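(* Let $(W,S)$ be a finite crystallographic Coxeter system. The assignment $[\gamma]\mapsto\tilde{\mathbf s}_\gamma$, $[-\gamma]\mapsto-\tilde{\mathbf s}_\gamma$ ($\gamma\in\Delta_+$), with $q_s$ acting by multiplication, defines a representation of the quantized bracket algebra $qBE(W,S)$ on $\mathbb R[q_s\mid s\in S]\langle W\rangle$, where $\tilde{\mathbf s}_\gamma$ is the $\mathbb R[q_s]$-linear operator given on $w\in W$ by $\tilde{\mathbf s}_\gamma.w=ws_\gamma$ if $l(w)=l(ws_\gamma)-1$; $\tilde{\mathbf s}_\gamma.w=q_{\gamma^\vee}\,ws_\gamma$ if $l(w)=l(ws_\gamma)+2(\rho,\gamma^\vee)-1$; and $\tilde{\mathbf s}_\gamma.w=0$ otherwise.
   Context: $V$ is the real vector space with basis $\{\alpha_s\}_{s\in S}$, $W$ acting by reflections; $\Delta$ is the root system normalized so that $2(\gamma,\gamma')/(\gamma,\gamma)\in\mathbb Z$, $\Delta_+$ the positive roots, $s_\gamma$ the reflection in $\gamma$, $l$ the length function, $\gamma^\vee=2\gamma/(\gamma,\gamma)$, $\rho=\frac12\sum_{\gamma\in\Delta_+}\gamma$. For $\gamma^\vee=\sum_s n_s\alpha_s^\vee$ put $q_{\gamma^\vee}=\prod_s q_s^{n_s}$ ($q_s$ indeterminates). $qBE(W,S)$: associative algebra over $\mathbb R[q_s\mid s\in S]$ with generators $[\gamma]$, $\gamma\in\Delta$, relations (i) $[-\gamma]=-[\gamma]$; (ii) for $\gamma\in\Delta_+$, $[\gamma]^2=q_s$ if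 $\gamma=\alpha_s$, and $[\gamma]^2=0$ otherwise; (iii) whenever $\gamma_0,\dots,\gamma_{m-1}\in\Delta_+$ ($m\ge2$) are such that $\{\pm\gamma_i\}$ is a root system of type $I_2(m)$ and $\mathbb R_{\ge0}\gamma_i+\mathbb R_{\ge0}\gamma_{i+1}$ meets $\Delta_+$ exactly in $\{\gamma_i,\gamma_{i+1}\}$ ($i=0,\dots,m-2$), then with $\gamma_{j+m}=-\gamma_j$: $\sum_{i=0}^{m-1}[\gamma_i][\gamma_{i+k}]=0$ for each integer $1\le k\le m/2$; (iv) for such $\gamma_i$ with $m\ge4$, $k=\lfloor m/2\rfloor-1$ and $l(s_{\gamma_k})\ne2(\rho,\gamma_k^\vee)-1$: $[\gamma_k][\gamma_0]\cdots[\gamma_{2k}]+[\gamma_0]\cdots[\gamma_{2k}][\gamma_k]+[\gamma_k][\gamma_{2k}]\cdots[\gamma_0]+[\gamma_{2k}]\cdots[\gamma_0][\gamma_k]=0$. *)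

theory Defs
  imports
    "HOL-Analysis.Inner_Product"
    "HOL-Library.Poly_Mapping"
    "HOL-Algebra.Multiplicative_Group"
    "HOL-Algebra.Generated_Groups"
    "HOL-Algebra.Group_Action"
    "HOL-Algebra.QuotRing"
    "HOL-Algebra.Module"
begin

unbundle inner_syntax

section \<open>Coxeter systems\<close>

definition word_prod :: "('w, 'b) monoid_scheme \<Rightarrow> 'w list \<Rightarrow> 'w" where
  "word_prod W ws = foldr (\<otimes>\<^bsub>W\<^esub>) ws \<one>\<^bsub>W\<^esub>"

text \<open>Deletion of a relator \<open>(s t)\<^bsup>m(s,t)\<^esup>\<close>, with \<open>m(s,t)\<close> the order of \<open>s t\<close>, from a word.
  The case \<open>s = t\<close>, \<open>m(s,s) = 1\<close> is the relator \<open>s s\<close>; \<open>ord\<close> is 0 for elements of infinite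
  order, for which the relator is empty.\<close>

definition relator_deletion :: "('w, 'b) monoid_scheme \<Rightarrow> 'w set \<Rightarrow> 'w list \<Rightarrow> 'w list \<Rightarrow> bool" where
  "relator_deletion W S u v \<longleftrightarrow>
     (\<exists>a b s t. set a \<subseteq> S \<and> set b \<subseteq> S \<and> s \<in> S \<and> t \<in> S \<and>
        u = a @ concat (replicate (group.ord W (s \<otimes>\<^bsub>W\<^esub> t)) [s, t]) @ b \<and> v = a @ b)"

text \<open>The last conjunct says that \<open>W\<close> has the presentation
  \<open>\<langle>S | (s t)\<^bsup>m(s,t)\<^esup> = 1\<rangle>\<close>; monoid words suffice because the generators are involutions.\<close>

definition coxeter_system :: "('w, 'b) monoid_scheme \<Rightarrow> 'w set \<Rightarrow> bool" where
  "coxeter_system W S \<longleftrightarrow>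
     group W \<and> S \<subseteq> carrier W \<and>
     (\<forall>s\<in>S. s \<noteq> \<one>\<^bsub>W\<^esub> \<and> s \<otimes>\<^bsub>W\<^esub> s = \<one>\<^bsub>W\<^esub>) \<and>
     generate W S = carrier W \<and>
     (\<forall>ws. set ws \<subseteq> S \<longrightarrow> word_prod W ws = \<one>\<^bsub>W\<^esub> \<longrightarrow> equivclp (relator_deletion W S) ws [])"

definition cox_length :: "('w, 'b) monoid_scheme \<Rightarrow> 'w set \<Rightarrow> 'w \<Rightarrow> nat" where
  "cox_length W S w = (LEAST n. \<exists>ws. set ws \<subseteq> S \<and> length ws = n \<and> word_prod W ws = w)"


section \<open>Reflections and roots\<close>

definition reflection :: "'v::real_inner \<Rightarrow> 'v \<Rightarrow> 'v" where
  "reflection g v = v - (2 * (v \<bullet> g) / (g \<bullet> g)) *\<^sub>R g"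

definition coroot :: "'v::real_inner \<Rightarrow> 'v" where
  "coroot g = (2 / (g \<bullet> g)) *\<^sub>R g"

text \<open>\<open>V\<close> is \<open>span (\<alpha> ` S)\<close>, possibly inside a larger inner product space. The lengths of the
  \<open>\<alpha> s\<close> are left free, the angles are those of the geometric representation.\<close>

definition reflection_realization ::
  "('w, 'b) monoid_scheme \<Rightarrow> 'w set \<Rightarrow> ('w \<Rightarrow> 'v::real_inner) \<Rightarrow> ('w \<Rightarrow> 'v \<Rightarrow> 'v) \<Rightarrow> bool" where
  "reflection_realization W S \<alpha> act \<longleftrightarrow>
     inj_on \<alpha> S \<and> independent (\<alpha> ` S) \<and>
     (\<forall>s\<in>S. \<forall>t\<in>S. \<alpha> s \<bullet> \<alpha> t = - norm (\<alpha> s) * norm (\<alpha> t) * cos (pi / real (group.ord W (s \<otimes>\<^bsub>W\<^esub> t)))) \<and>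
     group_action W (span (\<alpha> ` S)) act \<and>
     (\<forall>s\<in>S. \<forall>v\<in>span (\<alpha> ` S). act s v = reflection (\<alpha> s) v)"

definition roots :: "('w, 'b) monoid_scheme \<Rightarrow> 'w set \<Rightarrow> ('w \<Rightarrow> 'v) \<Rightarrow> ('w \<Rightarrow> 'v \<Rightarrow> 'v) \<Rightarrow> 'v set" where
  "roots W S \<alpha> act = {act w (\<alpha> s) | w s. w \<in> carrier W \<and> s \<in> S}"

definition crystallographic :: "'v::real_inner set \<Rightarrow> bool" where
  "crystallographic R \<longleftrightarrow> (\<forall>g\<in>R. \<forall>h\<in>R. 2 * (g \<bullet> h) / (g \<bullet> g) \<in> \<int>)"

definition pos_roots ::
  "('w, 'b) monoid_scheme \<Rightarrow> 'w set \<Rightarrow> ('w \<Rightarrow> 'v::real_inner) \<Rightarrow> ('w \<Rightarrow> 'v \<Rightarrow> 'v) \<Rightarrow> 'v set" where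
  "pos_roots W S \<alpha> act =
     {g \<in> roots W S \<alpha> act. \<exists>c. (\<forall>s\<in>S. 0 \<le> c s) \<and> g = (\<Sum>s\<in>S. c s *\<^sub>R \<alpha> s)}"

definition rho :: "('w, 'b) monoid_scheme \<Rightarrow> 'w set \<Rightarrow> ('w \<Rightarrow> 'v::real_inner) \<Rightarrow> ('w \<Rightarrow> 'v \<Rightarrow> 'v) \<Rightarrow> 'v" where
  "rho W S \<alpha> act = (1 / 2) *\<^sub>R (\<Sum>g\<in>pos_roots W S \<alpha> act. g)"

definition refl_elt ::
  "('w, 'b) monoid_scheme \<Rightarrow> 'w set \<Rightarrow> ('w \<Rightarrow> 'v::real_inner) \<Rightarrow> ('w \<Rightarrow> 'v \<Rightarrow> 'v) \<Rightarrow> 'v \<Rightarrow> 'w" where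
  "refl_elt W S \<alpha> act g =
     (THE w. w \<in> carrier W \<and> (\<forall>v\<in>span (\<alpha> ` S). act w v = reflection g v))"

definition coroot_coeffs :: "'w set \<Rightarrow> ('w \<Rightarrow> 'v::real_inner) \<Rightarrow> 'v \<Rightarrow> 'w \<Rightarrow> nat" where
  "coroot_coeffs S \<alpha> g =
     (THE n. (\<forall>s. s \<notin> S \<longrightarrow> n s = 0) \<and> coroot g = (\<Sum>s\<in>S. real (n s) *\<^sub>R coroot (\<alpha> s)))"


section \<open>Root systems of type $I_2(m)$\<close>

definition root_system :: "'v::real_inner set \<Rightarrow> bool" where
  "root_system R \<longleftrightarrow> finite R \<and> 0 \<notin> R \<and>
     (\<forall>g\<in>R. R \<inter> span {g} = {g, - g}) \<and> (\<forall>g\<in>R. reflection g ` R = R)"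

text \<open>There is a simple system \<open>{a, b}\<close> whose Coxeter graph is $I_2(m)$, that is, the angle
  between \<open>a\<close> and \<open>b\<close> is $\pi - \pi/m$.\<close>

definition root_system_I2 :: "nat \<Rightarrow> 'v::real_inner set \<Rightarrow> bool" where
  "root_system_I2 m R \<longleftrightarrow> 2 \<le> m \<and> root_system R \<and>
     (\<exists>a\<in>R. \<exists>b\<in>R. a \<noteq> b \<and> independent {a, b} \<and>
        (\<forall>g\<in>R. \<exists>x y. g = x *\<^sub>R a + y *\<^sub>R b \<and> (0 \<le> x \<and> 0 \<le> y \<or> x \<le> 0 \<and> y \<le> 0)) \<and>
        a \<bullet> b = - norm a * norm b * cos (pi / real m))"

text \<open>The sequences of the third and fourth family of relations, already continued by
  \<open>g (j + m) = - g j\<close>.\<close>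

definition dihedral_sequence :: "'v::real_inner set \<Rightarrow> nat \<Rightarrow> (nat \<Rightarrow> 'v) \<Rightarrow> bool" where
  "dihedral_sequence P m g \<longleftrightarrow>
     2 \<le> m \<and> (\<forall>i<m. g i \<in> P) \<and>
     root_system_I2 m (g ` {..<m} \<union> uminus ` g ` {..<m}) \<and>
     (\<forall>i. i + 1 < m \<longrightarrow>
        {x *\<^sub>R g i + y *\<^sub>R g (i + 1) | x y. 0 \<le> x \<and> 0 \<le> y} \<inter> P = {g i, g (i + 1)}) \<and>
     (\<forall>j. g (j + m) = - g j)"


section \<open>The polynomial ring and the free algebra\<close>

text \<open>\<open>'w qpoly\<close> has an indeterminate for every element of \<open>'w\<close>; the set \<open>qpolys S\<close>
  is $\mathbb{R}[q_s \mid s \in S]$.\<close>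

type_synonym 'w qpoly = "('w \<Rightarrow>\<^sub>0 nat) \<Rightarrow>\<^sub>0 real"

definition qpolys :: "'w set \<Rightarrow> 'w qpoly set" where
  "qpolys S = {p. \<forall>m\<in>Poly_Mapping.keys p. Poly_Mapping.keys m \<subseteq> S}"

definition qvar :: "'w \<Rightarrow> 'w qpoly" where
  "qvar s = Poly_Mapping.single (Poly_Mapping.single s 1) 1"

definition qpoly_ring :: "'w set \<Rightarrow> 'w qpoly ring" where
  "qpoly_ring S = \<lparr>carrier = qpolys S, mult = (*), one = 1, zero = 0, add = (+)\<rparr>"

definition q_coroot :: "'w set \<Rightarrow> ('w \<Rightarrow> 'v::real_inner) \<Rightarrow> 'v \<Rightarrow> 'w qpoly" where
  "q_coroot S \<alpha> g = (\<Prod>s\<in>S. qvar s ^ coroot_coeffs S \<alpha> g s)"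

text \<open>Words form the free monoid, written additively: the product of \<open>'m \<Rightarrow>\<^sub>0 'r\<close> is the
  monoid algebra product for the addition of \<open>'m\<close>. So \<open>'a word \<Rightarrow>\<^sub>0 'r\<close> is the free
  associative \<open>'r\<close>-algebra on \<open>'a\<close>.\<close>

datatype 'a word = Word (letters: "'a list")

instantiation word :: (type) monoid_add
begin

definition zero_word :: "'a word" where "0 = Word []"

definition plus_word :: "'a word \<Rightarrow> 'a word \<Rightarrow> 'a word" where
  "u + v = Word (letters u @ letters v)"

instance
  by standard (simp_all add: zero_word_def plus_word_def)

end

type_synonym ('v, 'w) free_alg = "'v word \<Rightarrow>\<^sub>0 'w qpoly"

definition gen :: "'v \<Rightarrow> ('v, 'w) free_alg" where
  "gen g = Poly_Mapping.single (Word [g]) 1"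

definition scal :: "'w qpoly \<Rightarrow> ('v, 'w) free_alg" where
  "scal p = Poly_Mapping.single 0 p"

definition free_algebra :: "'w set \<Rightarrow> 'v set \<Rightarrow> ('v, 'w) free_alg ring" where
  "free_algebra S D =
     \<lparr>carrier = {x. \<forall>u\<in>Poly_Mapping.keys x. set (letters u) \<subseteq> D \<and> Poly_Mapping.lookup x u \<in> qpolys S},
      mult = (*), one = 1, zero = 0, add = (+)\<rparr>"


section \<open>The quantized bracket algebra\<close>

definition relators_neg :: "'v::real_inner set \<Rightarrow> ('v, 'w) free_alg set" where
  "relators_neg D = {gen (- g) + gen g | g. g \<in> D}"

definition relators_square ::
  "'w set \<Rightarrow> ('w \<Rightarrow> 'v::real_inner) \<Rightarrow> 'v set \<Rightarrow> ('v, 'w) free_alg set" where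
  "relators_square S \<alpha> P =
     {gen (\<alpha> s) * gen (\<alpha> s) - scal (qvar s) | s. s \<in> S} \<union>
     {gen g * gen g | g. g \<in> P \<and> g \<notin> \<alpha> ` S}"

definition relators_quadratic :: "'v::real_inner set \<Rightarrow> ('v, 'w) free_alg set" where
  "relators_quadratic P =
     {\<Sum>i<m. gen (g i) * gen (g (i + k)) | m g k. dihedral_sequence P m g \<and> 1 \<le> k \<and> 2 * k \<le> m}"

definition four_term :: "nat \<Rightarrow> (nat \<Rightarrow> 'v) \<Rightarrow> ('v, 'w) free_alg" where
  "four_term k g =
     (let up = prod_list (map (\<lambda>i. gen (g i)) [0..<2 * k + 1]);
          down = prod_list (map (\<lambda>i. gen (g i)) (rev [0..<2 * k + 1]))
      in gen (g k) * up + up * gen (g k) + gen (g k) * down + down * gen (g k))"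

definition relators_four_term ::
  "('w, 'b) monoid_scheme \<Rightarrow> 'w set \<Rightarrow> ('w \<Rightarrow> 'v::real_inner) \<Rightarrow> ('w \<Rightarrow> 'v \<Rightarrow> 'v)
     \<Rightarrow> ('v, 'w) free_alg set" where
  "relators_four_term W S \<alpha> act =
     {four_term k g | m g k. dihedral_sequence (pos_roots W S \<alpha> act) m g \<and> 4 \<le> m \<and>
        k = m div 2 - 1 \<and>
        real (cox_length W S (refl_elt W S \<alpha> act (g k))) \<noteq> 2 * (rho W S \<alpha> act \<bullet> coroot (g k)) - 1}"

definition qBE_relators ::
  "('w, 'b) monoid_scheme \<Rightarrow> 'w set \<Rightarrow> ('w \<Rightarrow> 'v::real_inner) \<Rightarrow> ('w \<Rightarrow> 'v \<Rightarrow> 'v)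
     \<Rightarrow> ('v, 'w) free_alg set" where
  "qBE_relators W S \<alpha> act =
     relators_neg (roots W S \<alpha> act) \<union> relators_square S \<alpha> (pos_roots W S \<alpha> act) \<union>
     relators_quadratic (pos_roots W S \<alpha> act) \<union> relators_four_term W S \<alpha> act"

definition qBE_ideal ::
  "('w, 'b) monoid_scheme \<Rightarrow> 'w set \<Rightarrow> ('w \<Rightarrow> 'v::real_inner) \<Rightarrow> ('w \<Rightarrow> 'v \<Rightarrow> 'v)
     \<Rightarrow> ('v, 'w) free_alg set" where
  "qBE_ideal W S \<alpha> act = genideal (free_algebra S (roots W S \<alpha> act)) (qBE_relators W S \<alpha> act)"

definition qBE ::
  "('w, 'b) monoid_scheme \<Rightarrow> 'w set \<Rightarrow> ('w \<Rightarrow> 'v::real_inner) \<Rightarrow> ('w \<Rightarrow> 'v \<Rightarrow> 'v)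
     \<Rightarrow> ('v, 'w) free_alg set ring" where
  "qBE W S \<alpha> act = free_algebra S (roots W S \<alpha> act) Quot qBE_ideal W S \<alpha> act"

text \<open>The class in \<open>qBE\<close> of an element of the free algebra.\<close>

definition qBE_class ::
  "('w, 'b) monoid_scheme \<Rightarrow> 'w set \<Rightarrow> ('w \<Rightarrow> 'v::real_inner) \<Rightarrow> ('w \<Rightarrow> 'v \<Rightarrow> 'v)
     \<Rightarrow> ('v, 'w) free_alg \<Rightarrow> ('v, 'w) free_alg set" where
  "qBE_class W S \<alpha> act x = qBE_ideal W S \<alpha> act +>\<^bsub>free_algebra S (roots W S \<alpha> act)\<^esub> x"


section \<open>The module and the operators\<close>

definition module_End :: "('r, 'x) ring_scheme \<Rightarrow> ('r, 'm, 'y) module_scheme \<Rightarrow> ('m \<Rightarrow> 'm) ring" where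
  "module_End R M =
     \<lparr>carrier = {f \<in> carrier M \<rightarrow>\<^sub>E carrier M.
         (\<forall>x\<in>carrier M. \<forall>y\<in>carrier M. f (x \<oplus>\<^bsub>M\<^esub> y) = f x \<oplus>\<^bsub>M\<^esub> f y) \<and>
         (\<forall>a\<in>carrier R. \<forall>x\<in>carrier M. f (a \<odot>\<^bsub>M\<^esub> x) = a \<odot>\<^bsub>M\<^esub> f x)},
      mult = compose (carrier M),
      one = (\<lambda>x\<in>carrier M. x),
      zero = (\<lambda>x\<in>carrier M. \<zero>\<^bsub>M\<^esub>),
      add = (\<lambda>f g. \<lambda>x\<in>carrier M. f x \<oplus>\<^bsub>M\<^esub> g x)\<rparr>"

text \<open>$\mathbb{R}[q_s \mid s \in S]\langle W\rangle$; the ring multiplication fields of the record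
  \<open>module\<close> play no role.\<close>

definition W_module ::
  "('w, 'b) monoid_scheme \<Rightarrow> 'w set \<Rightarrow> ('w qpoly, 'w \<Rightarrow>\<^sub>0 'w qpoly) module" where
  "W_module W S =
     \<lparr>carrier = {x. Poly_Mapping.keys x \<subseteq> carrier W \<and> (\<forall>w. Poly_Mapping.lookup x w \<in> qpolys S)},
      mult = undefined, one = undefined, zero = 0, add = (+),
      smult = (\<lambda>p. Poly_Mapping.map ((*) p))\<rparr>"

definition s_tilde_basis ::
  "('w, 'b) monoid_scheme \<Rightarrow> 'w set \<Rightarrow> ('w \<Rightarrow> 'v::real_inner) \<Rightarrow> ('w \<Rightarrow> 'v \<Rightarrow> 'v)
     \<Rightarrow> 'v \<Rightarrow> 'w \<Rightarrow> ('w \<Rightarrow>\<^sub>0 'w qpoly)" where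
  "s_tilde_basis W S \<alpha> act g w =
     (let u = w \<otimes>\<^bsub>W\<^esub> refl_elt W S \<alpha> act g;
          lw = real (cox_length W S w); lu = real (cox_length W S u)
      in if lw = lu - 1 then Poly_Mapping.single u 1
         else if lw = lu + 2 * (rho W S \<alpha> act \<bullet> coroot g) - 1
           then Poly_Mapping.single u (q_coroot S \<alpha> g)
         else 0)"

definition s_tilde ::
  "('w, 'b) monoid_scheme \<Rightarrow> 'w set \<Rightarrow> ('w \<Rightarrow> 'v::real_inner) \<Rightarrow> ('w \<Rightarrow> 'v \<Rightarrow> 'v)
     \<Rightarrow> 'v \<Rightarrow> ('w \<Rightarrow>\<^sub>0 'w qpoly) \<Rightarrow> ('w \<Rightarrow>\<^sub>0 'w qpoly)" where
  "s_tilde W S \<alpha> act g =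
     (\<lambda>x\<in>carrier (W_module W S). \<Sum>w\<in>Poly_Mapping.keys x.
        Poly_Mapping.lookup x w \<odot>\<^bsub>W_module W S\<^esub> s_tilde_basis W S \<alpha> act g w)"

end

(*
  Writing ws for w s_gamma, both lengths occurring in the operators are sums over the set N of
  positive roots made negative by s_gamma:
    l(ws) - l(w) = sum of sgn(w beta),    2(rho, gamma^vee) = sum of (beta, gamma^vee),
  beta ranging over N, where (beta, gamma^vee) >= 1 for all beta in N, and = 2 for beta = gamma. The
  first formula needs that l(w) counts the positive roots made negative by w (Tits). Hence
  l(ws) = l(w) + 1 forces w gamma > 0 and opposite signs at w beta and w(-s_gamma beta) for beta in
  N other than gamma, while l(w) = l(ws) + 2(rho, gamma^vee) - 1 forces all w beta to be negative
  and all those (beta, gamma^vee) to be 1. Both conditions restrict to a plane of roots. So along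
  the reflections of a dihedral subgroup every edge of the quantum Bruhat graph of W is an edge of
  the quantum Bruhat graph of that subgroup, whereas an edge of the latter from w to ws of
  weight q^mu only satisfies l(ws) - l(w) + 2(rho, mu) >= 1, with equality for the edges of W. A
  path of the subgroup is therefore a path of W if and only if equality holds in the sum of these
  inequalities, which depends only on the end points and the total weight. This reduces
  the quadratic relations to a cancellation of paths in the dihedral groups with 4, 6, 8 and
  12 elements; in the four term relation no path at all survives once s_(gamma_k) is not allowed to
  go down.
*)

theory Submission
  imports Defs
begin

text \<open>Two obstacles stand between the roots and finite tables. The count of inversions rests
  on Tits's theorem that \<open>w\<close> sends \<open>\<alpha> s\<close> to a positive root when
  \<open>w s\<close> is longer than \<open>w\<close>. Its induction splits off a right factor in two
  simple reflections, and the rank two case left over is a list of integer recursions, because the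
  crystallographic condition confines the two Cartan integers to six pairs. The second obstacle is
  that a dihedral sequence is given by the set of its roots and by empty cones between neighbours,
  with neither the distinctness of the roots nor their Cartan integers stated. Counting roots and
  reflecting inside adjacent cones turns it into a recursion
  \<open>\<rho> (j + 1) = C j \<rho> j - \<rho> (j - 1)\<close> whose coefficients alternate between
  two integers, again one of the six pairs. Indexed by all integers with period \<open>2 m\<close>,
  such a fan makes a reflection the map from \<open>j\<close> to \<open>2 i - j\<close> up to sign,
  and it remembers of a group element only the residue at which its positive roots start. Paths
  become sequences of residues, weights become pairs of integers.\<close>

section \<open>Reflections in an inner product space\<close>

lemma reflection_add: "reflection g (x + y) = reflection g x + reflection g y"
  by (simp add: reflection_def inner_add_left add_divide_distrib algebra_simps)

lemma reflection_scaleR: "reflection g (c *\<^sub>R x) = c *\<^sub>R reflection g x"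
  by (simp add: reflection_def algebra_simps)

lemma linear_reflection: "linear (reflection g)"
  by (intro linearI reflection_add reflection_scaleR)

lemma reflection_inner:
  fixes g :: "'v::real_inner"
  shows "reflection g x \<bullet> reflection g y = x \<bullet> y"
proof (cases "g = 0")
  case False
  then have "g \<bullet> g \<noteq> 0" by simp
  then show ?thesis
    by (simp add: reflection_def inner_diff_left inner_diff_right inner_commute field_simps)
qed (simp add: reflection_def)

lemma reflection_self: "reflection g g = - (g::'v::real_inner)"
  by (cases "g = 0") (simp_all add: reflection_def scaleR_2)

lemma reflection_invol: "reflection g (reflection g x) = (x::'v::real_inner)"
proof (cases "g = 0")
  case False
  then have "g \<bullet> g \<noteq> 0" by simp
  then show ?thesis
    by (simp add: reflection_def inner_diff_left algebra_simps)
qed (simp add: reflection_def)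

lemma reflection_coroot: "reflection g v = v - (v \<bullet> coroot g) *\<^sub>R (g::'v::real_inner)"
  by (simp add: reflection_def coroot_def)

lemma coroot_self: "g \<noteq> 0 \<Longrightarrow> g \<bullet> coroot g = (2::real)"
  by (simp add: coroot_def)

locale crystallographic_coxeter =
  fixes W :: "('w, 'b) monoid_scheme" (structure) and S :: "'w set"
    and \<alpha> :: "'w \<Rightarrow> 'v::real_inner" and act :: "'w \<Rightarrow> 'v \<Rightarrow> 'v"
  assumes coxeter: "coxeter_system W S" and finite_W: "finite (carrier W)"
    and realization: "reflection_realization W S \<alpha> act"
    and cryst: "crystallographic (roots W S \<alpha> act)"
begin

sublocale group W
  using coxeter by (simp add: coxeter_system_def)

abbreviation len :: "'w \<Rightarrow> nat" where "len \<equiv> cox_length W S"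
abbreviation prd :: "'w list \<Rightarrow> 'w" where "prd \<equiv> word_prod W"
abbreviation V :: "'v set" where "V \<equiv> span (\<alpha> ` S)"
abbreviation \<Delta> :: "'v set" where "\<Delta> \<equiv> roots W S \<alpha> act"
abbreviation P :: "'v set" where "P \<equiv> pos_roots W S \<alpha> act"

section \<open>Words, parity and length\<close>

lemma S_carrier: "s \<in> S \<Longrightarrow> s \<in> carrier W"
  using coxeter by (auto simp: coxeter_system_def)

lemma S_subset: "S \<subseteq> carrier W"
  using S_carrier by blast

lemma S_not_one: "s \<in> S \<Longrightarrow> s \<noteq> \<one>"
  using coxeter by (auto simp: coxeter_system_def)

lemma S_sq: "s \<in> S \<Longrightarrow> s \<otimes> s = \<one>"
  using coxeter by (auto simp: coxeter_system_def)

lemma finite_S: "finite S"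
  using S_subset finite_W finite_subset by blast

lemma prd_Nil [simp]: "prd [] = \<one>"
  by (simp add: word_prod_def)

lemma prd_Cons [simp]: "prd (s # ws) = s \<otimes> prd ws"
  by (simp add: word_prod_def)

lemma prd_closed [simp]: "set ws \<subseteq> S \<Longrightarrow> prd ws \<in> carrier W"
  by (induction ws) (auto simp: S_carrier)

lemma prd_append: "set us \<subseteq> S \<Longrightarrow> set vs \<subseteq> S \<Longrightarrow> prd (us @ vs) = prd us \<otimes> prd vs"
  by (induction us) (auto simp: S_carrier m_assoc)

lemma prd_rev: "set us \<subseteq> S \<Longrightarrow> prd us \<otimes> prd (rev us) = \<one>"
proof (induction us)
  case (Cons s us)
  have "prd (s # us) \<otimes> prd (rev (s # us)) = s \<otimes> (prd us \<otimes> prd (rev us)) \<otimes> s"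
    using Cons.prems by (simp add: prd_append S_carrier m_assoc)
  then show ?case
    using Cons by (simp add: S_carrier S_sq)
qed simp

lemma word_exists: "w \<in> carrier W \<Longrightarrow> \<exists>ws. set ws \<subseteq> S \<and> prd ws = w"
proof -
  assume "w \<in> carrier W"
  then have "w \<in> generate W S"
    using coxeter by (simp add: coxeter_system_def)
  then show ?thesis
  proof (induction rule: generate.induct)
    case one
    then show ?case by (intro exI[of _ "[]"]) simp
  next
    case (incl h)
    then show ?case by (intro exI[of _ "[h]"]) (simp add: S_carrier)
  next
    case (inv h)
    then have "inv h = h"
      using S_carrier S_sq inv_equality by blast
    then show ?case using inv by (intro exI[of _ "[h]"]) (simp add: S_carrier)
  next
    case (eng h1 h2)
    then show ?case by (metis prd_append set_append sup.bounded_iff)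
  qed
qed

lemma len_le: "set ws \<subseteq> S \<Longrightarrow> len (prd ws) \<le> length ws"
  unfolding cox_length_def by (rule Least_le) blast

lemma reduced_exists:
  assumes "w \<in> carrier W"
  shows "\<exists>ws. set ws \<subseteq> S \<and> length ws = len w \<and> prd ws = w"
proof -
  obtain ws where "set ws \<subseteq> S" "prd ws = w" using word_exists[OF assms] by blast
  then have "\<exists>n ws. set ws \<subseteq> S \<and> length ws = n \<and> prd ws = w" by blast
  from LeastI_ex[OF this] show ?thesis
    by (simp add: cox_length_def)
qed

lemma len_one [simp]: "len \<one> = 0"
  using len_le[of "[]"] by simp

lemma len_0_iff: "w \<in> carrier W \<Longrightarrow> len w = 0 \<longleftrightarrow> w = \<one>"
  using reduced_exists[of w] by fastforce

lemma len_mult_le: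
  assumes "v \<in> carrier W" "w \<in> carrier W"
  shows "len (v \<otimes> w) \<le> len v + len w"
proof -
  obtain us vs where "set us \<subseteq> S" "length us = len v" "prd us = v"
    "set vs \<subseteq> S" "length vs = len w" "prd vs = w"
    using reduced_exists assms by meson
  then show ?thesis
    using len_le[of "us @ vs"] by (simp add: prd_append)
qed

lemma len_s: "s \<in> S \<Longrightarrow> len s = 1"
proof -
  assume s: "s \<in> S"
  have "len s \<le> 1" using len_le[of "[s]"] s by (simp add: S_carrier)
  moreover have "len s \<noteq> 0" using s len_0_iff S_carrier S_not_one by blast
  ultimately show ?thesis by simp
qed

text \<open>Each relator \<open>(s t)^n\<close> has even length. This is how the presentation
  enters: word length modulo 2 is well defined on \<open>W\<close>, so \<open>w s\<close> and
  \<open>w\<close> never have the same length.\<close>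

lemma even_relator:
  assumes "relator_deletion W S u v"
  shows "even (length u) = even (length v)"
proof -
  have "even (length (concat (replicate n [s, t])))" for n and s t :: 'w
    by (induction n) auto
  then show ?thesis using assms unfolding relator_deletion_def by (elim exE conjE) simp
qed

lemma even_word: "set ws \<subseteq> S \<Longrightarrow> prd ws = \<one> \<Longrightarrow> even (length ws)"
proof -
  assume "set ws \<subseteq> S" "prd ws = \<one>"
  then have "equivclp (relator_deletion W S) ws []"
    using coxeter by (simp add: coxeter_system_def)
  then have "even (length ws) = even (length ([]::'w list))"
    by (induction rule: equivclp_induct) (auto dest: even_relator)
  then show ?thesis by simp
qed

lemma parity_word:
  assumes "set us \<subseteq> S" "set vs \<subseteq> S" "prd us = prd vs"
  shows "even (length us) = even (length vs)"
proof -
  have "prd (us @ rev vs) = \<one>"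
    using assms by (simp add: prd_append prd_rev)
  then have "even (length (us @ rev vs))"
    using assms by (intro even_word) auto
  then show ?thesis by simp
qed

lemma len_mult_s_neq:
  assumes "w \<in> carrier W" "s \<in> S"
  shows "len (w \<otimes> s) \<noteq> len w"
proof
  assume eq: "len (w \<otimes> s) = len w"
  obtain us where us: "set us \<subseteq> S" "length us = len w" "prd us = w"
    using reduced_exists assms by blast
  obtain vs where vs: "set vs \<subseteq> S" "length vs = len (w \<otimes> s)" "prd vs = w \<otimes> s"
    using reduced_exists[of "w \<otimes> s"] assms S_carrier by blast
  have "prd (us @ [s]) = prd vs" using us vs assms by (simp add: prd_append S_carrier)
  then have "even (length (us @ [s])) = even (length vs)"
    using us vs assms by (intro parity_word) auto
  then show False using us vs eq by auto
qed

lemma mult_s_s: "w \<in> carrier W \<Longrightarrow> s \<in> S \<Longrightarrow> w \<otimes> s \<otimes> s = w"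
  by (simp add: m_assoc S_carrier S_sq)

lemma len_mult_s:
  assumes "w \<in> carrier W" "s \<in> S"
  shows "len (w \<otimes> s) = len w + 1 \<or> len w = len (w \<otimes> s) + 1"
proof -
  have "len (w \<otimes> s) \<le> len w + 1"
    using len_mult_le[of w s] len_s assms S_carrier by auto
  moreover have "len w \<le> len (w \<otimes> s) + 1"
    using len_mult_le[of "w \<otimes> s" s] len_s assms S_carrier mult_s_s by auto
  ultimately show ?thesis using len_mult_s_neq[OF assms] by linarith
qed

lemma descent_exists:
  assumes "w \<in> carrier W" "w \<noteq> \<one>"
  shows "\<exists>t\<in>S. len w = len (w \<otimes> t) + 1"
proof -
  obtain us where us: "set us \<subseteq> S" "length us = len w" "prd us = w"
    using reduced_exists assms by blast
  have "us \<noteq> []" using us assms by auto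
  then obtain vs t where vt: "us = vs @ [t]" by (metis rev_exhaust)
  then have t: "t \<in> S" "set vs \<subseteq> S" using us by auto
  have "w \<otimes> t = prd vs"
    using us(3) t mult_s_s[of "prd vs" t] by (simp add: vt prd_append S_carrier)
  then have "len (w \<otimes> t) < len w"
    using len_le[of vs] us vt t by auto
  then show ?thesis using len_mult_s[of w t] assms t by force
qed

section \<open>The geometric representation\<close>

lemma \<alpha>_independent: "independent (\<alpha> ` S)"
  using realization by (simp add: reflection_realization_def)

lemma \<alpha>_inj: "inj_on \<alpha> S"
  using realization by (simp add: reflection_realization_def)

lemma \<alpha>_nonzero: "s \<in> S \<Longrightarrow> \<alpha> s \<noteq> 0"
  using \<alpha>_independent dependent_zero by (metis imageI)

lemma \<alpha>_V: "s \<in> S \<Longrightarrow> \<alpha> s \<in> V"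
  by (simp add: span_base)

lemma \<alpha>_inner: "s \<in> S \<Longrightarrow> t \<in> S \<Longrightarrow>
  \<alpha> s \<bullet> \<alpha> t = - norm (\<alpha> s) * norm (\<alpha> t) * cos (pi / real (ord (s \<otimes> t)))"
  using realization by (simp add: reflection_realization_def)

lemma group_hom_act: "group_hom W (BijGroup V) act"
  using realization by (simp add: reflection_realization_def group_action_def)

lemma act_Bij: "w \<in> carrier W \<Longrightarrow> act w \<in> Bij V"
  using group_hom.hom_closed[OF group_hom_act] by (simp add: BijGroup_def)

lemma act_closed: "w \<in> carrier W \<Longrightarrow> v \<in> V \<Longrightarrow> act w v \<in> V"
  using act_Bij by (auto simp: Bij_def bij_betw_def)

lemma act_mult: "v \<in> carrier W \<Longrightarrow> w \<in> carrier W \<Longrightarrow> x \<in> V \<Longrightarrow> act (v \<otimes> w) x = act v (act w x)"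
  using group_hom.hom_mult[OF group_hom_act, of v w] act_Bij[of v] act_Bij[of w]
  by (simp add: BijGroup_def compose_def)

lemma act_one: "x \<in> V \<Longrightarrow> act \<one> x = x"
  using group_hom.hom_one[OF group_hom_act] by (simp add: BijGroup_def)

lemma act_s: "s \<in> S \<Longrightarrow> x \<in> V \<Longrightarrow> act s x = reflection (\<alpha> s) x"
  using realization by (simp add: reflection_realization_def)

text \<open>Each \<open>act w\<close> is extensional on \<open>V\<close>, hence linear only there.
  Composing reflections of the ambient space gives a map that is linear and isometric everywhere,
  free of membership side conditions.\<close>

definition wact :: "'w list \<Rightarrow> 'v \<Rightarrow> 'v" where
  "wact ws = foldr (\<lambda>s. reflection (\<alpha> s)) ws"

lemma wact_Nil [simp]: "wact [] v = v"
  by (simp add: wact_def)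

lemma wact_Cons [simp]: "wact (s # ws) v = reflection (\<alpha> s) (wact ws v)"
  by (simp add: wact_def)

lemma wact_append [simp]: "wact (us @ vs) v = wact us (wact vs v)"
  by (simp add: wact_def)

lemma linear_wact: "linear (wact ws)"
proof (induction ws)
  case Nil
  show ?case by (intro linearI) simp_all
next
  case (Cons s ws)
  then show ?case
    by (intro linearI) (simp_all add: linear_add linear_scale reflection_add reflection_scaleR)
qed

lemma wact_inner: "wact ws x \<bullet> wact ws y = x \<bullet> y"
  by (induction ws) (simp_all add: reflection_inner)

lemma act_prd: "set ws \<subseteq> S \<Longrightarrow> v \<in> V \<Longrightarrow> act (prd ws) v = wact ws v"
proof (induction ws)
  case (Cons s ws)
  then have "act (prd (s # ws)) v = act s (act (prd ws) v)"
    by (simp add: act_mult S_carrier)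
  also have "\<dots> = wact (s # ws) v"
    using Cons act_closed[of "prd ws" v] by (simp add: act_s)
  finally show ?case .
qed (simp add: act_one)

text \<open>A linear isometry of the whole ambient space that agrees with \<open>act w\<close> on \<open>V\<close>.\<close>

definition R :: "'w \<Rightarrow> 'v \<Rightarrow> 'v" where
  "R w = wact (SOME ws. set ws \<subseteq> S \<and> prd ws = w)"

lemma R_ex: "w \<in> carrier W \<Longrightarrow> \<exists>ws. set ws \<subseteq> S \<and> prd ws = w \<and> R w = wact ws"
  using someI_ex[OF word_exists] unfolding R_def by blast

lemma R_act: "w \<in> carrier W \<Longrightarrow> v \<in> V \<Longrightarrow> R w v = act w v"
  using R_ex act_prd by metis

lemma linear_R: "linear (R w)"
  unfolding R_def by (rule linear_wact)

lemma R_add: "R w (x + y) = R w x + R w y"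
  and R_diff: "R w (x - y) = R w x - R w y"
  and R_scaleR: "R w (c *\<^sub>R x) = c *\<^sub>R R w x"
  and R_neg: "R w (- x) = - R w x"
  using linear_R[of w] by (simp_all add: linear_add linear_diff linear_scale linear_neg)

lemma R_inner: "R w x \<bullet> R w y = x \<bullet> y"
  unfolding R_def by (rule wact_inner)

lemma R_V: "w \<in> carrier W \<Longrightarrow> v \<in> V \<Longrightarrow> R w v \<in> V"
  by (simp add: R_act act_closed)

lemma R_mult: "v \<in> carrier W \<Longrightarrow> w \<in> carrier W \<Longrightarrow> x \<in> V \<Longrightarrow> R (v \<otimes> w) x = R v (R w x)"
  by (simp add: R_act act_mult act_closed)

lemma R_one: "x \<in> V \<Longrightarrow> R \<one> x = x"
  by (simp add: R_act act_one)

lemma R_s: "s \<in> S \<Longrightarrow> x \<in> V \<Longrightarrow> R s x = reflection (\<alpha> s) x"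
  by (simp add: R_act act_s S_carrier)

lemma R_prd: "set ws \<subseteq> S \<Longrightarrow> v \<in> V \<Longrightarrow> R (prd ws) v = wact ws v"
  by (simp add: R_act act_prd)

lemma roots_alt: "\<Delta> = {R w (\<alpha> s) | w s. w \<in> carrier W \<and> s \<in> S}"
proof -
  have "x = act w (\<alpha> s) \<and> w \<in> carrier W \<and> s \<in> S \<longleftrightarrow> x = R w (\<alpha> s) \<and> w \<in> carrier W \<and> s \<in> S"
    for x w s by (auto simp: R_act \<alpha>_V)
  then show ?thesis by (simp add: roots_def)
qed

lemma \<Delta>_V: "\<beta> \<in> \<Delta> \<Longrightarrow> \<beta> \<in> V"
  unfolding roots_alt using R_V \<alpha>_V by blast

lemma \<alpha>_root: "s \<in> S \<Longrightarrow> \<alpha> s \<in> \<Delta>"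
  unfolding roots_alt using R_one[OF \<alpha>_V, of s, symmetric] one_closed by blast

lemma \<Delta>_closed:
  assumes "\<beta> \<in> \<Delta>" "w \<in> carrier W"
  shows "R w \<beta> \<in> \<Delta>"
proof -
  obtain v s where vs: "v \<in> carrier W" "s \<in> S" "\<beta> = R v (\<alpha> s)"
    using assms(1) unfolding roots_alt by blast
  then have "R w \<beta> = R (w \<otimes> v) (\<alpha> s)"
    using assms(2) by (simp add: R_mult \<alpha>_V)
  then show ?thesis using vs assms(2) m_closed unfolding roots_alt by blast
qed

lemma \<Delta>_neg: "\<beta> \<in> \<Delta> \<Longrightarrow> - \<beta> \<in> \<Delta>"
proof -
  assume "\<beta> \<in> \<Delta>"
  then obtain w s where ws: "w \<in> carrier W" "s \<in> S" "\<beta> = R w (\<alpha> s)"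
    unfolding roots_alt by blast
  have "R w (R s (\<alpha> s)) \<in> \<Delta>"
    using ws by (intro \<Delta>_closed \<alpha>_root) (auto simp: S_carrier)
  then show ?thesis using ws by (simp add: R_s \<alpha>_V reflection_self R_neg)
qed

lemma \<Delta>_nonzero: "\<beta> \<in> \<Delta> \<Longrightarrow> \<beta> \<noteq> 0"
proof
  assume "\<beta> \<in> \<Delta>" "\<beta> = 0"
  then obtain w s where ws: "s \<in> S" "R w (\<alpha> s) = 0"
    unfolding roots_alt by blast
  then show False using R_inner[of w "\<alpha> s" "\<alpha> s"] \<alpha>_nonzero by simp
qed

lemma finite_\<Delta>: "finite \<Delta>"
proof -
  have "\<Delta> = (\<lambda>(w, s). R w (\<alpha> s)) ` (carrier W \<times> S)"
    unfolding roots_alt by auto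
  then show ?thesis using finite_W finite_S by simp
qed

lemma pairing_int: "\<beta> \<in> \<Delta> \<Longrightarrow> \<gamma> \<in> \<Delta> \<Longrightarrow> \<beta> \<bullet> coroot \<gamma> \<in> \<int>"
  using cryst unfolding crystallographic_def coroot_def by (simp add: inner_commute[of \<beta> \<gamma>])

end

section \<open>Rank two: Cartan integers and alternating words\<close>

text \<open>The crystallographic restriction. The value \<open>k\<close> will be a product of two
  Cartan integers. For \<open>m >= 2\<close> it lies between 0 and 3, and since the cosine is
  nonnegative here and injective on \<open>[0, pi]\<close>, each value determines the angle.\<close>

lemma crystallographic_angle:
  fixes m :: nat and k :: int
  assumes "2 \<le> m" and k: "4 * (cos (pi / real m))\<^sup>2 = of_int k"
  shows "m = 2 \<and> k = 0 \<or> m = 3 \<and> k = 1 \<or> m = 4 \<and> k = 2 \<or> m = 6 \<and> k = 3"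
proof -
  let ?x = "pi / real m"
  have x: "0 < ?x" "?x \<le> pi / 2" "?x \<le> pi"
    using assms(1) by (auto simp: field_simps)
  have c0: "0 \<le> cos ?x" using x by (intro cos_ge_zero) auto
  have "cos ?x < cos 0" using x by (intro cos_monotone_0_pi) auto
  then have "(cos ?x)\<^sup>2 < 1" using c0 by (simp add: power_less_one_iff abs_square_less_1)
  then have "real_of_int k < 4" using k by linarith
  moreover have "0 \<le> real_of_int k" using k zero_le_power2[of "cos ?x"] by linarith
  ultimately have "k < 4" "k \<ge> 0" by linarith+
  then have k_cases: "k = 0 \<or> k = 1 \<or> k = 2 \<or> k = 3" by linarith
  have eq: "?x = y" if y: "real_of_int k / 4 = (cos y)\<^sup>2" "0 \<le> cos y" "0 \<le> y" "y \<le> pi" for y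
  proof -
    have "(cos ?x)\<^sup>2 = (cos y)\<^sup>2" using k y(1) by simp
    from power2_eq_imp_eq[OF this c0 y(2)] show ?thesis using x y(3,4) cos_inj_pi[of ?x y] by simp
  qed
  have "k = 0 \<and> ?x = pi / 2 \<or> k = 1 \<and> ?x = pi / 3 \<or> k = 2 \<and> ?x = pi / 4 \<or> k = 3 \<and> ?x = pi / 6"
    using k_cases eq[of "pi / 2"] eq[of "pi / 3"] eq[of "pi / 4"] eq[of "pi / 6"]
    by (elim disjE) (simp_all add: cos_60 cos_45 cos_30 power_divide)
  then show ?thesis using assms(1) by (auto simp: field_simps)
qed

text \<open>The Cartan matrices of finite type in rank two, \<open>A1 x A1\<close>,
  \<open>A2\<close>, \<open>B2\<close> and \<open>G2\<close>, with the signs of the off-diagonal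
  entries dropped.\<close>

lemma cartan_cases:
  fixes A B :: int
  assumes "0 \<le> A" "0 \<le> B" "A * B < 4" "A = 0 \<longleftrightarrow> B = 0"
  shows "A = 0 \<and> B = 0 \<or> A = 1 \<and> B = 1 \<or> A = 1 \<and> B = 2 \<or> A = 2 \<and> B = 1
    \<or> A = 1 \<and> B = 3 \<or> A = 3 \<and> B = 1"
proof (cases "A = 0")
  case False
  then have p: "1 \<le> A" "1 \<le> B" using assms by linarith+
  then have "1 * B \<le> A * B" "A * 1 \<le> A * B" by (intro mult_right_mono mult_left_mono; simp)+
  then have "A \<le> 3" "B \<le> 3" using assms by linarith+
  then have "A \<in> {1, 2, 3}" "B \<in> {1, 2, 3}" using p by auto
  then show ?thesis using assms by auto
qed (use assms in simp)

text \<open>The alternating word of length \<open>n\<close> that ends in \<open>s\<close>. Anchoring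
  it at its last letter suits right multiplication.\<close>

fun alt :: "'a \<Rightarrow> 'a \<Rightarrow> nat \<Rightarrow> 'a list" where
  "alt s t 0 = []"
| "alt s t (Suc n) = alt t s n @ [s]"

lemma alt_props: "length (alt s t n) = n" "set (alt s t n) \<subseteq> {s, t}"
  by (induction n arbitrary: s t) fastforce+

lemma alt_split: "\<exists>y. set y \<subseteq> {s, t} \<and> length y = j \<and> alt s t (j + k) = y @ alt s t k"
proof (induction k arbitrary: s t)
  case 0
  then show ?case using alt_props[of s t j] by auto
next
  case (Suc k)
  then obtain y where "set y \<subseteq> {t, s}" "length y = j" "alt t s (j + k) = y @ alt t s k" by blast
  then show ?case by (intro exI[of _ y]) auto
qed

context crystallographic_coxeter
begin

lemma alt_S: "s \<in> S \<Longrightarrow> t \<in> S \<Longrightarrow> set (alt s t n) \<subseteq> S"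
  using alt_props(2)[of s t n] by auto

text \<open>Read from the left, each new letter either cancels the last letter of the alternating
  word reached so far or extends it.\<close>

lemma word_alt:
  assumes "s \<in> S" "t \<in> S" "set z \<subseteq> {s, t}"
  shows "\<exists>n\<le>length z. prd z = prd (alt s t n) \<or> prd z = prd (alt t s n)"
  using assms(3)
proof (induction z rule: rev_induct)
  case Nil
  then show ?case by simp
next
  case (snoc a z)
  have *: "\<exists>n\<le>length (z @ [a]). prd (z @ [a]) = prd (alt a b n) \<or> prd (z @ [a]) = prd (alt b a n)"
    if ab: "a \<in> S" "b \<in> S" "set z \<subseteq> {a, b}"
      "n \<le> length z" "prd z = prd (alt a b n) \<or> prd z = prd (alt b a n)" for b n
  proof -
    have za: "prd (z @ [a]) = prd z \<otimes> a"
    proof -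
      have "set z \<subseteq> S" "set [a] \<subseteq> S" using ab by auto
      then show ?thesis using ab by (simp add: prd_append S_carrier)
    qed
    show ?thesis
    proof (cases n)
      case 0
      then show ?thesis using za ab by (intro exI[of _ 1]) (auto simp: S_carrier)
    next
      case (Suc k)
      from ab(5) show ?thesis
      proof
        assume "prd z = prd (alt a b n)"
        then have "prd z = prd (alt b a k) \<otimes> a"
          using Suc ab by (simp add: prd_append S_carrier alt_S)
        then have "prd (z @ [a]) = prd (alt b a k)"
          using za ab by (simp add: mult_s_s alt_S)
        then show ?thesis using Suc ab by (intro exI[of _ k]) auto
      next
        assume "prd z = prd (alt b a n)"
        then have "prd (z @ [a]) = prd (alt a b (Suc n))"
          using za ab by (simp add: prd_append S_carrier alt_S)
        then show ?thesis using ab by (intro exI[of _ "Suc n"]) auto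
      qed
    qed
  qed
  obtain n where n: "n \<le> length z" "prd z = prd (alt s t n) \<or> prd z = prd (alt t s n)"
    using snoc by auto
  from snoc.prems have "a = s \<or> a = t" by auto
  then show ?case
    using *[of t n] *[of s n] n snoc.prems assms by (auto simp: insert_commute)
qed

lemma inv_st: "s \<in> S \<Longrightarrow> t \<in> S \<Longrightarrow> (s \<otimes> t) \<otimes> (t \<otimes> s) = \<one>"
  using mult_s_s[of s t] by (simp add: S_carrier S_sq flip: m_assoc)

text \<open>The dihedral relation: conjugation by \<open>t\<close> inverts
  \<open>s t\<close>.\<close>

lemma pow_st:
  assumes "s \<in> S" "t \<in> S"
  shows "(s \<otimes> t) [^] (k::nat) \<otimes> (t \<otimes> (s \<otimes> t) [^] k) = t"
proof (induction k)
  case 0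
  then show ?case using assms by (simp add: S_carrier)
next
  case (Suc k)
  let ?p = "(s \<otimes> t) [^] k"
  have c: "s \<in> carrier W" "t \<in> carrier W" "?p \<in> carrier W"
    using assms S_carrier by auto
  have "(s \<otimes> t) [^] Suc k \<otimes> (t \<otimes> (s \<otimes> t) [^] Suc k)
      = ?p \<otimes> (s \<otimes> t) \<otimes> (t \<otimes> ((s \<otimes> t) \<otimes> ?p))"
    using c nat_pow_Suc2[of "s \<otimes> t" k] by simp
  also have "\<dots> = ?p \<otimes> (((s \<otimes> t) \<otimes> (t \<otimes> s)) \<otimes> (t \<otimes> ?p))"
    using c by (simp add: m_assoc)
  also have "\<dots> = t" using Suc c by (simp add: inv_st[OF assms])
  finally show ?case .
qed

text \<open>For \<open>k\<close> equal to the order of \<open>s t\<close> the last factor is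
  trivial, and this becomes the braid relation.\<close>

lemma alt_swap:
  assumes "s \<in> S" "t \<in> S"
  shows "prd (alt t s k) = prd (alt s t k) \<otimes> (s \<otimes> t) [^] k"
proof (induction k)
  case 0
  then show ?case by simp
next
  case (Suc k)
  let ?p = "(s \<otimes> t) [^] k"
  have c: "s \<in> carrier W" "t \<in> carrier W" "?p \<in> carrier W" "prd (alt s t k) \<in> carrier W"
    "prd (alt t s k) \<in> carrier W"
    using assms by (auto simp: S_carrier alt_S)
  have "prd (alt s t (Suc k)) \<otimes> (s \<otimes> t) [^] Suc k = prd (alt t s k) \<otimes> s \<otimes> (s \<otimes> t \<otimes> ?p)"
    unfolding nat_pow_Suc2[OF m_closed[OF c(1,2)]] using c assms by (simp add: prd_append alt_S)
  also have "\<dots> = prd (alt t s k) \<otimes> (s \<otimes> s) \<otimes> (t \<otimes> ?p)"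
    using c by (simp add: m_assoc)
  also have "\<dots> = prd (alt s t k) \<otimes> (?p \<otimes> (t \<otimes> ?p))"
    using c assms Suc by (simp add: S_sq m_assoc)
  also have "\<dots> = prd (alt t s (Suc k))"
    using c assms by (simp add: pow_st prd_append alt_S)
  finally show ?case by simp
qed

text \<open>With \<open>m\<close> the order, the braid relation makes the alternating word of length
  \<open>m + 1\<close> equal to one of length \<open>m - 1\<close>. Every longer alternating word
  has such a word as its suffix.\<close>

lemma alt_long:
  assumes "s \<in> S" "t \<in> S" "ord (s \<otimes> t) < N"
  shows "\<exists>z. set z \<subseteq> {s, t} \<and> length z < N \<and> prd z = prd (alt s t N)"
proof -
  define m where "m = ord (s \<otimes> t)"
  have c: "s \<in> carrier W" "t \<in> carrier W" using assms by (auto simp: S_carrier)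
  have m: "1 \<le> m" unfolding m_def using c finite_W ord_ge_1 by auto
  have "(s \<otimes> t) [^] m = \<one>" unfolding m_def using c by simp
  then have sw: "prd (alt t s m) = prd (alt s t m)"
    using alt_swap[OF assms(1,2), of m] assms by (simp add: alt_S)
  obtain k where k: "m = Suc k" using m by (cases m) auto
  have "prd (alt s t (Suc m)) = prd (alt s t m) \<otimes> s"
    using sw assms c by (simp add: prd_append alt_S)
  also have "\<dots> = prd (alt t s k)"
    using k assms c by (simp add: prd_append alt_S mult_s_s)
  finally have red: "prd (alt s t (Suc m)) = prd (alt t s k)" .
  obtain j where j: "N = j + Suc m" using assms(3) unfolding m_def by (metis add.commute less_iff_Suc_add add_Suc_right)
  obtain y where y: "set y \<subseteq> {s, t}" "length y = j" "alt s t (j + Suc m) = y @ alt s t (Suc m)"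
    using alt_split[of s t j "Suc m"] by (elim exE conjE)
  have yS: "set y \<subseteq> S" using y assms by auto
  have "prd (y @ alt t s k) = prd (alt s t N)"
    unfolding j y(3) using yS assms red by (simp only: prd_append alt_S)
  moreover have "set (y @ alt t s k) \<subseteq> {s, t}" using y alt_props(2)[of t s k] by auto
  moreover have "length (y @ alt t s k) < N" using y j k by (simp add: alt_props)
  ultimately show ?thesis by blast
qed

section \<open>Positivity of the images of simple roots\<close>

definition posV :: "'v \<Rightarrow> bool" where
  "posV v \<longleftrightarrow> (\<exists>c. (\<forall>s\<in>S. 0 \<le> c s) \<and> v = (\<Sum>s\<in>S. c s *\<^sub>R \<alpha> s))"

lemma posV_add: "posV x \<Longrightarrow> posV y \<Longrightarrow> posV (x + y)"
proof -
  assume "posV x" "posV y"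
  then obtain c d where "\<forall>s\<in>S. 0 \<le> c s" "x = (\<Sum>s\<in>S. c s *\<^sub>R \<alpha> s)"
    "\<forall>s\<in>S. 0 \<le> d s" "y = (\<Sum>s\<in>S. d s *\<^sub>R \<alpha> s)" unfolding posV_def by blast
  then show ?thesis unfolding posV_def
    by (intro exI[of _ "\<lambda>s. c s + d s"]) (simp add: scaleR_add_left sum.distrib)
qed

lemma posV_scale: "posV x \<Longrightarrow> 0 \<le> a \<Longrightarrow> posV (a *\<^sub>R x)"
proof -
  assume "posV x" "0 \<le> a"
  then obtain c where "\<forall>s\<in>S. 0 \<le> c s" "x = (\<Sum>s\<in>S. c s *\<^sub>R \<alpha> s)" unfolding posV_def by blast
  then show ?thesis unfolding posV_def using \<open>0 \<le> a\<close>
    by (intro exI[of _ "\<lambda>s. a * c s"]) (simp add: scaleR_sum_right)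
qed

lemma sum_delta: "s \<in> S \<Longrightarrow> (\<Sum>t\<in>S. (if t = s then d else 0) *\<^sub>R f t) = d *\<^sub>R (f s :: 'v)"
  using finite_S by (simp add: if_distrib[of "\<lambda>c. c *\<^sub>R _"] cong: if_cong)

lemma posV_\<alpha>: "s \<in> S \<Longrightarrow> posV (\<alpha> s)"
  unfolding posV_def using sum_delta[of s 1 \<alpha>]
  by (intro exI[of _ "\<lambda>t. if t = s then 1 else 0"]) simp

lemma indep_coeffs:
  assumes "(\<Sum>s\<in>S. c s *\<^sub>R \<alpha> s) = (\<Sum>s\<in>S. d s *\<^sub>R \<alpha> s)" "s \<in> S"
  shows "c s = d s"
proof -
  define f where "f v = c (the_inv_into S \<alpha> v) - d (the_inv_into S \<alpha> v)" for v
  have "(\<Sum>v\<in>\<alpha> ` S. f v *\<^sub>R v) = (\<Sum>s\<in>S. (c s - d s) *\<^sub>R \<alpha> s)"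
    by (subst sum.reindex[OF \<alpha>_inj]) (auto simp: f_def the_inv_into_f_f[OF \<alpha>_inj] intro!: sum.cong)
  also have "\<dots> = 0" using assms(1) by (simp add: scaleR_diff_left sum_subtractf)
  finally have "(\<Sum>v\<in>\<alpha> ` S. f v *\<^sub>R v) = 0" .
  then have "f (\<alpha> s) = 0"
    using independentD[OF \<alpha>_independent, of "\<alpha> ` S" f "\<alpha> s"] finite_S assms(2) by auto
  then show ?thesis by (simp add: f_def the_inv_into_f_f[OF \<alpha>_inj assms(2)])
qed

lemma posV_antisym:
  assumes "posV x" "posV (- x)"
  shows "x = 0"
proof -
  obtain c d where cd: "\<forall>s\<in>S. 0 \<le> c s" "x = (\<Sum>s\<in>S. c s *\<^sub>R \<alpha> s)"
    "\<forall>s\<in>S. 0 \<le> d s" "- x = (\<Sum>s\<in>S. d s *\<^sub>R \<alpha> s)" using assms unfolding posV_def by blast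
  have "(\<Sum>s\<in>S. c s *\<^sub>R \<alpha> s) = (\<Sum>s\<in>S. (- d s) *\<^sub>R \<alpha> s)"
    using cd(2,4) by (simp add: sum_negf) (metis minus_equation_iff)
  then have "c s = - d s" if "s \<in> S" for s using indep_coeffs[of c "\<lambda>s. - d s"] that by blast
  then have "c s = 0" if "s \<in> S" for s using cd that by (smt (verit))
  then show ?thesis using cd(2) by simp
qed

lemma refl_pair:
  assumes "s \<in> S" "t \<in> S"
  shows "reflection (\<alpha> t) (p *\<^sub>R \<alpha> s + q *\<^sub>R \<alpha> t)
    = p *\<^sub>R \<alpha> s + (- (\<alpha> s \<bullet> coroot (\<alpha> t)) * p - q) *\<^sub>R \<alpha> t"
  using assms \<alpha>_nonzero[of t]
  by (simp add: reflection_coroot inner_add_left coroot_self algebra_simps scaleR_2)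
    (simp flip: scaleR_add_left)

text \<open>In the coordinates of \<open>\<alpha> s\<close> and \<open>\<alpha> t\<close> the two
  reflections are given by nonnegative integers \<open>A\<close> and \<open>B\<close> with
  \<open>A B = 4 cos^2 (pi / m)\<close>. That leaves six triples \<open>(m, A, B)\<close> and
  \<open>n <= 5\<close>, and the coordinates are computed in each case.\<close>

lemma dihedral_pos:
  assumes st: "s \<in> S" "t \<in> S" "s \<noteq> t" and n: "n < ord (s \<otimes> t)"
  shows "\<exists>p q. 0 \<le> p \<and> 0 \<le> q \<and> wact (alt t s n) (\<alpha> s) = p *\<^sub>R \<alpha> s + q *\<^sub>R \<alpha> t"
proof -
  define m where "m = ord (s \<otimes> t)"
  have c: "s \<in> carrier W" "t \<in> carrier W" using st by (auto simp: S_carrier)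
  have "1 \<le> m" unfolding m_def using c finite_W ord_ge_1 by auto
  moreover have "m \<noteq> 1"
  proof
    assume "m = 1"
    then have "s \<otimes> t = \<one>" unfolding m_def using c ord_eq_1 by auto
    then have "s = t" using S_sq[OF st(2)] c inv_equality inv_inv inv_unique by metis
    then show False using st by simp
  qed
  ultimately have m: "2 \<le> m" by simp
  define A B where "A = - (\<alpha> s \<bullet> coroot (\<alpha> t))" and "B = - (\<alpha> t \<bullet> coroot (\<alpha> s))"
  let ?x = "pi / real m"
  have x: "0 \<le> ?x" "?x \<le> pi / 2"
    using m by (auto simp: field_simps)
  have "- (pi / 2) \<le> ?x" using x(1) pi_gt_zero by linarith
  then have c0: "0 \<le> cos ?x" using x(2) by (rule cos_ge_zero)
  have nz: "norm (\<alpha> s) \<noteq> 0" "norm (\<alpha> t) \<noteq> 0" using \<alpha>_nonzero st by auto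
  have A: "A = 2 * norm (\<alpha> s) * cos ?x / norm (\<alpha> t)"
    unfolding A_def coroot_def using \<alpha>_inner[OF st(1,2)] nz
    by (simp add: m_def dot_square_norm power2_eq_square)
  have B: "B = 2 * norm (\<alpha> t) * cos ?x / norm (\<alpha> s)"
    unfolding B_def coroot_def using \<alpha>_inner[OF st(1,2)] nz
    by (simp add: m_def dot_square_norm power2_eq_square inner_commute)
  have AB: "A * B = 4 * (cos ?x)\<^sup>2" using A B nz by (simp add: power2_eq_square)
  have pos: "0 \<le> A" "0 \<le> B" using A B c0 by auto
  have zero: "A = 0 \<longleftrightarrow> B = 0" using A B nz by simp
  obtain A' B' :: int where AB': "A = of_int A'" "B = of_int B'"
    using pairing_int[OF \<alpha>_root[OF st(1)] \<alpha>_root[OF st(2)]] pairing_int[OF \<alpha>_root[OF st(2)] \<alpha>_root[OF st(1)]]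
    unfolding A_def B_def by (metis Ints_cases of_int_minus)
  have mk: "m = 2 \<and> A' * B' = 0 \<or> m = 3 \<and> A' * B' = 1 \<or> m = 4 \<and> A' * B' = 2 \<or> m = 6 \<and> A' * B' = 3"
    using crystallographic_angle[OF m, of "A' * B'"] AB AB' by simp
  have cases: "A' = 0 \<and> B' = 0 \<or> A' = 1 \<and> B' = 1 \<or> A' = 1 \<and> B' = 2 \<or> A' = 2 \<and> B' = 1
    \<or> A' = 1 \<and> B' = 3 \<or> A' = 3 \<and> B' = 1"
    using pos zero mk unfolding AB' by (intro cartan_cases) auto
  define U where "U p q = p *\<^sub>R \<alpha> s + q *\<^sub>R \<alpha> t" for p q
  have U0: "\<alpha> s = U 1 0" by (simp add: U_def)
  have rt: "reflection (\<alpha> t) (U p q) = U p (A * p - q)" for p q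
    unfolding A_def U_def using refl_pair[OF st(1,2)] by simp
  have rs: "reflection (\<alpha> s) (U p q) = U (B * q - p) q" for p q
    unfolding B_def U_def using refl_pair[OF st(2,1), of q p] by (simp add: add.commute)
  have "\<exists>p q. 0 \<le> p \<and> 0 \<le> q \<and> wact (alt t s n) (U 1 0) = U p q"
  proof -
    have n': "n = 0 \<or> n = 1 \<or> n = 2 \<and> 2 < m \<or> n = 3 \<and> 3 < m \<or> n = 4 \<and> 4 < m \<or> n = 5 \<and> 5 < m"
      using n mk unfolding m_def[symmetric] by auto
    have "(m, A, B) \<in> {(2, 0, 0), (3, 1, 1), (4, 1, 2), (4, 2, 1), (6, 1, 3), (6, 3, 1)}"
      using mk cases by (elim disjE conjE) (simp_all add: AB')
    then show ?thesis
      using n' unfolding insert_iff prod.inject empty_iff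
      by (elim disjE conjE FalseE; simp add: numeral_eq_Suc rt rs; intro exI conjI; (rule refl | simp))
  qed
  then show ?thesis unfolding U0[symmetric] by (simp add: U_def)
qed

text \<open>With a descent \<open>t\<close> of \<open>w\<close>, factor \<open>w = v x\<close> where
  \<open>x\<close> is a word in \<open>s\<close> and \<open>t\<close> and \<open>v\<close> is as
  short as possible. By induction \<open>v\<close> keeps \<open>\<alpha> s\<close> and
  \<open>\<alpha> t\<close> positive, and by the rank two case \<open>x\<close> sends
  \<open>\<alpha> s\<close> to a nonnegative combination of both.\<close>

theorem posV_R_\<alpha>:
  assumes "w \<in> carrier W" "s \<in> S" "len w < len (w \<otimes> s)"
  shows "posV (R w (\<alpha> s))"
  using assms
proof (induction "len w" arbitrary: w s rule: less_induct)
  case less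
  show ?case
  proof (cases "w = \<one>")
    case True
    then show ?thesis using less by (simp add: R_one \<alpha>_V posV_\<alpha>)
  next
    case False
    then obtain t where t: "t \<in> S" "len w = len (w \<otimes> t) + 1"
      using descent_exists less by blast
    then have st: "s \<noteq> t" using less by auto
    note st' = less.prems(2) t(1)
    \<comment> \<open>\<open>k\<close> ranges over the lengths of left factors in factorizations
      whose lengths add up. The witness \<open>w t\<close> together with the word \<open>[t]\<close>
      bounds the minimum below \<open>len w\<close>, which the induction needs.\<close>
    define Q where "Q k \<longleftrightarrow> (\<exists>v x. v \<in> carrier W \<and> set x \<subseteq> {s, t} \<and> w = v \<otimes> prd x \<and>
      len w = len v + length x \<and> len v = k)" for k
    have "Q (len (w \<otimes> t))"
      unfolding Q_def using t less.prems
      by (intro exI[of _ "w \<otimes> t"] exI[of _ "[t]"]) (simp add: mult_s_s S_carrier)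
    then have "Q (LEAST k. Q k)" and min: "\<And>k. Q k \<Longrightarrow> (LEAST k. Q k) \<le> k"
      and le: "(LEAST k. Q k) \<le> len (w \<otimes> t)"
      by (auto intro: LeastI Least_le)
    then obtain v x where v: "v \<in> carrier W" "set x \<subseteq> {s, t}" "w = v \<otimes> prd x"
      "len w = len v + length x" "len v = (LEAST k. Q k)" unfolding Q_def by blast
    have vlt: "len v < len w" using v(5) le t(2) by simp
    have xS: "set x \<subseteq> S" using v(2) st' by auto
    \<comment> \<open>If \<open>u\<close> shortened \<open>v\<close>, it could be moved to the front
      of \<open>x\<close>, and \<open>v u\<close> would be a shorter left factor.\<close>
    have up: "len v < len (v \<otimes> u)" if u: "u \<in> {s, t}" for u
    proof (rule ccontr)
      assume "\<not> len v < len (v \<otimes> u)"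
      moreover have uS: "u \<in> S" using u st' by auto
      ultimately have lu: "len v = len (v \<otimes> u) + 1" using len_mult_s[of v u] v(1) by auto
      have eq: "w = (v \<otimes> u) \<otimes> prd (u # x)"
        using v(1,3) uS xS S_sq[OF uS] by (simp add: S_carrier m_assoc) (simp add: S_carrier flip: m_assoc)
      have "len w \<le> len (v \<otimes> u) + length (u # x)"
        using len_mult_le[of "v \<otimes> u" "prd (u # x)"] len_le[of "u # x"] eq v(1) uS xS
        by (auto simp: S_carrier simp del: prd_Cons)
      then have "Q (len (v \<otimes> u))"
        unfolding Q_def using eq v lu u uS
        by (intro exI[of _ "v \<otimes> u"] exI[of _ "u # x"]) (auto simp: S_carrier)
      then show False using min lu v(5) by fastforce
    qed
    have pos: "posV (R v (\<alpha> u))" if "u \<in> {s, t}" for u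
      using less.hyps[OF vlt v(1)] up[OF that] that st' by blast
    \<comment> \<open>\<open>x\<close> is a shortest word for its product, and since
      \<open>w s\<close> is longer than \<open>w\<close>, every word for the product of
      \<open>x\<close> and \<open>s\<close> is longer than \<open>x\<close>. These two facts allow
      replacing \<open>x\<close> by \<open>alt t s n\<close> with
      \<open>n < ord (s t)\<close>.\<close>
    have minx: "length x \<le> length y" if "set y \<subseteq> {s, t}" "prd y = prd x" for y
    proof -
      have "set y \<subseteq> S" using that st' by auto
      then show ?thesis using len_mult_le[of v "prd y"] len_le[of y] that v xS by auto
    qed
    have minxs: "length x + 1 \<le> length y" if "set y \<subseteq> {s, t}" "prd y = prd x \<otimes> s" for y
    proof -
      have "w \<otimes> s = v \<otimes> prd y" using that v xS st' by (simp add: m_assoc S_carrier)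
      moreover have "set y \<subseteq> S" using that st' by auto
      ultimately have "len (w \<otimes> s) \<le> len v + length y"
        using len_mult_le[OF v(1) prd_closed, of y] len_le[of y] by fastforce
      then show ?thesis using less.prems v by linarith
    qed
    define n where "n = length x"
    have props: "set (alt a b k) \<subseteq> {s, t}" "length (alt a b k) = k"
      if "{a, b} = {s, t}" for a b k
      using alt_props[of a b k] that by auto
    obtain n' where n': "n' \<le> n" "prd x = prd (alt s t n') \<or> prd x = prd (alt t s n')"
      unfolding n_def using word_alt[OF st' v(2)] by blast
    have "n' = n"
      using n' minx[of "alt s t n'"] minx[of "alt t s n'"] props[of s t n'] props[of t s n']
      by (auto simp: n_def insert_commute)
    have px: "prd x = prd (alt t s n)"
    proof (rule ccontr)
      assume neq: "prd x \<noteq> prd (alt t s n)"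
      then have e: "prd x = prd (alt s t n)" using n' \<open>n' = n\<close> by blast
      have "n \<noteq> 0"
      proof
        assume "n = 0"
        then show False using neq e by simp
      qed
      then obtain k where k: "n = Suc k" by (cases n) auto
      have "prd x \<otimes> s = prd (alt t s k)"
        using e k st' by (simp add: prd_append alt_S S_carrier mult_s_s)
      then show False using minxs[of "alt t s k"] props[of t s k] k by (auto simp: n_def insert_commute)
    qed
    \<comment> \<open>Otherwise \<open>alt s t (n + 1)\<close>, a word for the product of
      \<open>x\<close> and \<open>s\<close>, could be shortened.\<close>
    have "n < ord (s \<otimes> t)"
    proof (rule ccontr)
      assume "\<not> n < ord (s \<otimes> t)"
      then obtain z where z: "set z \<subseteq> {s, t}" "length z < Suc n" "prd z = prd (alt s t (Suc n))"
        using alt_long[OF st', of "Suc n"] by auto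
      then have "prd z = prd x \<otimes> s" using px st' by (simp add: prd_append alt_S S_carrier)
      then show False using minxs[of z] z by (simp add: n_def)
    qed
    then obtain p q where pq: "0 \<le> p" "0 \<le> q" "wact (alt t s n) (\<alpha> s) = p *\<^sub>R \<alpha> s + q *\<^sub>R \<alpha> t"
      using dihedral_pos[OF st' st] by blast
    have "R w (\<alpha> s) = R v (R (prd x) (\<alpha> s))"
      using v xS st' by (simp add: R_mult \<alpha>_V)
    also have "R (prd x) (\<alpha> s) = p *\<^sub>R \<alpha> s + q *\<^sub>R \<alpha> t"
      using px pq st' by (simp add: R_prd alt_S \<alpha>_V)
    finally have "R w (\<alpha> s) = p *\<^sub>R R v (\<alpha> s) + q *\<^sub>R R v (\<alpha> t)"
      by (simp add: R_add R_scaleR)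
    then show ?thesis using pos pq by (simp add: posV_add posV_scale)
  qed
qed


section \<open>Positive roots and inversions\<close>

lemma P_alt: "\<beta> \<in> P \<longleftrightarrow> \<beta> \<in> \<Delta> \<and> posV \<beta>"
  unfolding pos_roots_def posV_def by blast

lemma P_\<Delta>: "\<beta> \<in> P \<Longrightarrow> \<beta> \<in> \<Delta>"
  by (simp add: P_alt)

lemma P_V: "\<beta> \<in> P \<Longrightarrow> \<beta> \<in> V"
  by (simp add: P_\<Delta> \<Delta>_V)

lemma finite_P: "finite P"
  using finite_subset[OF subsetI[OF P_\<Delta>] finite_\<Delta>] .

lemma \<alpha>_P: "s \<in> S \<Longrightarrow> \<alpha> s \<in> P"
  by (simp add: P_alt \<alpha>_root posV_\<alpha>)

lemma R_\<alpha>_down: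
  assumes "w \<in> carrier W" "s \<in> S" "len w = len (w \<otimes> s) + 1"
  shows "- R w (\<alpha> s) \<in> P"
proof -
  have c: "w \<otimes> s \<in> carrier W" using assms by (simp add: S_carrier)
  have "posV (R (w \<otimes> s) (\<alpha> s))"
    using assms c by (intro posV_R_\<alpha>) (auto simp: mult_s_s)
  moreover have "R (w \<otimes> s) (\<alpha> s) = - R w (\<alpha> s)"
    using assms by (simp add: R_mult S_carrier \<alpha>_V R_s reflection_self R_neg)
  ultimately show ?thesis
    using \<Delta>_neg[OF \<Delta>_closed[OF \<alpha>_root[OF assms(2)] assms(1)]] by (simp add: P_alt)
qed

lemma R_\<alpha>_up:
  assumes "w \<in> carrier W" "s \<in> S" "len w < len (w \<otimes> s)"
  shows "R w (\<alpha> s) \<in> P"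
  using posV_R_\<alpha>[OF assms] \<Delta>_closed \<alpha>_root assms by (simp add: P_alt)

lemma \<Delta>_cases: "\<beta> \<in> \<Delta> \<Longrightarrow> \<beta> \<in> P \<or> - \<beta> \<in> P"
proof -
  assume "\<beta> \<in> \<Delta>"
  then obtain w s where ws: "w \<in> carrier W" "s \<in> S" "\<beta> = R w (\<alpha> s)"
    unfolding roots_alt by blast
  then show ?thesis using len_mult_s[OF ws(1,2)] R_\<alpha>_up[OF ws(1,2)] R_\<alpha>_down[OF ws(1,2)] by auto
qed

lemma P_not_neg: "\<beta> \<in> P \<Longrightarrow> - \<beta> \<notin> P"
  using posV_antisym \<Delta>_nonzero by (auto simp: P_alt)

lemma neg_P_iff: "\<beta> \<in> \<Delta> \<Longrightarrow> - \<beta> \<in> P \<longleftrightarrow> \<beta> \<notin> P"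
  using \<Delta>_cases P_not_neg by blast

lemma P_comb: "\<beta> \<in> P \<Longrightarrow> \<gamma> \<in> P \<Longrightarrow> 0 \<le> x \<Longrightarrow> 0 \<le> y \<Longrightarrow> x *\<^sub>R \<beta> + y *\<^sub>R \<gamma> \<in> \<Delta> \<Longrightarrow> x *\<^sub>R \<beta> + y *\<^sub>R \<gamma> \<in> P"
  by (simp add: P_alt posV_add posV_scale)

text \<open>A nontrivial \<open>w\<close> has a descent \<open>t\<close>, and a descent makes
  \<open>R w (\<alpha> t)\<close> negative.\<close>

lemma R_faithful:
  assumes "w \<in> carrier W" "\<And>s. s \<in> S \<Longrightarrow> R w (\<alpha> s) = \<alpha> s"
  shows "w = \<one>"
proof (rule ccontr)
  assume "w \<noteq> \<one>"
  then obtain t where t: "t \<in> S" "len w = len (w \<otimes> t) + 1" using descent_exists assms by blast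
  then have "- \<alpha> t \<in> P" using R_\<alpha>_down[OF assms(1) t] assms(2) by simp
  then show False using P_not_neg \<alpha>_P t by blast
qed

lemma R_inv: "w \<in> carrier W \<Longrightarrow> x \<in> V \<Longrightarrow> R (inv w) (R w x) = x" "w \<in> carrier W \<Longrightarrow> x \<in> V \<Longrightarrow> R w (R (inv w) x) = x"
  using R_mult[of "inv w" w x] R_mult[of w "inv w" x] by (simp_all add: R_one)

lemma R_inj:
  assumes "v \<in> carrier W" "w \<in> carrier W" "\<And>x. x \<in> V \<Longrightarrow> R v x = R w x"
  shows "v = w"
proof -
  have "inv w \<otimes> v = \<one>"
  proof (rule R_faithful)
    fix s assume s: "s \<in> S"
    have "R (inv w \<otimes> v) (\<alpha> s) = R (inv w) (R w (\<alpha> s))"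
      using assms s by (simp add: R_mult \<alpha>_V)
    then show "R (inv w \<otimes> v) (\<alpha> s) = \<alpha> s" using assms s by (simp add: R_inv(1) \<alpha>_V)
  qed (use assms in simp)
  then show ?thesis using assms by (metis inv_closed inv_equality inv_inv)
qed

section \<open>Root lattice and reducedness\<close>

definition lattice :: "('w \<Rightarrow> 'v) \<Rightarrow> 'v set" where
  "lattice f = {v. \<exists>n::'w \<Rightarrow> int. v = (\<Sum>s\<in>S. of_int (n s) *\<^sub>R f s)}"

lemma lattice_diff: "x \<in> lattice f \<Longrightarrow> y \<in> lattice f \<Longrightarrow> x - of_int k *\<^sub>R y \<in> lattice f"
proof -
  assume "x \<in> lattice f" "y \<in> lattice f"
  then obtain m n :: "'w \<Rightarrow> int" where "x = (\<Sum>s\<in>S. of_int (m s) *\<^sub>R f s)" "y = (\<Sum>s\<in>S. of_int (n s) *\<^sub>R f s)"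
    unfolding lattice_def by blast
  then show ?thesis unfolding lattice_def
    by (intro CollectI exI[of _ "\<lambda>s. m s - k * n s"])
      (simp add: scaleR_sum_right scaleR_diff_left sum_subtractf)
qed

lemma lattice_gen: "s \<in> S \<Longrightarrow> f s \<in> lattice f"
  unfolding lattice_def using sum_delta[of s 1 f]
  by (intro CollectI exI[of _ "\<lambda>t. if t = s then 1 else 0"]) (simp add: if_distrib[of of_int] cong: if_cong)

lemma lattice_zero: "0 \<in> lattice f"
  unfolding lattice_def by (intro CollectI exI[of _ "\<lambda>_. 0"]) simp

lemma lattice_sum: "(\<And>s. s \<in> A \<Longrightarrow> g s \<in> lattice f) \<Longrightarrow> (\<Sum>s\<in>A. of_int (n s) *\<^sub>R g s) \<in> lattice f"
proof (induction A rule: infinite_finite_induct)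
  case (insert a A)
  then show ?case using lattice_diff[of "\<Sum>s\<in>A. of_int (n s) *\<^sub>R g s" f "g a" "- n a"] by (simp add: add.commute)
qed (auto simp: lattice_zero)

text \<open>Elements of \<open>W\<close> act as products of simple reflections, so stability has to
  be checked on generators only. The family \<open>f\<close> will be the simple roots and later the
  simple coroots.\<close>

lemma R_lattice:
  assumes gen: "\<And>s t. s \<in> S \<Longrightarrow> t \<in> S \<Longrightarrow> reflection (\<alpha> t) (f s) \<in> lattice f"
    and V: "\<And>s. s \<in> S \<Longrightarrow> f s \<in> V"
    and "w \<in> carrier W" "x \<in> lattice f"
  shows "R w x \<in> lattice f"
proof -
  have step: "reflection (\<alpha> t) y \<in> lattice f" if ty: "t \<in> S" "y \<in> lattice f" for t y
  proof -
    obtain n :: "'w \<Rightarrow> int" where "y = (\<Sum>s\<in>S. of_int (n s) *\<^sub>R f s)" using ty unfolding lattice_def by blast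
    then have "reflection (\<alpha> t) y = (\<Sum>s\<in>S. of_int (n s) *\<^sub>R reflection (\<alpha> t) (f s))"
      using linear_reflection[of "\<alpha> t"] by (simp add: linear_sum linear_scale)
    then show ?thesis using lattice_sum[of S "\<lambda>s. reflection (\<alpha> t) (f s)" f n] gen ty by simp
  qed
  obtain ws where ws: "set ws \<subseteq> S" "prd ws = w" using word_exists assms by blast
  obtain n :: "'w \<Rightarrow> int" where "x = (\<Sum>s\<in>S. of_int (n s) *\<^sub>R f s)" using assms(4) unfolding lattice_def by blast
  then have "x \<in> V" using V by (auto intro!: span_sum span_scale)
  then have "R w x = wact ws x" using ws R_prd by blast
  moreover have "wact ws x \<in> lattice f" using ws(1) by (induction ws) (auto simp: assms(4) step)
  ultimately show ?thesis by simp
qed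

lemma root_lattice: "\<beta> \<in> \<Delta> \<Longrightarrow> \<beta> \<in> lattice \<alpha>"
proof -
  assume "\<beta> \<in> \<Delta>"
  then obtain w s where ws: "w \<in> carrier W" "s \<in> S" "\<beta> = R w (\<alpha> s)"
    unfolding roots_alt by blast
  have "reflection (\<alpha> t) (\<alpha> s) \<in> lattice \<alpha>" if st: "s \<in> S" "t \<in> S" for s t
  proof -
    obtain k where "\<alpha> s \<bullet> coroot (\<alpha> t) = of_int k"
      using pairing_int[OF \<alpha>_root[OF st(1)] \<alpha>_root[OF st(2)]] by (rule Ints_cases)
    then show ?thesis using lattice_diff[OF lattice_gen lattice_gen, of s t \<alpha> k] st
      by (simp add: reflection_coroot)
  qed
  then show ?thesis unfolding ws(3) using ws(1,2) \<alpha>_V lattice_gen[OF ws(2)] R_lattice by metis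
qed

lemma multiple_\<alpha>_int:
  assumes "s \<in> S" "d *\<^sub>R \<alpha> s \<in> \<Delta>"
  shows "\<exists>k::int. d = of_int k"
proof -
  obtain n :: "'w \<Rightarrow> int" where "d *\<^sub>R \<alpha> s = (\<Sum>t\<in>S. of_int (n t) *\<^sub>R \<alpha> t)"
    using root_lattice[OF assms(2)] unfolding lattice_def by blast
  then have "(\<Sum>t\<in>S. (if t = s then d else 0) *\<^sub>R \<alpha> t) = (\<Sum>t\<in>S. of_int (n t) *\<^sub>R \<alpha> t)"
    using sum_delta[OF assms(1), of d \<alpha>] by simp
  from indep_coeffs[OF this assms(1)] show ?thesis by auto
qed

text \<open>The factor \<open>c\<close> is an integer because \<open>\<beta>\<close> lies in the
  root lattice. Moving \<open>\<beta>\<close> back to the simple root it came from shows that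
  \<open>1 / c\<close> is an integer as well, and positivity excludes
  \<open>c = - 1\<close>.\<close>

lemma multiple_\<alpha>:
  assumes "\<beta> \<in> P" "s \<in> S" "\<beta> = c *\<^sub>R \<alpha> s"
  shows "\<beta> = \<alpha> s"
proof -
  obtain w t where wt: "w \<in> carrier W" "t \<in> S" "\<beta> = R w (\<alpha> t)"
    using assms(1) P_\<Delta> unfolding roots_alt by blast
  have c: "c \<noteq> 0" using assms P_\<Delta> \<Delta>_nonzero by fastforce
  obtain k :: int where k: "c = of_int k" using multiple_\<alpha>_int[OF assms(2)] assms P_\<Delta> by blast
  have "R (inv w) (c *\<^sub>R \<alpha> s) = \<alpha> t"
    using wt assms(3) R_inv(1)[OF wt(1) \<alpha>_V[OF wt(2)]] by metis
  then have ct: "c *\<^sub>R R (inv w) (\<alpha> s) = \<alpha> t" by (simp add: R_scaleR)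
  then have "R (inv w) (\<alpha> s) = (1 / c) *\<^sub>R \<alpha> t" using c by (simp flip: ct)
  then have "(1 / c) *\<^sub>R \<alpha> t \<in> \<Delta>"
    using \<Delta>_closed[OF \<alpha>_root[OF assms(2)], of "inv w"] wt by simp
  then obtain l :: int where l: "1 / c = of_int l" using multiple_\<alpha>_int[OF wt(2)] by blast
  have "of_int (k * l) = (1::real)" using k l c by (metis nonzero_mult_div_cancel_left of_int_mult times_divide_eq_right mult.right_neutral)
  then have "k * l = 1" using of_int_eq_1_iff by blast
  then have "k = 1 \<or> k = - 1" by (simp add: zmult_eq_1_iff) blast
  moreover have "k \<noteq> - 1" using k assms P_not_neg[OF \<alpha>_P[OF assms(2)]] by auto
  ultimately show ?thesis using assms(3) k by simp
qed

text \<open>The reflection changes only the coefficient at \<open>\<alpha> s\<close>. A positive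
  root that became negative would have no other nonzero coefficient, hence be a multiple of
  \<open>\<alpha> s\<close>.\<close>

lemma reflection_simple_P:
  assumes "\<beta> \<in> P" "s \<in> S" "\<beta> \<noteq> \<alpha> s"
  shows "reflection (\<alpha> s) \<beta> \<in> P"
proof (rule ccontr)
  assume neg: "reflection (\<alpha> s) \<beta> \<notin> P"
  have "reflection (\<alpha> s) \<beta> \<in> \<Delta>"
    using \<Delta>_closed[OF P_\<Delta>[OF assms(1)] S_carrier[OF assms(2)]] R_s[OF assms(2) P_V[OF assms(1)]] by simp
  then have "posV (- reflection (\<alpha> s) \<beta>)" using neg neg_P_iff[of "reflection (\<alpha> s) \<beta>"] P_alt by blast
  then obtain d where d: "\<forall>t\<in>S. 0 \<le> d t" "- reflection (\<alpha> s) \<beta> = (\<Sum>t\<in>S. d t *\<^sub>R \<alpha> t)" unfolding posV_def by blast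
  obtain c where c: "\<forall>t\<in>S. 0 \<le> c t" "\<beta> = (\<Sum>t\<in>S. c t *\<^sub>R \<alpha> t)" using assms(1) unfolding P_alt posV_def by blast
  let ?k = "\<beta> \<bullet> coroot (\<alpha> s)"
  have "(\<Sum>t\<in>S. (c t + d t) *\<^sub>R \<alpha> t) = \<beta> - reflection (\<alpha> s) \<beta>"
    using c d by (simp add: scaleR_add_left sum.distrib)
  also have "\<dots> = (\<Sum>t\<in>S. (if t = s then ?k else 0) *\<^sub>R \<alpha> t)"
    unfolding sum_delta[OF assms(2)] by (simp add: reflection_coroot)
  finally have eq: "(\<Sum>t\<in>S. (c t + d t) *\<^sub>R \<alpha> t) = (\<Sum>t\<in>S. (if t = s then ?k else 0) *\<^sub>R \<alpha> t)" .
  have "c t = 0" if "t \<in> S" "t \<noteq> s" for t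
    using indep_coeffs[OF eq that(1)] that c d by (smt (verit))
  then have "\<beta> = (\<Sum>t\<in>S. (if t = s then c s else 0) *\<^sub>R \<alpha> t)"
    using c(2) by (auto intro!: sum.cong)
  then have "\<beta> = c s *\<^sub>R \<alpha> s" unfolding sum_delta[OF assms(2)] .
  then show False using multiple_\<alpha> assms by blast
qed

section \<open>Inversion sets\<close>

definition Inv :: "'w \<Rightarrow> 'v set" where
  "Inv w = {\<beta> \<in> P. - R w \<beta> \<in> P}"

lemma Inv_alt: "Inv w = {\<beta> \<in> P. R w \<beta> \<notin> P}" if "w \<in> carrier W"
  unfolding Inv_def using neg_P_iff \<Delta>_closed P_\<Delta> that by blast

lemma finite_Inv: "finite (Inv w)"
  unfolding Inv_def using finite_P by simp

text \<open>The simple reflection permutes the positive roots other than \<open>\<alpha> s\<close>,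
  so it carries the inversions of \<open>w\<close> to those of \<open>w s\<close>, which gains only
  \<open>\<alpha> s\<close>.\<close>

lemma Inv_mult_s:
  assumes "w \<in> carrier W" "s \<in> S" "R w (\<alpha> s) \<in> P"
  shows "card (Inv (w \<otimes> s)) = card (Inv w) + 1"
proof -
  have Rws: "R (w \<otimes> s) \<beta> = R w (reflection (\<alpha> s) \<beta>)" if "\<beta> \<in> P" for \<beta>
    using that assms by (simp add: R_mult S_carrier P_V R_s)
  have eq: "Inv (w \<otimes> s) = insert (\<alpha> s) (reflection (\<alpha> s) ` Inv w)"
  proof (intro equalityI subsetI)
    fix \<beta> assume b: "\<beta> \<in> Inv (w \<otimes> s)"
    then have bP: "\<beta> \<in> P" "- R w (reflection (\<alpha> s) \<beta>) \<in> P" using Rws by (auto simp: Inv_def)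
    show "\<beta> \<in> insert (\<alpha> s) (reflection (\<alpha> s) ` Inv w)"
    proof (cases "\<beta> = \<alpha> s")
      case False
      then have "reflection (\<alpha> s) \<beta> \<in> Inv w" using bP reflection_simple_P assms by (auto simp: Inv_def)
      then show ?thesis using reflection_invol by (metis image_eqI insertI2)
    qed simp
  next
    fix \<beta> assume "\<beta> \<in> insert (\<alpha> s) (reflection (\<alpha> s) ` Inv w)"
    then consider "\<beta> = \<alpha> s" | \<gamma> where "\<gamma> \<in> Inv w" "\<beta> = reflection (\<alpha> s) \<gamma>" by blast
    then show "\<beta> \<in> Inv (w \<otimes> s)"
    proof cases
      case 1
      then show ?thesis using assms Rws[OF \<alpha>_P] \<alpha>_P by (simp add: Inv_def reflection_self R_neg)
    next
      case 2
      have "\<gamma> \<noteq> \<alpha> s" using 2 assms P_not_neg by (auto simp: Inv_def)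
      then have "\<beta> \<in> P" using 2 reflection_simple_P assms by (auto simp: Inv_def)
      then show ?thesis using 2 Rws by (simp add: Inv_def reflection_invol)
    qed
  qed
  have inj: "inj_on (reflection (\<alpha> s)) A" for A
    by (rule inj_on_inverseI[where g = "reflection (\<alpha> s)"]) (simp add: reflection_invol)
  have "\<alpha> s \<notin> reflection (\<alpha> s) ` Inv w"
  proof
    assume "\<alpha> s \<in> reflection (\<alpha> s) ` Inv w"
    then obtain \<gamma> where g: "\<gamma> \<in> Inv w" "\<alpha> s = reflection (\<alpha> s) \<gamma>" by blast
    then have "\<gamma> = - \<alpha> s" using reflection_invol[of "\<alpha> s" \<gamma>] reflection_self[of "\<alpha> s"] by simp
    then show False using g P_not_neg \<alpha>_P assms by (auto simp: Inv_def)
  qed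
  then show ?thesis unfolding eq using finite_Inv by (simp add: card_image[OF inj])
qed

text \<open>Removing a descent \<open>t\<close> lowers both sides by one, since \<open>w t\<close>
  sends \<open>\<alpha> t\<close> to a positive root.\<close>

theorem len_Inv: "w \<in> carrier W \<Longrightarrow> len w = card (Inv w)"
proof (induction "len w" arbitrary: w rule: less_induct)
  case less
  show ?case
  proof (cases "w = \<one>")
    case True
    have "Inv \<one> = {}" using P_not_neg by (auto simp: Inv_def R_one P_V)
    then show ?thesis using True by simp
  next
    case False
    then obtain t where t: "t \<in> S" "len w = len (w \<otimes> t) + 1"
      using descent_exists less by blast
    have c: "w \<otimes> t \<in> carrier W" using less t by (simp add: S_carrier)
    have "len (w \<otimes> t) = card (Inv (w \<otimes> t))" using less c t by auto
    moreover have "R (w \<otimes> t) (\<alpha> t) \<in> P" using c t less by (intro R_\<alpha>_up) (auto simp: mult_s_s)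
    then have "card (Inv w) = card (Inv (w \<otimes> t)) + 1"
      using Inv_mult_s[OF c t(1)] t less by (simp add: mult_s_s)
    ultimately show ?thesis using t by simp
  qed
qed

end

lemma coroot_minus: "coroot (- g) = - coroot (g::'v::real_inner)"
  by (simp add: coroot_def)

lemma reflection_minus: "reflection (- g) = reflection (g::'v::real_inner)"
  by (rule ext) (simp add: reflection_def)

lemma reflection_neg: "reflection g (- x) = - reflection g (x::'v::real_inner)"
  using reflection_scaleR[of g "-1" x] by simp

lemma inner_coroot_reflection: "reflection g x \<bullet> coroot g = - (x \<bullet> coroot (g::'v::real_inner))"
  by (cases "g = 0") (simp_all add: reflection_coroot inner_diff_left coroot_self, simp add: coroot_def)

context crystallographic_coxeter
begin

section \<open>Reflections and length differences\<close>

abbreviation rf :: "'v \<Rightarrow> 'w" where "rf \<equiv> refl_elt W S \<alpha> act"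

lemma coroot_R: "coroot (R w x) = R w (coroot x)"
  by (simp add: coroot_def R_inner R_scaleR)

lemma R_reflection: "R w (reflection g x) = reflection (R w g) (R w x)"
  by (simp add: reflection_coroot R_diff R_scaleR coroot_R R_inner)

lemma rf_unique:
  assumes "w \<in> carrier W" "\<And>v. v \<in> V \<Longrightarrow> R w v = reflection \<gamma> v"
  shows "rf \<gamma> = w"
  unfolding refl_elt_def
proof (rule the_equality)
  show "w \<in> carrier W \<and> (\<forall>v\<in>V. act w v = reflection \<gamma> v)"
    using assms by (simp flip: R_act)
next
  fix u assume "u \<in> carrier W \<and> (\<forall>v\<in>V. act u v = reflection \<gamma> v)"
  then show "u = w" using assms by (intro R_inj) (auto simp: R_act)
qed

lemma rf_props:
  assumes "\<gamma> \<in> \<Delta>"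
  shows rf_closed: "rf \<gamma> \<in> carrier W" and R_rf: "v \<in> V \<Longrightarrow> R (rf \<gamma>) v = reflection \<gamma> v"
proof -
  obtain w s where ws: "w \<in> carrier W" "s \<in> S" "\<gamma> = R w (\<alpha> s)"
    using assms unfolding roots_alt by blast
  \<comment> \<open>The reflection in the image of \<open>\<alpha> s\<close> under \<open>w\<close>
    is the conjugate of \<open>s\<close> by \<open>w\<close>.\<close>
  let ?u = "w \<otimes> (s \<otimes> inv w)"
  have u: "?u \<in> carrier W" using ws by (simp add: S_carrier)
  have ru: "R ?u v = reflection \<gamma> v" if v: "v \<in> V" for v
  proof -
    have "R ?u v = R w (R s (R (inv w) v))"
      using ws v by (simp add: R_mult S_carrier R_V)
    also have "\<dots> = R w (reflection (\<alpha> s) (R (inv w) v))"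
      using ws v by (simp add: R_s R_V)
    also have "\<dots> = reflection \<gamma> v"
      using ws v by (simp add: R_reflection R_inv(2))
    finally show ?thesis .
  qed
  have "rf \<gamma> = ?u" using u ru by (rule rf_unique)
  then show "rf \<gamma> \<in> carrier W" "v \<in> V \<Longrightarrow> R (rf \<gamma>) v = reflection \<gamma> v"
    using u ru by auto
qed

lemma rf_\<alpha>: "s \<in> S \<Longrightarrow> rf (\<alpha> s) = s"
  by (rule rf_unique) (auto simp: S_carrier R_s)

lemma rf_minus: "rf (- \<gamma>) = rf \<gamma>"
  by (simp add: refl_elt_def reflection_minus)

lemma reflection_V: "\<gamma> \<in> \<Delta> \<Longrightarrow> v \<in> V \<Longrightarrow> reflection \<gamma> v \<in> V"
  using R_V[OF rf_closed] R_rf by metis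

lemma reflection_\<Delta>: "\<gamma> \<in> \<Delta> \<Longrightarrow> \<beta> \<in> \<Delta> \<Longrightarrow> reflection \<gamma> \<beta> \<in> \<Delta>"
  using \<Delta>_closed[OF _ rf_closed] R_rf \<Delta>_V by metis

lemma rf_sq: "\<gamma> \<in> \<Delta> \<Longrightarrow> rf \<gamma> \<otimes> rf \<gamma> = \<one>"
  by (rule R_inj) (simp_all add: R_mult rf_closed R_rf R_one reflection_invol reflection_V)

lemma R_mult_rf: "w \<in> carrier W \<Longrightarrow> \<gamma> \<in> \<Delta> \<Longrightarrow> v \<in> V \<Longrightarrow> R (w \<otimes> rf \<gamma>) v = R w (reflection \<gamma> v)"
  by (simp add: R_mult rf_closed R_rf)

lemma mult_rf_rf: "w \<in> carrier W \<Longrightarrow> \<gamma> \<in> \<Delta> \<Longrightarrow> w \<otimes> rf \<gamma> \<otimes> rf \<gamma> = w"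
  by (simp add: m_assoc rf_closed rf_sq)

lemma rf_conj:
  assumes "\<gamma> \<in> \<Delta>" "\<delta> \<in> \<Delta>"
  shows "rf (reflection \<gamma> \<delta>) = rf \<gamma> \<otimes> (rf \<delta> \<otimes> rf \<gamma>)"
proof (rule rf_unique)
  fix v assume v: "v \<in> V"
  have "R (rf \<gamma> \<otimes> (rf \<delta> \<otimes> rf \<gamma>)) v = R (rf \<gamma>) (reflection \<delta> (reflection \<gamma> v))"
    using assms v by (simp add: R_mult rf_closed R_rf reflection_V)
  also have "\<dots> = reflection (R (rf \<gamma>) \<delta>) (R (rf \<gamma>) (reflection \<gamma> v))" by (rule R_reflection)
  also have "\<dots> = reflection (reflection \<gamma> \<delta>) v"
    using assms v by (simp add: R_rf reflection_V \<Delta>_V reflection_invol)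
  finally show "R (rf \<gamma> \<otimes> (rf \<delta> \<otimes> rf \<gamma>)) v = reflection (reflection \<gamma> \<delta>) v" .
qed (use assms rf_closed in simp)

definition sg :: "'v \<Rightarrow> int" where "sg v = (if v \<in> P then 1 else - 1)"

lemma sg_neg: "\<beta> \<in> \<Delta> \<Longrightarrow> sg (- \<beta>) = - sg \<beta>"
  using neg_P_iff by (simp add: sg_def)

definition N :: "'v \<Rightarrow> 'v set" where
  "N \<gamma> = {\<beta> \<in> P. - reflection \<gamma> \<beta> \<in> P}"

lemma N_Inv: "\<gamma> \<in> \<Delta> \<Longrightarrow> N \<gamma> = Inv (rf \<gamma>)"
  unfolding N_def Inv_def using R_rf P_V by auto

lemma len_rf: "\<gamma> \<in> \<Delta> \<Longrightarrow> len (rf \<gamma>) = card (N \<gamma>)"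
  by (simp add: len_Inv rf_closed N_Inv)

lemma finite_N: "finite (N \<gamma>)"
  unfolding N_def using finite_P by simp

lemma N_P: "\<beta> \<in> N \<gamma> \<Longrightarrow> \<beta> \<in> P"
  by (simp add: N_def)

lemma N_self: "\<gamma> \<in> P \<Longrightarrow> \<gamma> \<in> N \<gamma>"
  by (simp add: N_def reflection_self)

lemma N_flip: "\<beta> \<in> N \<gamma> \<Longrightarrow> - reflection \<gamma> \<beta> \<in> N \<gamma>"
  by (simp add: N_def reflection_neg reflection_invol)

text \<open>This involution fixes \<open>\<gamma>\<close> and matches each root with one whose sum
  with it is a multiple of \<open>\<gamma>\<close>. The sign sum of a step up is estimated pair by
  pair.\<close>

lemma N_flip_bij: "bij_betw (\<lambda>\<beta>. - reflection \<gamma> \<beta>) (N \<gamma>) (N \<gamma>)"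
  by (rule bij_betwI[where g = "\<lambda>\<beta>. - reflection \<gamma> \<beta>"])
    (auto simp: N_flip reflection_neg reflection_invol)

lemma not_N:
  assumes "\<gamma> \<in> \<Delta>" "\<beta> \<in> P - N \<gamma>"
  shows "reflection \<gamma> \<beta> \<in> P - N \<gamma>"
proof -
  have "- reflection \<gamma> \<beta> \<notin> P" using assms by (auto simp: N_def)
  then have "reflection \<gamma> \<beta> \<in> P"
    using neg_P_iff[OF reflection_\<Delta>[OF assms(1) P_\<Delta>]] assms(2) by blast
  then show ?thesis using assms P_not_neg by (auto simp: N_def reflection_invol)
qed

lemma not_N_bij: "\<gamma> \<in> \<Delta> \<Longrightarrow> bij_betw (reflection \<gamma>) (P - N \<gamma>) (P - N \<gamma>)"
  by (rule bij_betwI[where g = "reflection \<gamma>"]) (use not_N in \<open>auto simp: reflection_invol\<close>)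

lemma len_count: "w \<in> carrier W \<Longrightarrow> 2 * int (len w) = (\<Sum>\<beta>\<in>P. 1 - sg (R w \<beta>))"
proof -
  assume w: "w \<in> carrier W"
  have "(\<Sum>\<beta>\<in>P. 1 - sg (R w \<beta>)) = (\<Sum>\<beta>\<in>P. if R w \<beta> \<notin> P then 2 else 0)"
    by (intro sum.cong) (auto simp: sg_def)
  also have "\<dots> = (\<Sum>\<beta>\<in>{\<beta>\<in>P. R w \<beta> \<notin> P}. 2)"
    by (rule sum.inter_filter[symmetric]) (rule finite_P)
  also have "\<dots> = 2 * int (len w)" using w by (simp add: len_Inv Inv_alt)
  finally show ?thesis by simp
qed

text \<open>Twice a length is the sum of \<open>1 - sg\<close> over \<open>P\<close>. Outside
  \<open>N \<gamma>\<close> the reflection only permutes the summands. On \<open>N \<gamma>\<close>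
  the flip shows that it negates the sign sum, so the difference is twice that sum.\<close>

theorem len_diff:
  assumes "w \<in> carrier W" "\<gamma> \<in> \<Delta>"
  shows "int (len (w \<otimes> rf \<gamma>)) - int (len w) = (\<Sum>\<beta>\<in>N \<gamma>. sg (R w \<beta>))"
proof -
  let ?f = "\<lambda>\<beta>. sg (R w \<beta>)"
  have split: "sum h P = sum h (P - N \<gamma>) + sum h (N \<gamma>)" for h :: "'v \<Rightarrow> int"
    using finite_P N_P by (intro sum.subset_diff) auto
  have sgR: "sg (R w (- reflection \<gamma> \<beta>)) = - sg (R w (reflection \<gamma> \<beta>))" if "\<beta> \<in> P" for \<beta>
    unfolding R_neg by (rule sg_neg[OF \<Delta>_closed[OF reflection_\<Delta>[OF assms(2) P_\<Delta>[OF that]] assms(1)]])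
  have a: "(\<Sum>\<beta>\<in>P - N \<gamma>. sg (R (w \<otimes> rf \<gamma>) \<beta>)) = (\<Sum>\<beta>\<in>P - N \<gamma>. ?f \<beta>)"
  proof -
    have "(\<Sum>\<beta>\<in>P - N \<gamma>. sg (R (w \<otimes> rf \<gamma>) \<beta>)) = (\<Sum>\<beta>\<in>P - N \<gamma>. ?f (reflection \<gamma> \<beta>))"
      using assms by (intro sum.cong) (auto simp: R_mult_rf P_V)
    also have "\<dots> = (\<Sum>\<beta>\<in>P - N \<gamma>. ?f \<beta>)"
      by (rule sum.reindex_bij_betw[OF not_N_bij[OF assms(2)]])
    finally show ?thesis .
  qed
  have b: "(\<Sum>\<beta>\<in>N \<gamma>. sg (R (w \<otimes> rf \<gamma>) \<beta>)) = - (\<Sum>\<beta>\<in>N \<gamma>. ?f \<beta>)"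
  proof -
    have "(\<Sum>\<beta>\<in>N \<gamma>. sg (R (w \<otimes> rf \<gamma>) \<beta>)) = (\<Sum>\<beta>\<in>N \<gamma>. - ?f (- reflection \<gamma> \<beta>))"
      using assms sgR by (intro sum.cong) (auto simp: R_mult_rf P_V N_P)
    also have "\<dots> = - (\<Sum>\<beta>\<in>N \<gamma>. ?f \<beta>)"
      using sum.reindex_bij_betw[OF N_flip_bij[of \<gamma>], of ?f] by (simp add: sum_negf)
    finally show ?thesis .
  qed
  have "2 * int (len (w \<otimes> rf \<gamma>)) - 2 * int (len w)
     = (\<Sum>\<beta>\<in>P. ?f \<beta>) - (\<Sum>\<beta>\<in>P. sg (R (w \<otimes> rf \<gamma>) \<beta>))"
    using assms by (simp add: len_count rf_closed sum_subtractf)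
  also have "\<dots> = 2 * (\<Sum>\<beta>\<in>N \<gamma>. ?f \<beta>)"
    using a b split[of ?f] split[of "\<lambda>\<beta>. sg (R (w \<otimes> rf \<gamma>) \<beta>)"] by linarith
  finally show ?thesis by simp
qed

section \<open>Heights of coroots and extremal length changes\<close>

definition ht :: "'v \<Rightarrow> real" where "ht v = 2 * (rho W S \<alpha> act \<bullet> v)"

lemma ht_add: "ht (x + y) = ht x + ht y"
  and ht_zero: "ht 0 = 0"
  by (simp_all add: ht_def inner_add_right algebra_simps)

text \<open>The reflection permutes the positive roots outside \<open>N \<gamma>\<close> and negates
  their pairing with \<open>coroot \<gamma>\<close>, so their total contribution is zero.\<close>

lemma ht_coroot:
  assumes "\<gamma> \<in> \<Delta>"
  shows "ht (coroot \<gamma>) = (\<Sum>\<beta>\<in>N \<gamma>. \<beta> \<bullet> coroot \<gamma>)"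
proof -
  let ?f = "\<lambda>\<beta>. \<beta> \<bullet> coroot \<gamma>"
  have "(\<Sum>\<beta>\<in>P - N \<gamma>. ?f (reflection \<gamma> \<beta>)) = (\<Sum>\<beta>\<in>P - N \<gamma>. ?f \<beta>)"
    by (rule sum.reindex_bij_betw[OF not_N_bij[OF assms]])
  then have "(\<Sum>\<beta>\<in>P - N \<gamma>. ?f \<beta>) = 0"
    by (simp add: inner_coroot_reflection sum_negf)
  moreover have "sum ?f P = sum ?f (P - N \<gamma>) + sum ?f (N \<gamma>)"
    using finite_P N_P by (intro sum.subset_diff) auto
  ultimately show ?thesis by (simp add: ht_def rho_def inner_sum_left)
qed

text \<open>With a pairing at most 0, the reflected root would be a nonnegative combination of
  \<open>\<beta>\<close> and \<open>\<gamma>\<close> and therefore still positive. Integrality gives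
  the bound 1.\<close>

lemma N_pairing_ge:
  assumes "\<gamma> \<in> P" "\<beta> \<in> N \<gamma>"
  shows "\<beta> \<bullet> coroot \<gamma> \<ge> 1"
proof -
  obtain k :: int where k: "\<beta> \<bullet> coroot \<gamma> = of_int k"
    using pairing_int[OF P_\<Delta>[OF N_P[OF assms(2)]] P_\<Delta>[OF assms(1)]] by (rule Ints_cases)
  have "k > 0"
  proof (rule ccontr)
    assume "\<not> k > 0"
    then have "(1 *\<^sub>R \<beta> + (- of_int k) *\<^sub>R \<gamma>) \<in> P"
      using assms k reflection_\<Delta>[OF P_\<Delta> P_\<Delta>, of \<gamma> \<beta>]
      by (intro P_comb) (auto simp: N_P reflection_coroot)
    then have "reflection \<gamma> \<beta> \<in> P" using k by (simp add: reflection_coroot)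
    then show False using assms(2) P_not_neg by (auto simp: N_def)
  qed
  then show ?thesis using k by simp
qed

text \<open>The root \<open>\<gamma>\<close> contributes 2 to the height and every other root of
  \<open>N \<gamma>\<close> at least 1. The slack is the sum of the pairings diminished by 1, so
  without slack they are all 1.\<close>

lemma ht_ge:
  assumes "\<gamma> \<in> P"
  shows "real (card (N \<gamma>)) \<le> ht (coroot \<gamma>) - 1"
    and "real (card (N \<gamma>)) = ht (coroot \<gamma>) - 1 \<Longrightarrow> \<beta> \<in> N \<gamma> \<Longrightarrow> \<beta> \<noteq> \<gamma> \<Longrightarrow> \<beta> \<bullet> coroot \<gamma> = 1"
proof -
  have nz: "\<gamma> \<noteq> 0" using assms P_\<Delta> \<Delta>_nonzero by blast
  let ?M = "N \<gamma> - {\<gamma>}"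
  have "ht (coroot \<gamma>) = 2 + (\<Sum>\<beta>\<in>?M. \<beta> \<bullet> coroot \<gamma>)"
    using ht_coroot[OF P_\<Delta>[OF assms]] sum.remove[OF finite_N N_self[OF assms], of "\<lambda>\<beta>. \<beta> \<bullet> coroot \<gamma>"]
      coroot_self[OF nz] by simp
  moreover have c: "card (N \<gamma>) = 1 + card ?M"
    using card.remove[OF finite_N N_self[OF assms]] by simp
  ultimately have eq: "ht (coroot \<gamma>) - 1 - real (card (N \<gamma>)) = (\<Sum>\<beta>\<in>?M. \<beta> \<bullet> coroot \<gamma> - 1)"
    by (simp add: sum_subtractf)
  have nn: "\<And>\<beta>. \<beta> \<in> ?M \<Longrightarrow> 0 \<le> \<beta> \<bullet> coroot \<gamma> - 1" using N_pairing_ge[OF assms] by fastforce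
  show "real (card (N \<gamma>)) \<le> ht (coroot \<gamma>) - 1" using eq sum_nonneg[of ?M "\<lambda>\<beta>. \<beta> \<bullet> coroot \<gamma> - 1", OF nn] by linarith
  assume "real (card (N \<gamma>)) = ht (coroot \<gamma>) - 1" "\<beta> \<in> N \<gamma>" "\<beta> \<noteq> \<gamma>"
  then show "\<beta> \<bullet> coroot \<gamma> = 1"
    using eq sum_nonneg_eq_0_iff[of ?M "\<lambda>\<beta>. \<beta> \<bullet> coroot \<gamma> - 1"] nn finite_N by fastforce
qed

lemma flip_sum: "\<beta> + (- reflection \<gamma> \<beta>) = (\<beta> \<bullet> coroot \<gamma>) *\<^sub>R \<gamma>"
  by (simp add: reflection_coroot)

text \<open>The images of \<open>\<beta>\<close> and of its partner add up to a positive multiple of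
  \<open>R w \<gamma>\<close>, so they cannot both be negative. Each pair of signs therefore has a
  nonnegative sum, the pair of \<open>\<gamma>\<close> with itself gives 2, and a minimal step
  leaves 0 for all others.\<close>

lemma up_steps:
  assumes "w \<in> carrier W" "\<gamma> \<in> P" "R w \<gamma> \<in> P"
  shows "len w + 1 \<le> len (w \<otimes> rf \<gamma>)"
    and "len (w \<otimes> rf \<gamma>) = len w + 1 \<Longrightarrow> \<beta> \<in> N \<gamma> \<Longrightarrow> \<beta> \<noteq> \<gamma> \<Longrightarrow>
      sg (R w \<beta>) + sg (R w (- reflection \<gamma> \<beta>)) = 0"
proof -
  let ?f = "\<lambda>\<beta>. sg (R w \<beta>)"
  let ?g = "\<lambda>\<beta>. ?f \<beta> + ?f (- reflection \<gamma> \<beta>)"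
  let ?M = "N \<gamma> - {\<gamma>}"
  have nn: "0 \<le> ?g \<beta>" if b: "\<beta> \<in> N \<gamma>" for \<beta>
  proof (rule ccontr)
    assume "\<not> 0 \<le> ?g \<beta>"
    then have "R w \<beta> \<notin> P" "R w (- reflection \<gamma> \<beta>) \<notin> P" by (auto simp: sg_def split: if_splits)
    then have neg: "- R w \<beta> \<in> P" "- R w (- reflection \<gamma> \<beta>) \<in> P"
      using neg_P_iff \<Delta>_closed assms(1) P_\<Delta> N_P b N_flip by metis+
    have k: "0 \<le> \<beta> \<bullet> coroot \<gamma>" using N_pairing_ge[OF assms(2) b] by simp
    have "- R w \<beta> + - R w (- reflection \<gamma> \<beta>) = - ((\<beta> \<bullet> coroot \<gamma>) *\<^sub>R R w \<gamma>)"
      using flip_sum[of \<beta> \<gamma>] by (metis R_add R_scaleR minus_add_distrib)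
    moreover have "posV (- R w \<beta> + - R w (- reflection \<gamma> \<beta>))"
      using neg by (intro posV_add) (auto simp: P_alt)
    moreover have "posV ((\<beta> \<bullet> coroot \<gamma>) *\<^sub>R R w \<gamma>)"
      using assms(3) k by (simp add: P_alt posV_scale)
    ultimately have "(\<beta> \<bullet> coroot \<gamma>) *\<^sub>R R w \<gamma> = 0" using posV_antisym by metis
    then show False
      using N_pairing_ge[OF assms(2) b] \<Delta>_nonzero[OF P_\<Delta>[OF assms(3)]] by auto
  qed
  have "(\<Sum>\<beta>\<in>N \<gamma>. ?g \<beta>) = 2 * (\<Sum>\<beta>\<in>N \<gamma>. ?f \<beta>)"
    using sum.reindex_bij_betw[OF N_flip_bij[of \<gamma>], of ?f] by (simp add: sum.distrib)
  moreover have "(\<Sum>\<beta>\<in>N \<gamma>. ?g \<beta>) = 2 + (\<Sum>\<beta>\<in>?M. ?g \<beta>)"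
    using sum.remove[OF finite_N N_self[OF assms(2)], of ?g] assms(3)
    by (simp add: reflection_self sg_def)
  ultimately have eq: "2 * (int (len (w \<otimes> rf \<gamma>)) - int (len w)) = 2 + (\<Sum>\<beta>\<in>?M. ?g \<beta>)"
    using len_diff[OF assms(1) P_\<Delta>[OF assms(2)]] by simp
  have "0 \<le> (\<Sum>\<beta>\<in>?M. ?g \<beta>)" using nn by (intro sum_nonneg) auto
  then have "2 * int (len (w \<otimes> rf \<gamma>)) - 2 * int (len w) \<ge> 2" using eq by (simp add: right_diff_distrib)
  then show "len w + 1 \<le> len (w \<otimes> rf \<gamma>)" by linarith
  assume "len (w \<otimes> rf \<gamma>) = len w + 1" "\<beta> \<in> N \<gamma>" "\<beta> \<noteq> \<gamma>"
  then show "sg (R w \<beta>) + sg (R w (- reflection \<gamma> \<beta>)) = 0"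
    using eq sum_nonneg_eq_0_iff[of ?M ?g] nn finite_N by fastforce
qed

lemma up_iff:
  assumes "w \<in> carrier W" "\<gamma> \<in> P"
  shows "len w < len (w \<otimes> rf \<gamma>) \<longleftrightarrow> R w \<gamma> \<in> P"
proof
  show "len w < len (w \<otimes> rf \<gamma>)" if "R w \<gamma> \<in> P" using up_steps(1)[OF assms that] by simp
  show "R w \<gamma> \<in> P" if l: "len w < len (w \<otimes> rf \<gamma>)"
  proof (rule ccontr)
    assume "R w \<gamma> \<notin> P"
    then have "- R w \<gamma> \<in> P" using neg_P_iff \<Delta>_closed assms P_\<Delta> by metis
    then have "R (w \<otimes> rf \<gamma>) \<gamma> \<in> P"
      using assms by (simp add: R_mult_rf P_\<Delta> P_V reflection_self R_neg)
    then have "len (w \<otimes> rf \<gamma>) + 1 \<le> len w"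
      using up_steps(1)[of "w \<otimes> rf \<gamma>" \<gamma>] assms by (simp add: rf_closed P_\<Delta> mult_rf_rf)
    then show False using l by simp
  qed
qed

text \<open>Two bounds are chained: \<open>len w\<close> is at most
  \<open>len (w s) + card (N \<gamma>)\<close>, where \<open>s\<close> is the reflection, and
  \<open>card (N \<gamma>)\<close> is at most the height minus 1. Equality at the end forces both:
  the first makes all signs negative, the second makes all pairings minimal.\<close>

lemma down_steps:
  assumes "w \<in> carrier W" "\<gamma> \<in> P"
  shows "real (len w) \<le> real (len (w \<otimes> rf \<gamma>)) + ht (coroot \<gamma>) - 1"
    and "real (len w) = real (len (w \<otimes> rf \<gamma>)) + ht (coroot \<gamma>) - 1 \<Longrightarrow>
      real (len (rf \<gamma>)) = ht (coroot \<gamma>) - 1"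
    and "real (len w) = real (len (w \<otimes> rf \<gamma>)) + ht (coroot \<gamma>) - 1 \<Longrightarrow> \<beta> \<in> N \<gamma> \<Longrightarrow> R w \<beta> \<notin> P"
    and "real (len w) = real (len (w \<otimes> rf \<gamma>)) + ht (coroot \<gamma>) - 1 \<Longrightarrow> \<beta> \<in> N \<gamma> \<Longrightarrow> \<beta> \<noteq> \<gamma> \<Longrightarrow>
      \<beta> \<bullet> coroot \<gamma> = 1"
proof -
  let ?g = "\<lambda>\<beta>. sg (R w \<beta>) + 1"
  have eq: "int (len (w \<otimes> rf \<gamma>)) + int (card (N \<gamma>)) - int (len w) = (\<Sum>\<beta>\<in>N \<gamma>. ?g \<beta>)"
    using len_diff[OF assms(1) P_\<Delta>[OF assms(2)]] by (simp add: sum.distrib)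
  have nn: "0 \<le> ?g \<beta>" for \<beta> by (simp add: sg_def)
  have "0 \<le> (\<Sum>\<beta>\<in>N \<gamma>. ?g \<beta>)" using nn by (intro sum_nonneg) auto
  then have le: "len w \<le> len (w \<otimes> rf \<gamma>) + card (N \<gamma>)" using eq by linarith
  note ge = ht_ge(1)[OF assms(2)]
  show "real (len w) \<le> real (len (w \<otimes> rf \<gamma>)) + ht (coroot \<gamma>) - 1" using le ge by linarith
  assume e: "real (len w) = real (len (w \<otimes> rf \<gamma>)) + ht (coroot \<gamma>) - 1"
  then have c: "real (card (N \<gamma>)) = ht (coroot \<gamma>) - 1" using le ge by linarith
  show "real (len (rf \<gamma>)) = ht (coroot \<gamma>) - 1" using c assms by (simp add: len_rf P_\<Delta>)
  assume b: "\<beta> \<in> N \<gamma>"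
  have "(\<Sum>\<beta>\<in>N \<gamma>. ?g \<beta>) = 0" using eq e c by linarith
  then have "?g \<beta> = 0" using sum_nonneg_eq_0_iff[of "N \<gamma>" ?g] nn finite_N b by blast
  then show "R w \<beta> \<notin> P" by (auto simp: sg_def)
  show "\<beta> \<noteq> \<gamma> \<Longrightarrow> \<beta> \<bullet> coroot \<gamma> = 1" using ht_ge(2)[OF assms(2) c b] .
qed

lemma N_\<alpha>: "s \<in> S \<Longrightarrow> N (\<alpha> s) = {\<alpha> s}"
  using reflection_simple_P P_not_neg N_self[OF \<alpha>_P] by (auto simp: N_def)

lemma ht_\<alpha>: "s \<in> S \<Longrightarrow> ht (coroot (\<alpha> s)) = 2"
  using ht_coroot[OF \<alpha>_root] by (simp add: N_\<alpha> coroot_self \<alpha>_nonzero)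

text \<open>If \<open>N \<gamma>\<close> had one element, the reflection would have length 1, hence
  be some \<open>t\<close> in \<open>S\<close>, and \<open>N (\<alpha> t)\<close> contains only
  \<open>\<alpha> t\<close>. With two elements the height is at least 3.\<close>

lemma ht_nonsimple:
  assumes "\<gamma> \<in> P" "\<gamma> \<notin> \<alpha> ` S"
  shows "ht (coroot \<gamma>) > 2"
proof -
  have "card (N \<gamma>) \<noteq> 0" using N_self[OF assms(1)] finite_N by auto
  moreover have "card (N \<gamma>) \<noteq> 1"
  proof
    assume "card (N \<gamma>) = 1"
    then have l: "len (rf \<gamma>) = 1" using assms by (simp add: len_rf P_\<Delta>)
    then have "rf \<gamma> \<noteq> \<one>" by auto
    then obtain t where t: "t \<in> S" "len (rf \<gamma>) = len (rf \<gamma> \<otimes> t) + 1"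
      using descent_exists rf_closed assms P_\<Delta> by blast
    then have "rf \<gamma> \<otimes> t = \<one>" using l len_0_iff rf_closed assms P_\<Delta> S_carrier by (metis add_cancel_left_left m_closed)
    then have "rf \<gamma> = t" using t rf_closed[OF P_\<Delta>[OF assms(1)]] S_sq mult_s_s S_carrier l_one by metis
    then have "N \<gamma> = N (\<alpha> t)" using t by (simp add: N_Inv P_\<Delta> assms \<alpha>_root rf_\<alpha>)
    then have "\<gamma> = \<alpha> t" using N_self[OF assms(1)] N_\<alpha>[OF t(1)] by simp
    then show False using assms t by blast
  qed
  ultimately have "card (N \<gamma>) \<ge> 2" by linarith
  then show ?thesis using ht_ge(1)[OF assms(1)] by linarith
qed


section \<open>Monomials indexed by the coroot lattice\<close>

definition natcomb :: "'v \<Rightarrow> bool" where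
  "natcomb v \<longleftrightarrow> (\<exists>n. (\<forall>s. s \<notin> S \<longrightarrow> n s = 0) \<and> v = (\<Sum>s\<in>S. real (n s) *\<^sub>R coroot (\<alpha> s)))"

text \<open>Exponents are needed for sums of coroots, not only for single ones, because the weight
  of a path is such a sum. Outside \<open>natcomb\<close> the value is unspecified.\<close>

definition cvec :: "'v \<Rightarrow> 'w \<Rightarrow> nat" where
  "cvec v = (THE n. (\<forall>s. s \<notin> S \<longrightarrow> n s = 0) \<and> v = (\<Sum>s\<in>S. real (n s) *\<^sub>R coroot (\<alpha> s)))"

definition qwt :: "'v \<Rightarrow> 'w qpoly" where
  "qwt v = (\<Prod>s\<in>S. qvar s ^ cvec v s)"

lemma qwt_coroot: "qwt (coroot \<gamma>) = q_coroot S \<alpha> \<gamma>"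
  by (simp add: qwt_def q_coroot_def cvec_def coroot_coeffs_def)

lemma coroot_indep:
  assumes "(\<Sum>s\<in>S. c s *\<^sub>R coroot (\<alpha> s)) = (\<Sum>s\<in>S. d s *\<^sub>R coroot (\<alpha> s))" "s \<in> S"
  shows "c s = d s"
proof -
  have "(\<Sum>s\<in>S. (c s * (2 / (\<alpha> s \<bullet> \<alpha> s))) *\<^sub>R \<alpha> s) = (\<Sum>s\<in>S. (d s * (2 / (\<alpha> s \<bullet> \<alpha> s))) *\<^sub>R \<alpha> s)"
    using assms(1) by (simp add: coroot_def)
  from indep_coeffs[OF this assms(2)] show ?thesis using \<alpha>_nonzero[OF assms(2)] by simp
qed

lemma cvec_eq:
  assumes "\<And>s. s \<notin> S \<Longrightarrow> n s = 0" "v = (\<Sum>s\<in>S. real (n s) *\<^sub>R coroot (\<alpha> s))"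
  shows "cvec v = n"
  unfolding cvec_def
proof (rule the_equality)
  fix n' :: "'w \<Rightarrow> nat"
  assume n': "(\<forall>s. s \<notin> S \<longrightarrow> n' s = 0) \<and> v = (\<Sum>s\<in>S. real (n' s) *\<^sub>R coroot (\<alpha> s))"
  show "n' = n"
  proof
    fix s
    show "n' s = n s"
    proof (cases "s \<in> S")
      case True
      have "(\<Sum>s\<in>S. real (n' s) *\<^sub>R coroot (\<alpha> s)) = (\<Sum>s\<in>S. real (n s) *\<^sub>R coroot (\<alpha> s))"
        using n' assms(2) by simp
      from coroot_indep[OF this True] show ?thesis by simp
    qed (use n' assms(1) in simp)
  qed
qed (use assms in simp)

lemma qwt_zero: "qwt 0 = 1"
proof -
  have "cvec 0 = (\<lambda>_. 0)" by (rule cvec_eq) auto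
  then show ?thesis by (simp add: qwt_def)
qed

lemma natcomb_cvec:
  assumes "natcomb u"
  shows "s \<notin> S \<Longrightarrow> cvec u s = 0" "u = (\<Sum>s\<in>S. real (cvec u s) *\<^sub>R coroot (\<alpha> s))"
proof -
  obtain n where n: "\<And>s. s \<notin> S \<Longrightarrow> n s = 0" "u = (\<Sum>s\<in>S. real (n s) *\<^sub>R coroot (\<alpha> s))"
    using assms unfolding natcomb_def by blast
  have "cvec u = n" using n by (rule cvec_eq)
  then show "s \<notin> S \<Longrightarrow> cvec u s = 0" "u = (\<Sum>s\<in>S. real (cvec u s) *\<^sub>R coroot (\<alpha> s))"
    using n by auto
qed

lemma qwt_add:
  assumes "natcomb u" "natcomb v"
  shows "qwt (u + v) = qwt u * qwt v"
proof -
  note u = natcomb_cvec[OF assms(1)] and v = natcomb_cvec[OF assms(2)]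
  have "cvec (u + v) = (\<lambda>s. cvec u s + cvec v s)"
  proof (rule cvec_eq)
    show "u + v = (\<Sum>s\<in>S. real (cvec u s + cvec v s) *\<^sub>R coroot (\<alpha> s))"
      by (simp add: scaleR_add_left sum.distrib flip: u(2) v(2))
  qed (use u v in auto)
  then show ?thesis by (simp add: qwt_def power_add prod.distrib)
qed

lemma natcomb_zero: "natcomb 0"
  unfolding natcomb_def by (intro exI[of _ "\<lambda>_. 0"]) simp

lemma reflection_coroot_coroot:
  "reflection g (coroot h) = coroot h - (g \<bullet> coroot h) *\<^sub>R coroot (g::'v)"
  by (simp add: reflection_coroot coroot_def inner_commute)

lemma coroot_lattice: "\<gamma> \<in> \<Delta> \<Longrightarrow> coroot \<gamma> \<in> lattice (\<lambda>s. coroot (\<alpha> s))"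
proof -
  assume "\<gamma> \<in> \<Delta>"
  then obtain w s where ws: "w \<in> carrier W" "s \<in> S" "\<gamma> = R w (\<alpha> s)"
    unfolding roots_alt by blast
  have refl: "reflection (\<alpha> t) (coroot (\<alpha> s)) \<in> lattice (\<lambda>s. coroot (\<alpha> s))"
    if st: "s \<in> S" "t \<in> S" for s t
  proof -
    obtain k where k: "\<alpha> t \<bullet> coroot (\<alpha> s) = of_int k"
      using pairing_int[OF \<alpha>_root[OF st(2)] \<alpha>_root[OF st(1)]] by (rule Ints_cases)
    show ?thesis unfolding reflection_coroot_coroot k
      using lattice_diff[OF lattice_gen[OF st(1), of "\<lambda>s. coroot (\<alpha> s)"] lattice_gen[OF st(2), of "\<lambda>s. coroot (\<alpha> s)"]] .
  qed
  have "coroot (\<alpha> s) \<in> V" if "s \<in> S" for s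
    using \<alpha>_V[OF that] by (simp add: coroot_def span_scale)
  then show ?thesis unfolding ws(3) coroot_R
    using refl ws(1) lattice_gen[OF ws(2), of "\<lambda>s. coroot (\<alpha> s)"]
    by (intro R_lattice[of "\<lambda>s. coroot (\<alpha> s)"]) auto
qed

text \<open>Integrality comes from the coroot lattice, nonnegativity from the positive coefficients
  of \<open>\<gamma>\<close>: the two expansions of \<open>coroot \<gamma>\<close> in simple roots
  are compared.\<close>

lemma natcomb_coroot:
  assumes "\<gamma> \<in> P"
  shows "natcomb (coroot \<gamma>)"
proof -
  obtain z :: "'w \<Rightarrow> int" where z: "coroot \<gamma> = (\<Sum>s\<in>S. of_int (z s) *\<^sub>R coroot (\<alpha> s))"
    using coroot_lattice[OF P_\<Delta>[OF assms]] unfolding lattice_def by blast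
  obtain c where c: "\<forall>s\<in>S. 0 \<le> c s" "\<gamma> = (\<Sum>s\<in>S. c s *\<^sub>R \<alpha> s)"
    using assms unfolding P_alt posV_def by blast
  have "(\<Sum>s\<in>S. (2 / (\<gamma> \<bullet> \<gamma>) * c s) *\<^sub>R \<alpha> s) = coroot \<gamma>"
    unfolding coroot_def by (subst (3) c(2)) (simp add: scaleR_sum_right)
  also have "\<dots> = (\<Sum>s\<in>S. (of_int (z s) * (2 / (\<alpha> s \<bullet> \<alpha> s))) *\<^sub>R \<alpha> s)"
    unfolding z by (simp add: coroot_def)
  finally have eq: "(\<Sum>s\<in>S. (2 / (\<gamma> \<bullet> \<gamma>) * c s) *\<^sub>R \<alpha> s) = (\<Sum>s\<in>S. (of_int (z s) * (2 / (\<alpha> s \<bullet> \<alpha> s))) *\<^sub>R \<alpha> s)" .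
  have nn: "0 \<le> z s" if s: "s \<in> S" for s
  proof -
    have "0 \<le> of_int (z s) * (2 / (\<alpha> s \<bullet> \<alpha> s))"
      using indep_coeffs[OF eq s] c(1) s by (metis divide_nonneg_nonneg inner_ge_zero mult_nonneg_nonneg zero_le_numeral)
    moreover have "0 < 2 / (\<alpha> s \<bullet> \<alpha> s)" using \<alpha>_nonzero[OF s] by simp
    ultimately have "0 \<le> real_of_int (z s)"
      using zero_le_mult_iff[of "real_of_int (z s)" "2 / (\<alpha> s \<bullet> \<alpha> s)"] by linarith
    then show ?thesis by simp
  qed
  then have "coroot \<gamma> = (\<Sum>s\<in>S. real (if s \<in> S then nat (z s) else 0) *\<^sub>R coroot (\<alpha> s))"
    unfolding z by (intro sum.cong) auto
  then show ?thesis unfolding natcomb_def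
    by (intro exI[of _ "\<lambda>s. if s \<in> S then nat (z s) else 0"]) auto
qed

lemma qwt_coroot_\<alpha>: "s \<in> S \<Longrightarrow> qwt (coroot (\<alpha> s)) = qvar s"
proof -
  assume s: "s \<in> S"
  have "cvec (coroot (\<alpha> s)) = (\<lambda>t. if t = s then 1 else 0)"
    using s finite_S by (intro cvec_eq)
      (auto simp: if_distrib[of real] if_distrib[of "\<lambda>c. c *\<^sub>R _"] cong: if_cong)
  then show ?thesis using s finite_S
    by (simp add: qwt_def if_distrib[of "\<lambda>n. qvar _ ^ n"] cong: if_cong)
qed

end

section \<open>Linear extension\<close>

abbreviation (input) "lookup \<equiv> Poly_Mapping.lookup"
abbreviation (input) "keys \<equiv> Poly_Mapping.keys"
abbreviation (input) "single \<equiv> Poly_Mapping.single"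

definition smul :: "'r::semiring_0 \<Rightarrow> ('k \<Rightarrow>\<^sub>0 'r) \<Rightarrow> ('k \<Rightarrow>\<^sub>0 'r)" where
  "smul p = Poly_Mapping.map ((*) p)"

lemma lookup_smul [simp]: "lookup (smul p x) k = p * lookup x k"
  by (simp add: smul_def Poly_Mapping.map.rep_eq when_def)

lemma smul_add_right: "smul p (x + y) = smul p x + smul p y"
  by (rule poly_mapping_eqI) (simp add: lookup_add distrib_left)

lemma smul_add_left: "smul (p + q) x = smul p x + smul q x"
  by (rule poly_mapping_eqI) (simp add: lookup_add distrib_right)

lemma smul_smul: "smul p (smul q x) = smul (p * q) x"
  by (rule poly_mapping_eqI) (simp add: mult.assoc)

lemma smul_zero_left [simp]: "smul 0 x = 0"
  by (rule poly_mapping_eqI) simp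

lemma smul_zero_right [simp]: "smul p 0 = 0"
  by (rule poly_mapping_eqI) simp

lemma smul_one [simp]: "smul (1::'r::semiring_1) x = x"
  by (rule poly_mapping_eqI) simp

lemma smul_single [simp]: "smul p (single k c) = single k (p * c)"
  by (rule poly_mapping_eqI) (simp add: lookup_single when_def)

lemma smul_sum: "smul p (sum f A) = (\<Sum>a\<in>A. smul p (f a))"
  by (induction A rule: infinite_finite_induct) (simp_all add: smul_add_right)

lemma smul_minus_right: "smul p (- x) = - smul (p::'r::ring) x"
  by (rule poly_mapping_eqI) simp

lemma pm_sum_single: "(x :: 'k \<Rightarrow>\<^sub>0 'r::comm_monoid_add) = (\<Sum>k\<in>keys x. single k (lookup x k))"
proof (rule poly_mapping_eqI)
  fix j
  show "lookup x j =
    lookup (\<Sum>k\<in>keys x. single k (lookup x k)) j"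
    by (cases "j \<in> keys x") (auto simp: lookup_sum lookup_single when_def in_keys_iff)
qed

lemma pm_induct [case_names single add]:
  fixes x :: "'k \<Rightarrow>\<^sub>0 'r::comm_monoid_add"
  assumes "\<And>k c. Q (single k c)" "\<And>x y. Q x \<Longrightarrow> Q y \<Longrightarrow> Q (x + y)"
  shows "Q x"
proof -
  have "Q (sum (\<lambda>k. single k (lookup x k)) A)" if "finite A" for A
    using that assms(1)[of _ 0]
    by (induction A rule: finite_induct) (simp_all add: assms)
  then show ?thesis using pm_sum_single[of x] finite_keys by metis
qed

definition lin :: "('k \<Rightarrow> ('j \<Rightarrow>\<^sub>0 'r)) \<Rightarrow> ('k \<Rightarrow>\<^sub>0 'r::semiring_0) \<Rightarrow> ('j \<Rightarrow>\<^sub>0 'r)" where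
  "lin b x = (\<Sum>k\<in>keys x. smul (lookup x k) (b k))"

lemma lin_superset:
  "finite A \<Longrightarrow> keys x \<subseteq> A \<Longrightarrow> lin b x = (\<Sum>k\<in>A. smul (lookup x k) (b k))"
  unfolding lin_def by (rule sum.mono_neutral_left) (auto simp: in_keys_iff)

lemma lin_add: "lin b (x + y) = lin b x + lin b y"
proof -
  let ?A = "keys x \<union> keys y"
  have "lin b (x + y) = (\<Sum>k\<in>?A. smul (lookup (x + y) k) (b k))"
    by (rule lin_superset) (auto simp: keys_add)
  also have "\<dots> = lin b x + lin b y"
    using lin_superset[of ?A x b] lin_superset[of ?A y b]
    by (simp add: lookup_add smul_add_left sum.distrib)
  finally show ?thesis .
qed

lemma lin_single [simp]: "lin b (single k c) = smul c (b k)"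
  by (subst lin_superset[of "{k}"]) auto

lemma lin_zero [simp]: "lin b 0 = 0"
  by (simp add: lin_def)

lemma lin_smul: "lin b (smul p x) = smul p (lin b x)"
  by (induction x rule: pm_induct) (simp_all add: smul_add_right lin_add smul_smul)

lemma lin_minus: "lin b (- x) = - lin b (x::_ \<Rightarrow>\<^sub>0 'r::ring)"
  using lin_add[of b x "- x"] by (simp add: eq_neg_iff_add_eq_0 add.commute)

lemma lin_sum: "lin b (sum f A) = (\<Sum>a\<in>A. lin b (f a))"
  by (induction A rule: infinite_finite_induct) (simp_all add: lin_add)

section \<open>Coordinates in a plane\<close>

lemma plane_basis:
  fixes a b :: "'v::real_vector"
  assumes "u = u1 *\<^sub>R a + u2 *\<^sub>R b" "v = v1 *\<^sub>R a + v2 *\<^sub>R b" "w = w1 *\<^sub>R a + w2 *\<^sub>R b"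
    and "u \<noteq> 0" "v \<notin> span {u}"
  shows "\<exists>p q. w = p *\<^sub>R u + q *\<^sub>R v"
proof -
  let ?d = "u1 * v2 - u2 * v1"
  have "?d \<noteq> 0"
  proof
    assume d: "?d = 0"
    have "v = (v1 / u1) *\<^sub>R u" if "u1 \<noteq> 0"
      using that d assms(1,2) by (simp add: scaleR_add_right field_simps)
    moreover have "v = (v2 / u2) *\<^sub>R u" if "u1 = 0" "u2 \<noteq> 0"
      using that d assms(1,2) by simp
    moreover have "u1 \<noteq> 0 \<or> u2 \<noteq> 0" using assms(1,4) by auto
    ultimately have "\<exists>c. v = c *\<^sub>R u" by blast
    then show False using assms(5) by (auto simp: span_singleton)
  qed
  \<comment> \<open>Cramer's rule with determinant \<open>?d\<close>.\<close>
  then have e: "(w1 * v2 - w2 * v1) / ?d * u1 + (u1 * w2 - u2 * w1) / ?d * v1 = w1"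
    "(w1 * v2 - w2 * v1) / ?d * u2 + (u1 * w2 - u2 * w1) / ?d * v2 = w2"
    by (simp_all add: add_divide_distrib[symmetric] nonzero_divide_eq_eq) (simp_all add: algebra_simps)
  show ?thesis
  proof (intro exI)
    have "((w1 * v2 - w2 * v1) / ?d) *\<^sub>R u + ((u1 * w2 - u2 * w1) / ?d) *\<^sub>R v
      = ((w1 * v2 - w2 * v1) / ?d * u1 + (u1 * w2 - u2 * w1) / ?d * v1) *\<^sub>R a
       + ((w1 * v2 - w2 * v1) / ?d * u2 + (u1 * w2 - u2 * w1) / ?d * v2) *\<^sub>R b"
      unfolding assms(1,2) by (simp only: scaleR_add_left scaleR_add_right scaleR_scaleR ac_simps)
    then show "w = ((w1 * v2 - w2 * v1) / ?d) *\<^sub>R u + ((u1 * w2 - u2 * w1) / ?d) *\<^sub>R v"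
      unfolding e assms(3) by simp
  qed
qed

lemma comb_unique:
  fixes u v :: "'v::real_vector"
  assumes "u \<noteq> 0" "v \<notin> span {u}" "x *\<^sub>R u + y *\<^sub>R v = x' *\<^sub>R u + y' *\<^sub>R v"
  shows "x = x' \<and> y = y'"
proof -
  have eq: "(y - y') *\<^sub>R v = (x' - x) *\<^sub>R u" using assms(3) by (simp add: algebra_simps)
  have "y = y'"
  proof (rule ccontr)
    assume n: "y \<noteq> y'"
    have "v = (1 / (y - y')) *\<^sub>R ((y - y') *\<^sub>R v)" using n by simp
    also have "\<dots> = ((x' - x) / (y - y')) *\<^sub>R u" unfolding eq by simp
    finally show False using assms(2) by (metis rangeI span_singleton)
  qed
  then show ?thesis using eq assms(1) by simp
qed

lemma not_in_span:
  fixes u :: "'v::real_inner"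
  assumes "R \<inter> span {u} = {u, - u}" "v \<in> R" "v \<noteq> u" "v \<noteq> - u"
  shows "v \<notin> span {u}"
  using assms by blast

context crystallographic_coxeter
begin

section \<open>Dihedral sequences\<close>

text \<open>The number of positive roots of the root system of rank two with Cartan integers \<open>- A\<close> and
  \<open>- B\<close>, where \<open>k = A * B \<in> {0, 1, 2, 3}\<close>.\<close>

definition dsize :: "int \<Rightarrow> nat" where
  "dsize k = (if k = 0 then 2 else if k = 1 then 3 else if k = 2 then 4 else 6)"

text \<open>Reflecting \<open>a\<close> and \<open>b\<close> in each other produces all positive
  roots of the rank two system with simple roots \<open>a\<close> and \<open>b\<close> inside
  \<open>Z\<close>. Up to sign each lies in \<open>G\<close>, and no two of them agree up to
  sign.\<close>

lemma dsize_le_card: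
  assumes Z: "Z = G \<union> uminus ` G" "finite G" "\<And>x. x \<in> Z \<Longrightarrow> reflection x ` Z = Z"
    and ab: "a \<in> Z" "b \<in> Z" "a \<noteq> 0" "b \<notin> span {a}"
    and AB: "b \<bullet> coroot a = - real_of_int A" "a \<bullet> coroot b = - real_of_int B"
      "0 \<le> A" "0 \<le> B" "A * B < 4" "A = 0 \<longleftrightarrow> B = 0"
  shows "dsize (A * B) \<le> card G"
proof -
  have refl: "reflection x y \<in> Z" if "x \<in> Z" "y \<in> Z" for x y using Z(3)[OF that(1)] that by blast
  define v where "v c = real_of_int (fst c) *\<^sub>R a + real_of_int (snd c) *\<^sub>R b" for c :: "int \<times> int"
  have nb: "b \<noteq> 0" using ab(4) span_zero by metis
  have ra: "reflection a (v (x, y)) = v (A * y - x, y)" for x y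
    using AB(1) coroot_self[OF ab(3)]
    by (simp add: v_def reflection_coroot inner_add_left algebra_simps; simp flip: scaleR_add_left)
  have rb: "reflection b (v (x, y)) = v (x, B * x - y)" for x y
    using AB(2) coroot_self[OF nb]
    by (simp add: v_def reflection_coroot inner_add_left algebra_simps; simp flip: scaleR_add_left)
  have m0: "v (1, 0) \<in> Z" "v (0, 1) \<in> Z" using ab by (auto simp: v_def)
  have m1: "v (A, 1) \<in> Z" "v (1, B) \<in> Z"
    using refl[OF ab(1) m0(2)] refl[OF ab(2) m0(1)] by (simp_all add: ra rb)
  have m2: "v (A * B - 1, B) \<in> Z" "v (A, A * B - 1) \<in> Z"
    using refl[OF ab(1) m1(2)] refl[OF ab(2) m1(1)] by (simp_all add: ra rb mult.commute)
  \<comment> \<open>The coefficients of these positive roots, found by at most two reflections from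
    the simple ones.\<close>
  define C :: "(int \<times> int) set" where
    "C = (if A * B = 0 then {(1, 0), (0, 1)}
      else if A * B = 1 then {(1, 0), (0, 1), (A, 1)}
      else if A * B = 2 then {(1, 0), (0, 1), (A, 1), (1, B)}
      else {(1, 0), (0, 1), (A, 1), (1, B), (A * B - 1, B), (A, A * B - 1)})"
  note cases = cartan_cases[OF AB(3-6)]
  have card: "card C = dsize (A * B)" using cases by (auto simp: C_def dsize_def)
  have CR: "\<And>c. c \<in> C \<Longrightarrow> v c \<in> Z" using m0 m1 m2 by (auto simp: C_def split: if_splits)
  have "\<forall>c\<in>C. 0 \<le> fst c \<and> 0 \<le> snd c \<and> c \<noteq> (0, 0)"
    using cases by (elim disjE conjE) (simp_all add: C_def)
  then have Cpos: "\<And>c. c \<in> C \<Longrightarrow> 0 \<le> fst c \<and> 0 \<le> snd c \<and> c \<noteq> (0, 0)" by blast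
  have vinj: "c = d" if "v c = v d" for c d
    using comb_unique[OF ab(3,4), of "fst c" "snd c" "fst d" "snd d"] that
    by (simp add: v_def prod_eq_iff)
  have vneg: "- v c = v (- fst c, - snd c)" for c by (simp add: v_def)
  have vinj': "False" if "c \<in> C" "d \<in> C" "v c = - v d" for c d
  proof -
    have "c = (- fst d, - snd d)" using vinj that(3) vneg by metis
    then show False using Cpos[OF that(1)] Cpos[OF that(2)] by (cases c; cases d) auto
  qed
  \<comment> \<open>Selects whichever of a root and its negative belongs to \<open>G\<close>. This
    stays injective because the coefficients in \<open>C\<close> are nonnegative and not both zero,
    so no root of the list is the negative of another.\<close>
  define f where "f c = (if v c \<in> G then v c else - v c)" for c
  have fG: "f c \<in> G" if "c \<in> C" for c using CR[OF that] Z(1) by (auto simp: f_def)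
  have "inj_on f C"
  proof (rule inj_onI)
    fix c d assume "c \<in> C" "d \<in> C" "f c = f d"
    then show "c = d" using vinj[of c d] vinj'[of c d] vinj'[of d c] by (auto simp: f_def split: if_splits)
  qed
  then show ?thesis using card card_inj_on_le[of f C G, OF _ image_subsetI[OF fG] Z(2)] by simp
qed

text \<open>Strict Cauchy-Schwarz, from the nonzero component of \<open>v\<close> orthogonal to
  \<open>u\<close>; the product \<open>X Y\<close> is \<open>4 cos^2\<close> of the angle.\<close>

lemma cartan_bounds:
  assumes "u \<noteq> 0" "v \<notin> span {u}" "u \<bullet> coroot v = real_of_int X" "v \<bullet> coroot u = real_of_int (Y::int)"
  shows "0 \<le> X * Y" "X * Y < 4" "X = 0 \<longleftrightarrow> Y = 0"
proof -
  have nv: "v \<noteq> 0" using assms(2) span_zero by metis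
  have p: "0 < u \<bullet> u" "0 < v \<bullet> v" using assms(1) nv by auto
  let ?t = "(u \<bullet> v) / (u \<bullet> u)"
  have "v - ?t *\<^sub>R u \<noteq> 0" using assms(2) by (metis eq_iff_diff_eq_0 rangeI span_singleton)
  then have "0 < (v - ?t *\<^sub>R u) \<bullet> (v - ?t *\<^sub>R u)" by simp
  also have "\<dots> = v \<bullet> v - (u \<bullet> v)\<^sup>2 / (u \<bullet> u)"
    using p by (simp add: inner_diff_left inner_diff_right inner_commute power2_eq_square field_simps)
  finally have lt: "(u \<bullet> v)\<^sup>2 < (u \<bullet> u) * (v \<bullet> v)" using p by (simp add: field_simps)
  have X: "real_of_int X = 2 * (u \<bullet> v) / (v \<bullet> v)" and Y: "real_of_int Y = 2 * (u \<bullet> v) / (u \<bullet> u)"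
    using assms(3,4) by (auto simp: coroot_def inner_commute)
  have XY: "real_of_int (X * Y) = 4 * (u \<bullet> v)\<^sup>2 / ((u \<bullet> u) * (v \<bullet> v))"
    using X Y by (simp add: power2_eq_square)
  have "0 \<le> real_of_int (X * Y)" unfolding XY using p by simp
  then show "0 \<le> X * Y" using of_int_0_le_iff by blast
  have "real_of_int (X * Y) < 4" unfolding XY using p lt by (simp add: field_simps)
  then show "X * Y < 4" by linarith
  have "real_of_int X = 0 \<longleftrightarrow> real_of_int Y = 0" using X Y p by simp
  then show "X = 0 \<longleftrightarrow> Y = 0" by simp
qed

text \<open>Every other position of \<open>w\<close> would put one of the roots, or the mirror image of \<open>u\<close> or \<open>w\<close> in
  \<open>v\<close>, into the interior of one of the two cones.\<close>

lemma fan_step: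
  assumes P: "u \<in> P" "v \<in> P" "w \<in> P"
    and ne: "v \<notin> span {u}" "w \<noteq> u" "w \<noteq> v" "u \<noteq> v"
    and w: "w = p *\<^sub>R u + q *\<^sub>R v"
    and cone1: "\<And>x y. 0 \<le> x \<Longrightarrow> 0 \<le> y \<Longrightarrow> x *\<^sub>R u + y *\<^sub>R v \<in> \<Delta> \<Longrightarrow>
      x *\<^sub>R u + y *\<^sub>R v = u \<or> x *\<^sub>R u + y *\<^sub>R v = v"
    and cone2: "\<And>x y. 0 \<le> x \<Longrightarrow> 0 \<le> y \<Longrightarrow> x *\<^sub>R v + y *\<^sub>R w \<in> \<Delta> \<Longrightarrow>
      x *\<^sub>R v + y *\<^sub>R w = v \<or> x *\<^sub>R v + y *\<^sub>R w = w"
  shows "w = (u \<bullet> coroot v) *\<^sub>R v - u"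
proof -
  let ?C = "u \<bullet> coroot v"
  have D: "u \<in> \<Delta>" "v \<in> \<Delta>" "w \<in> \<Delta>" using P P_\<Delta> by auto
  have u0: "u \<noteq> 0" and v0: "v \<noteq> 0" using D \<Delta>_nonzero by auto
  have ru: "- reflection v u = ?C *\<^sub>R v - u" by (simp add: reflection_coroot)
  consider "0 \<le> p" "0 \<le> q" | "0 \<le> p" "q < 0" | "p < 0" "q \<le> 0" | "p < 0" "0 < q" by linarith
  then show ?thesis
  proof cases
    case 1
    then show ?thesis using cone1[of p q] w D ne by auto
  next
    case 2
    have eq: "p *\<^sub>R u = w + (- q) *\<^sub>R v" using w by simp
    have "p \<noteq> 0"
    proof
      assume "p = 0"
      then have "w + (- q) *\<^sub>R v = 0" using eq by simp
      then have "- w = (- q) *\<^sub>R v" by (metis add_eq_0_iff add.commute minus_minus)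
      moreover have "posV ((- q) *\<^sub>R v)" using 2 P by (intro posV_scale) (auto simp: P_alt)
      ultimately have "posV (- w)" by simp
      then have "w = 0" using P(3) posV_antisym[of w] P_alt by blast
      then show False using D \<Delta>_nonzero by blast
    qed
    then have "u = (1 / p) *\<^sub>R (p *\<^sub>R u)" by simp
    also have "\<dots> = (- q / p) *\<^sub>R v + (1 / p) *\<^sub>R w" unfolding eq by (simp add: scaleR_add_right scaleR_diff_right)
    finally have "u = (- q / p) *\<^sub>R v + (1 / p) *\<^sub>R w" .
    moreover have "0 \<le> - q / p" "0 \<le> 1 / p" using 2 by (auto simp: divide_nonpos_nonneg)
    ultimately have "u = v \<or> u = w" using cone2[of "- q / p" "1 / p"] D by metis
    then show ?thesis using ne by auto
  next
    case 3
    have "- w = (- p) *\<^sub>R u + (- q) *\<^sub>R v" using w by simp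
    moreover have "posV ((- p) *\<^sub>R u + (- q) *\<^sub>R v)"
      using 3 P by (intro posV_add posV_scale) (auto simp: P_alt)
    ultimately have "posV (- w)" by simp
    then have "w = 0" using P(3) posV_antisym[of w] P_alt by blast
    then show ?thesis using D \<Delta>_nonzero by blast
  next
    case 4
    \<comment> \<open>Here \<open>v\<close> lies strictly between \<open>u\<close> and
      \<open>w\<close>. The sign of \<open>q + p * ?C\<close> decides which mirror image falls into
      the opposite cone: that of \<open>w\<close> into the first, or that of \<open>u\<close> into
      the second.\<close>
    have rw: "- reflection v w = (- p) *\<^sub>R u + (q + p * ?C) *\<^sub>R v"
      unfolding w using coroot_self[OF v0]
      by (simp add: reflection_coroot inner_add_left algebra_simps) (simp flip: scaleR_add_left)
    have mem: "- reflection v w \<in> \<Delta>" "- reflection v u \<in> \<Delta>"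
      using D by (auto intro!: \<Delta>_neg reflection_\<Delta>)
    show ?thesis
    proof (cases "0 \<le> q + p * ?C")
      case True
      then have "- reflection v w = u \<or> - reflection v w = v"
        using cone1[of "- p" "q + p * ?C"] 4 mem(1) rw by simp
      then show ?thesis
      proof
        assume "- reflection v w = u"
        then have "(- p) *\<^sub>R u + (q + p * ?C) *\<^sub>R v = 1 *\<^sub>R u + 0 *\<^sub>R v" using rw by simp
        from comb_unique[OF u0 ne(1) this] have "p = - 1" "q = ?C" by auto
        then show ?thesis using w by simp
      next
        assume "- reflection v w = v"
        then have "reflection v (- reflection v w) = - v" by (simp add: reflection_self)
        then have "w = v" by (simp add: reflection_neg reflection_invol)
        then show ?thesis using ne by simp
      qed
    next
      case False
      have "u = (1 / p) *\<^sub>R w - (q / p) *\<^sub>R v" using w 4 by (simp add: scaleR_add_right)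
      then have e: "?C *\<^sub>R v - u = (?C + q / p) *\<^sub>R v + (- 1 / p) *\<^sub>R w"
        by (simp add: algebra_simps)
      have "p * (?C + q / p) = q + p * ?C" using 4 by (simp add: distrib_left)
      then have "p * (?C + q / p) < 0" using False by simp
      then have "0 \<le> ?C + q / p" using 4 by (smt (verit) mult_nonpos_nonpos)
      then have "?C *\<^sub>R v - u = v \<or> ?C *\<^sub>R v - u = w"
        using cone2[of "?C + q / p" "- 1 / p"] 4 mem(2) ru e by (simp add: divide_nonneg_neg)
      then show ?thesis
      proof
        assume "?C *\<^sub>R v - u = v"
        then have "reflection v (- reflection v u) = - v" using ru by (simp add: reflection_self)
        then have "u = v" by (simp add: reflection_neg reflection_invol)
        then show ?thesis using ne by simp
      qed simp
    qed
  qed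
qed

text \<open>\<open>w\<close> is the image of \<open>u\<close> under \<open>- reflection v\<close>,
  an isometry that fixes \<open>v\<close>, so its Cartan integers with \<open>v\<close> are those of
  \<open>u\<close>. This makes the integers along a fan alternate.\<close>

lemma pairing_step:
  fixes u v w :: 'v
  assumes "v \<noteq> 0" "w = (u \<bullet> coroot v) *\<^sub>R v - u"
  shows "w \<bullet> coroot v = u \<bullet> coroot v" "v \<bullet> coroot w = v \<bullet> coroot u"
proof -
  show "w \<bullet> coroot v = u \<bullet> coroot v" using assms coroot_self[OF assms(1)] by (simp add: inner_diff_left)
  have w: "w = - reflection v u" using assms by (simp add: reflection_coroot)
  have "w \<bullet> w = u \<bullet> u" unfolding w by (simp add: reflection_inner)
  moreover have "v \<bullet> w = v \<bullet> u"
    using reflection_inner[of v v u] unfolding w by (simp add: reflection_self)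
  ultimately show "v \<bullet> coroot w = v \<bullet> coroot u" by (simp add: coroot_def)
qed

end

text \<open>The Cartan integer \<open>\<langle>\<rho>\<^sub>j\<^sub>-\<^sub>1, \<rho>\<^sub>j\<^sup>\<vee>\<rangle>\<close> of a fan of roots alternates between two values.\<close>

definition cart :: "int \<Rightarrow> int \<Rightarrow> int \<Rightarrow> int" where
  "cart A B j = (if even j then A else B)"

text \<open>The types \<open>A1 x A1\<close>, \<open>A2\<close>, \<open>B2\<close> and
  \<open>G2\<close>, the last two in both orientations.\<close>

definition dihedral_table :: "(int \<times> int \<times> int) list" where
  "dihedral_table = [(2, 0, 0), (3, 1, 1), (4, 1, 2), (4, 2, 1), (6, 1, 3), (6, 3, 1)]"

context crystallographic_coxeter
begin

text \<open>The simple pair \<open>a\<close>, \<open>b\<close> provided by the type determines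
  \<open>m\<close>, but has no stated relation to \<open>g 0\<close> and \<open>g 1\<close>. It
  serves to count roots; the Cartan integers of the first two members of the sequence are then
  determined afresh and matched with \<open>m\<close>.\<close>

lemma dihedral_data:
  assumes ds: "dihedral_sequence P m g"
  shows "\<exists>A B. (int m, A, B) \<in> set dihedral_table
    \<and> (\<forall>n. g (n + 2) = real_of_int (cart A B (int n + 1)) *\<^sub>R g (n + 1) - g n)
    \<and> g 0 \<bullet> coroot (g 1) = real_of_int B \<and> g 1 \<bullet> coroot (g 0) = real_of_int A"
proof -
  define G where "G = g ` {..<m}"
  define Z where "Z = G \<union> uminus ` G"
  have m2: "2 \<le> m" and gP: "\<And>i. i < m \<Longrightarrow> g i \<in> P" and I2: "root_system_I2 m Z"
    and cone: "\<And>i. i + 1 < m \<Longrightarrow>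
        {x *\<^sub>R g i + y *\<^sub>R g (i + 1) | x y. 0 \<le> x \<and> 0 \<le> y} \<inter> P = {g i, g (i + 1)}"
    and anti: "\<And>j. g (j + m) = - g j"
    using ds unfolding dihedral_sequence_def G_def Z_def by auto
  have rs: "root_system Z" using I2 by (simp add: root_system_I2_def)
  then have spanZ: "\<And>x. x \<in> Z \<Longrightarrow> Z \<inter> span {x} = {x, - x}"
    and reflZ: "\<And>x. x \<in> Z \<Longrightarrow> reflection x ` Z = Z" by (auto simp: root_system_def)
  have GP: "G \<subseteq> P" using gP by (auto simp: G_def)
  then have Z\<Delta>: "Z \<subseteq> \<Delta>" using P_\<Delta> \<Delta>_neg by (auto simp: Z_def)
  have finG: "finite G" by (simp add: G_def)
  obtain a b where ab: "a \<in> Z" "b \<in> Z" "a \<noteq> b" "independent {a, b}"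
    and coord: "\<And>x. x \<in> Z \<Longrightarrow> \<exists>x1 x2. x = x1 *\<^sub>R a + x2 *\<^sub>R b"
    and angle: "a \<bullet> b = - norm a * norm b * cos (pi / real m)"
    using I2 unfolding root_system_I2_def by metis
  have a0: "a \<noteq> 0" and b0: "b \<noteq> 0" using ab Z\<Delta> \<Delta>_nonzero by auto
  have bspan: "b \<notin> span {a}"
    using ab(3,4) independent_insert[of b "{a}"] by (simp add: insert_commute)
  obtain A' B' :: int where AB': "b \<bullet> coroot a = real_of_int A'" "a \<bullet> coroot b = real_of_int B'"
    using pairing_int ab(1,2) Z\<Delta> Ints_cases by (metis subsetD)
  have "0 \<le> pi / real m" "pi / real m \<le> pi / 2" using m2 by (auto simp: field_simps)
  moreover from this have "- (pi / 2) \<le> pi / real m" using pi_gt_zero by linarith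
  ultimately have c0: "0 \<le> cos (pi / real m)" by (intro cos_ge_zero)
  have eA: "real_of_int A' = - (2 * norm b * cos (pi / real m) / norm a)"
    using AB'(1) angle a0 by (simp add: coroot_def inner_commute dot_square_norm power2_eq_square)
  have eB: "real_of_int B' = - (2 * norm a * cos (pi / real m) / norm b)"
    using AB'(2) angle b0 by (simp add: coroot_def dot_square_norm power2_eq_square)
  have neg: "A' \<le> 0" "B' \<le> 0"
  proof -
    have "real_of_int A' \<le> 0" "real_of_int B' \<le> 0" unfolding eA eB using c0 by simp_all
    then show "A' \<le> 0" "B' \<le> 0" by simp_all
  qed
  have "4 * (cos (pi / real m))\<^sup>2 = real_of_int (A' * B')"
    using eA eB a0 b0 by (simp add: power2_eq_square)
  from crystallographic_angle[OF m2 this] have m_dsize: "m = dsize (A' * B')"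
    by (auto simp: dsize_def)
  have "dsize ((- A') * (- B')) \<le> card G"
  proof (rule dsize_le_card[OF Z_def finG reflZ ab(1,2) a0 bspan])
    show "b \<bullet> coroot a = - real_of_int (- A')" "a \<bullet> coroot b = - real_of_int (- B')" using AB' by auto
    show "0 \<le> - A'" "0 \<le> - B'" using neg by auto
    show "- A' * - B' < 4" "(- A' = 0) = (- B' = 0)"
      using cartan_bounds[OF a0 bspan AB'(2,1)] by (auto simp: mult.commute)
  qed auto
  \<comment> \<open>There are at least \<open>m\<close> roots up to sign, so a sequence of
    \<open>m\<close> terms cannot repeat itself.\<close>
  then have "card (g ` {..<m}) = card {..<m}"
    using m_dsize card_image_le[of "{..<m}" g] by (simp add: G_def)
  then have inj: "inj_on g {..<m}" by (intro eq_card_imp_inj_on) auto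
  have gZ: "g i \<in> Z" if "i < m" for i using that by (auto simp: Z_def G_def)
  have nspan: "g j \<notin> span {g i}" if ij: "i < m" "j < m" "i \<noteq> j" for i j
  proof (rule not_in_span[OF spanZ[OF gZ[OF ij(1)]] gZ[OF ij(2)]])
    show "g j \<noteq> g i" using inj ij by (auto dest: inj_onD)
    show "g j \<noteq> - g i" using gP[OF ij(1)] gP[OF ij(2)] P_not_neg by metis
  qed
  have neq: "g j \<noteq> g i" if "i < m" "j < m" "i \<noteq> j" for i j
    using inj that by (auto dest: inj_onD)
  have cone': "x *\<^sub>R g i + y *\<^sub>R g (i + 1) = g i \<or> x *\<^sub>R g i + y *\<^sub>R g (i + 1) = g (i + 1)"
    if "i + 1 < m" "0 \<le> x" "0 \<le> y" "x *\<^sub>R g i + y *\<^sub>R g (i + 1) \<in> \<Delta>" for i x y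
  proof -
    have "x *\<^sub>R g i + y *\<^sub>R g (i + 1) \<in> P" using that gP by (intro P_comb) auto
    then have "x *\<^sub>R g i + y *\<^sub>R g (i + 1) \<in> {g i, g (i + 1)}"
      unfolding cone[OF that(1), symmetric] using that by blast
    then show ?thesis by blast
  qed
  have g0: "g i \<noteq> 0" if "i < m" for i using gP[OF that] P_\<Delta> \<Delta>_nonzero by blast
  have rec0: "g (n + 2) = (g n \<bullet> coroot (g (n + 1))) *\<^sub>R g (n + 1) - g n" if n: "n + 2 < m" for n
  proof -
    obtain u1 u2 v1 v2 w1 w2 where uvw: "g n = u1 *\<^sub>R a + u2 *\<^sub>R b"
      "g (n + 1) = v1 *\<^sub>R a + v2 *\<^sub>R b" "g (n + 2) = w1 *\<^sub>R a + w2 *\<^sub>R b"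
      using coord gZ n by (metis add_lessD1 add.assoc one_add_one)
    have sp: "g (n + 1) \<notin> span {g n}" using n by (intro nspan) auto
    obtain p q where pq: "g (n + 2) = p *\<^sub>R g n + q *\<^sub>R g (n + 1)"
      using plane_basis[OF uvw _ sp] g0 n by auto
    show ?thesis
    proof (rule fan_step[OF gP gP gP sp _ _ _ pq])
      show "g (n + 2) \<noteq> g n" "g (n + 2) \<noteq> g (n + 1)" "g n \<noteq> g (n + 1)" using n by (intro neq; simp)+
    qed (use n cone'[of n] cone'[of "n + 1"] in auto)
  qed
  obtain A B :: int where AB: "g 1 \<bullet> coroot (g 0) = real_of_int A" "g 0 \<bullet> coroot (g 1) = real_of_int B"
    using pairing_int[of "g 1" "g 0"] pairing_int[of "g 0" "g 1"] gP[of 0] gP[of 1] m2 P_\<Delta> Ints_cases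
    by (metis Suc_1 Suc_le_lessD less_trans zero_less_one One_nat_def)
  let ?C = "\<lambda>n. real_of_int (cart A B (int n))"
  have pair: "n + 1 < m \<longrightarrow> g n \<bullet> coroot (g (n + 1)) = ?C (n + 1) \<and> g (n + 1) \<bullet> coroot (g n) = ?C n" for n
  proof (induction n)
    case 0
    then show ?case using AB by (simp add: cart_def)
  next
    case (Suc n)
    show ?case
    proof
      assume n: "Suc n + 1 < m"
      then have IH: "g n \<bullet> coroot (g (n + 1)) = ?C (n + 1)" "g (n + 1) \<bullet> coroot (g n) = ?C n"
        using Suc by auto
      have n': "n + 1 < m" "n + 2 < m" using n by auto
      show "g (Suc n) \<bullet> coroot (g (Suc n + 1)) = ?C (Suc n + 1) \<and> g (Suc n + 1) \<bullet> coroot (g (Suc n)) = ?C (Suc n)"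
        using IH pairing_step[OF g0[OF n'(1)] rec0[OF n'(2)]] by (simp add: cart_def)
    qed
  qed
  have rec1: "g (n + 2) = ?C (n + 1) *\<^sub>R g (n + 1) - g n" if "n + 2 < m" for n
    using rec0[OF that] pair[of n] that by simp
  have sp01: "g 1 \<notin> span {g 0}" using m2 by (intro nspan) auto
  note bounds = cartan_bounds[OF g0 sp01 AB(2,1)]
  \<comment> \<open>Were \<open>A\<close> negative, the reflection of \<open>g 1\<close> in
    \<open>g 0\<close> would be a root inside the cone of \<open>g 0\<close> and
    \<open>g 1\<close>.\<close>
  have A0: "0 \<le> A"
  proof (rule ccontr)
    assume A: "\<not> 0 \<le> A"
    have "reflection (g 0) (g 1) \<in> \<Delta>" using gP m2 by (intro reflection_\<Delta> P_\<Delta>) auto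
    moreover have r: "reflection (g 0) (g 1) = (- real_of_int A) *\<^sub>R g 0 + 1 *\<^sub>R g 1"
      unfolding reflection_coroot AB(1) by simp
    ultimately have "(- real_of_int A) *\<^sub>R g 0 + 1 *\<^sub>R g 1 = 1 *\<^sub>R g 0 + 0 *\<^sub>R g 1
       \<or> (- real_of_int A) *\<^sub>R g 0 + 1 *\<^sub>R g 1 = 0 *\<^sub>R g 0 + 1 *\<^sub>R g 1"
      using cone'[of 0 "- real_of_int A" 1] A m2 by simp
    then show False
      using comb_unique[OF g0 sp01, of "- real_of_int A" 1 1 0]
        comb_unique[OF g0 sp01, of "- real_of_int A" 1 0 1] A m2 by auto
  qed
  have bnd: "0 \<le> A * B" "A * B < 4" "A = 0 \<longleftrightarrow> B = 0" using bounds m2 by (auto simp: mult.commute)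
  have B0: "0 \<le> B"
  proof (cases "A = 0")
    case False
    then show ?thesis using A0 bnd(1) by (simp add: zero_le_mult_iff)
  qed (use bnd in simp)
  have M_le: "dsize (A * B) \<le> m"
  proof -
    have "dsize (A * B) \<le> card G"
    \<comment> \<open>Neighbours form an acute or right angle, so one sign is changed to obtain
      nonpositive pairings as in a simple system.\<close>
    proof (rule dsize_le_card[OF Z_def finG reflZ, of "- g 0" "g 1"])
      show "- g 0 \<in> Z" "g 1 \<in> Z" "- g 0 \<noteq> 0" using m2 g0 by (auto simp: Z_def G_def)
      show "g 1 \<notin> span {- g 0}" using sp01 by (auto simp: span_singleton) (metis rangeI scaleR_minus_left)
      show "g 1 \<bullet> coroot (- g 0) = - real_of_int A" "- g 0 \<bullet> coroot (g 1) = - real_of_int B"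
        using AB by (simp_all add: coroot_minus)
    qed (use A0 B0 bnd in auto)
    also have "\<dots> \<le> m" using card_image_le[of "{..<m}" g] by (simp add: G_def)
    finally show ?thesis .
  qed
  note cases = cartan_cases[OF A0 B0 bnd(2,3)]
  note r0 = rec1[of 0, simplified] and r1 = rec1[of 1, simplified] and r2 = rec1[of 2, simplified]
    and r3 = rec1[of 3, simplified] and r4 = rec1[of 4, simplified]
  have contra: "g n \<noteq> - g 0" if "n < m" for n
    using gP[OF that] gP[of 0] m2 P_not_neg by fastforce
  define U where "U x y = x *\<^sub>R g 0 + y *\<^sub>R g 1" for x y
  have U01: "g 0 = U 1 0" "g (Suc 0) = U 0 1" by (simp_all add: U_def)
  have Urec: "c *\<^sub>R U x y - U x' y' = U (c * x - x') (c * y - y')" "- U x y = U (- x) (- y)"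
    "U x y - U x' y' = U (x - x') (y - y')" for c x y x' y'
    by (simp_all add: U_def algebra_simps)
  have M_ge: "m \<le> dsize (A * B)"
  proof (rule ccontr)
    assume lt: "\<not> m \<le> dsize (A * B)"
    \<comment> \<open>The recursion runs through all positive roots of its type and then arrives at
      \<open>- g 0\<close>, which is not positive.\<close>
    have "g (dsize (A * B)) = - g 0"
      using cases lt r0 r1 r2 r3 r4
      by (elim disjE conjE)
        (simp_all add: dsize_def cart_def numeral_eq_Suc U01 Urec)
    then show False using contra lt by simp
  qed
  have m_eq: "m = dsize (A * B)" using M_le M_ge by simp
  then have tbl: "(int m, A, B) \<in> set dihedral_table"
    using cases by (elim disjE conjE) (simp_all add: dsize_def dihedral_table_def)
  \<comment> \<open>The two places where the recursion crosses from the \<open>m\<close> given roots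
    to their negatives. Beyond them it repeats with a change of sign.\<close>
  have close1: "g m = ?C (m - 1) *\<^sub>R g (m - 1) - g (m - 2)"
    using cases m_eq r0 r1 r2 r3 r4 anti[of 0]
    by (elim disjE conjE)
      (simp_all add: dsize_def cart_def numeral_eq_Suc U01 Urec)
  have close2: "g (m + 1) = ?C m *\<^sub>R g m - g (m - 1)"
    using cases m_eq r0 r1 r2 r3 r4 anti[of 0] anti[of 1]
    by (elim disjE conjE)
      (simp_all add: dsize_def cart_def numeral_eq_Suc U01 Urec)
  \<comment> \<open>An odd \<open>m\<close> exchanges the parities, but then \<open>m = 3\<close>
    and \<open>A = B\<close>.\<close>
  have Cm: "cart A B (int (n + m)) = cart A B (int n)" for n
    using cases m_eq by (elim disjE conjE) (simp_all add: dsize_def cart_def)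
  have "g (n + 2) = ?C (n + 1) *\<^sub>R g (n + 1) - g n" for n
  proof (induction n rule: less_induct)
    case (less n)
    consider "n + 2 < m" | "n + 2 = m" | "n + 1 = m" | "m \<le> n" by linarith
    then show ?case
    proof cases
      case 1 then show ?thesis by (rule rec1)
    next
      case 2
      then have "m = n + 2" "m - 1 = n + 1" "m - 2 = n" by auto
      then show ?thesis using close1 by simp
    next
      case 3
      then have "m = n + 1" "m - 1 = n" "m + 1 = n + 2" by auto
      then show ?thesis using close2 by simp
    next
      case 4
      then obtain k where k: "n = k + m" by (metis add.commute le_iff_add)
      have "g (k + 2) = ?C (k + 1) *\<^sub>R g (k + 1) - g k" using less[of k] k m2 by simp
      moreover have "g (n + 2) = - g (k + 2)" "g (n + 1) = - g (k + 1)" "g n = - g k"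
        using anti[of "k + 2"] anti[of "k + 1"] anti[of k] unfolding k by (simp_all add: ac_simps)
      moreover have "cart A B (int (n + 1)) = cart A B (int (k + 1))"
        using Cm[of "k + 1"] unfolding k by (simp add: ac_simps)
      ultimately show ?thesis by simp
    qed
  qed
  then show ?thesis using tbl AB by (intro exI[of _ A] exI[of _ B]) (simp add: add.commute)
qed

end

section \<open>Fans of roots\<close>

text \<open>A group element makes exactly \<open>m\<close> cyclically consecutive roots of a fan positive; it is in state
  \<open>c\<close> if the first of these is the root number \<open>c\<close>.\<close>

definition eps :: "int \<Rightarrow> int \<Rightarrow> int \<Rightarrow> bool" where
  "eps m c j \<longleftrightarrow> (j - c) mod (2 * m) < m"

text \<open>The bound on \<open>d\<close> keeps \<open>i + d\<close> and \<open>i - d\<close> among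
  the indices \<open>0\<close> to \<open>m - 1\<close>. The roots there are positive and exchanged
  by the flip at root \<open>i\<close>, so they lie in its \<open>N\<close>. In
  \<open>down_step\<close> the case \<open>d = 0\<close> adds root \<open>i\<close> itself.\<close>

definition up_step :: "int \<Rightarrow> int \<Rightarrow> int \<Rightarrow> bool" where
  "up_step m c i \<longleftrightarrow> eps m c i \<and> (\<forall>d\<in>set [1..min i (m - 1 - i)]. eps m c (i + d) \<noteq> eps m c (i - d))"

definition down_step :: "int \<Rightarrow> int \<Rightarrow> int \<Rightarrow> bool" where
  "down_step m c i \<longleftrightarrow> (\<forall>d\<in>set [0..min i (m - 1 - i)]. \<not> eps m c (i + d) \<and> \<not> eps m c (i - d))"

text \<open>Roots at distance 1 from root \<open>i\<close> pair with its coroot to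
  \<open>cart A B i\<close>, those at distance 2 to
  \<open>cart A B (i + 1) * cart A B i - 2\<close>. Both must be 1, and \<open>m <= 6\<close> in the
  table leaves no distance above 2.\<close>

definition quantum_root :: "int \<Rightarrow> int \<Rightarrow> int \<Rightarrow> int \<Rightarrow> bool" where
  "quantum_root m A B i \<longleftrightarrow> (1 \<le> min i (m - 1 - i) \<longrightarrow> cart A B i = 1) \<and>
    (2 \<le> min i (m - 1 - i) \<longrightarrow> cart A B (i + 1) * cart A B i = 3)"

text \<open>Reflecting indices by \<open>2 i - j\<close> reverses the cyclic order, so the block of
  negative roots becomes a block of positive ones whose start is the image of the old end
  \<open>c - 1\<close>, namely \<open>2 i + 1 - c\<close>.\<close>

lemma eps_flip: "0 < m \<Longrightarrow> eps m ((2 * i + 1 - c) mod (2 * m)) j \<longleftrightarrow> \<not> eps m c (2 * i - j)"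
proof -
  assume m: "0 < m"
  define t where "t = (2 * i - j - c) mod (2 * m)"
  have t: "0 \<le> t" "t < 2 * m" using m by (auto simp: t_def)
  have "(j - (2 * i + 1 - c) mod (2 * m)) mod (2 * m) = (- 1 - (2 * i - j - c)) mod (2 * m)"
    by (simp add: mod_diff_right_eq algebra_simps)
  also have "\<dots> = (- 1 - t) mod (2 * m)" unfolding t_def by (simp add: mod_diff_right_eq)
  also have "\<dots> = (2 * m + (- 1 - t)) mod (2 * m)" by (rule mod_add_self1[symmetric])
  also have "\<dots> = 2 * m + (- 1 - t)" using t by (intro mod_pos_pos_trivial) auto
  finally show ?thesis using t by (auto simp: eps_def t_def[symmetric])
qed

text \<open>Indexing by all integers puts positive and negative roots of the plane on one cycle, so
  that mirror images around any root need no case distinction.\<close>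

locale fan = crystallographic_coxeter W S \<alpha> act
  for W :: "('w, 'b) monoid_scheme" (structure) and S :: "'w set"
    and \<alpha> :: "'w \<Rightarrow> 'v::real_inner" and act :: "'w \<Rightarrow> 'v \<Rightarrow> 'v" +
  fixes m A B :: int and \<rho> :: "int \<Rightarrow> 'v"
  assumes tbl: "(m, A, B) \<in> set dihedral_table"
    and rec: "\<rho> (j + 1) = real_of_int (cart A B j) *\<^sub>R \<rho> j - \<rho> (j - 1)"
    and anti: "\<rho> (j + m) = - \<rho> j"
    and pair_base: "\<rho> 0 \<bullet> coroot (\<rho> 1) = real_of_int B" "\<rho> 1 \<bullet> coroot (\<rho> 0) = real_of_int A"
    and pos: "0 \<le> j \<Longrightarrow> j < m \<Longrightarrow> \<rho> j \<in> P"
begin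

abbreviation C :: "int \<Rightarrow> int" where "C \<equiv> cart A B"

lemma m_cases: "m = 2 \<and> A = 0 \<and> B = 0 \<or> m = 3 \<and> A = 1 \<and> B = 1 \<or> m = 4 \<and> A = 1 \<and> B = 2
  \<or> m = 4 \<and> A = 2 \<and> B = 1 \<or> m = 6 \<and> A = 1 \<and> B = 3 \<or> m = 6 \<and> A = 3 \<and> B = 1"
  using tbl by (simp add: dihedral_table_def)

lemma m_pos: "0 < m"
  using m_cases by auto

lemma C_shift: "C (j + 2) = C j" "C (j - 1) = C (j + 1)"
  by (simp_all add: cart_def)

lemma periodic: "\<rho> (j + k * (2 * m)) = \<rho> j"
proof -
  have up: "\<rho> (j + 2 * m) = \<rho> j" for j using anti[of j] anti[of "j + m"] by (simp add: add.assoc)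
  show ?thesis
  proof (induction k rule: int_induct[where k = 0])
    case (step1 k)
    then show ?case using up[of "j + k * (2 * m)"] by (simp add: algebra_simps)
  next
    case (step2 k)
    then show ?case using up[of "j + (k - 1) * (2 * m)"] by (simp add: algebra_simps)
  qed simp
qed

lemma \<rho>_mod: "\<rho> (j mod (2 * m)) = \<rho> j"
  using periodic[of "j mod (2 * m)" "j div (2 * m)"] by (simp add: mult.commute)

lemma \<rho>_root: "\<rho> j \<in> \<Delta>"
proof -
  have r: "0 \<le> j mod (2 * m)" "j mod (2 * m) < 2 * m" using m_pos by auto
  show ?thesis
  proof (cases "j mod (2 * m) < m")
    case True
    then show ?thesis using pos r \<rho>_mod P_\<Delta> by metis
  next
    case False
    then have "\<rho> (j mod (2 * m) - m) \<in> P" using r by (intro pos) auto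
    then have "- \<rho> (j mod (2 * m) - m) \<in> \<Delta>" using P_\<Delta> \<Delta>_neg by blast
    then show ?thesis using anti[of "j mod (2 * m) - m"] \<rho>_mod by simp
  qed
qed

lemma \<rho>_V: "\<rho> j \<in> V"
  by (simp add: \<rho>_root \<Delta>_V)

lemma \<rho>_nz: "\<rho> j \<noteq> 0"
  using \<rho>_root \<Delta>_nonzero by blast

lemma pairing: "\<rho> (j - 1) \<bullet> coroot (\<rho> j) = C j \<and> \<rho> j \<bullet> coroot (\<rho> (j - 1)) = C (j - 1)"
proof (induction j rule: int_induct[where k = 1])
  case base
  show ?case using pair_base by (simp add: cart_def)
next
  case (step1 j)
  then show ?case
    using pairing_step[OF \<rho>_nz[of j], of "\<rho> (j + 1)" "\<rho> (j - 1)"] rec[of j] by (simp add: cart_def)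
next
  case (step2 j)
  have r: "\<rho> (j - 2) = (\<rho> j \<bullet> coroot (\<rho> (j - 1))) *\<^sub>R \<rho> (j - 1) - \<rho> j"
    using step2 rec[of "j - 1"] by simp
  show ?case
    using pairing_step[OF \<rho>_nz r] step2 by (simp add: cart_def)
qed

lemma pairing1: "\<rho> (j - 1) \<bullet> coroot (\<rho> j) = C j" "\<rho> (j + 1) \<bullet> coroot (\<rho> j) = C j"
  using pairing[of j] pairing[of "j + 1"] by auto

lemma pairing2: "\<rho> (j + 2) \<bullet> coroot (\<rho> j) = C (j + 1) * C j - 2"
  using rec[of "j + 1"] pairing1[of j] coroot_self[OF \<rho>_nz[of j]] by (simp add: inner_diff_left add.assoc)

text \<open>The coefficient at \<open>j\<close> depends only on the parity of \<open>j\<close>, so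
  the recursion looks the same in both directions from \<open>i\<close>.\<close>

lemma reflect_\<rho>: "reflection (\<rho> i) (\<rho> (i + d)) = - \<rho> (i - d)"
proof -
  have nn: "reflection (\<rho> i) (\<rho> (i + int n)) = - \<rho> (i - int n)" for n
  proof (induction n rule: less_induct)
    case (less n)
    consider "n = 0" | "n = 1" | k where "n = k + 2" by (metis One_nat_def add_2_eq_Suc' not0_implies_Suc)
    then show ?case
    proof cases
      case 1
      then show ?thesis by (simp add: reflection_self)
    next
      case 2
      have "reflection (\<rho> i) (\<rho> (i + 1)) = \<rho> (i + 1) - real_of_int (C i) *\<^sub>R \<rho> i"
        by (simp add: reflection_coroot pairing1)
      then show ?thesis using 2 rec[of i] by simp
    next
      case 3
      have "\<rho> (i + int n) = real_of_int (C (i + int k + 1)) *\<^sub>R \<rho> (i + int (k + 1)) - \<rho> (i + int k)"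
        using rec[of "i + int k + 1"] 3 by (simp add: ac_simps)
      then have "reflection (\<rho> i) (\<rho> (i + int n))
          = real_of_int (C (i + int k + 1)) *\<^sub>R (- \<rho> (i - int (k + 1))) + \<rho> (i - int k)"
        using less[of k] less[of "k + 1"] 3 linear_reflection[of "\<rho> i"]
        by (simp add: linear_diff linear_scale del: of_nat_add)
      also have "\<dots> = - \<rho> (i - int n)"
        using rec[of "i - int k - 1"] 3 by (simp add: cart_def algebra_simps)
      finally show ?thesis .
    qed
  qed
  show ?thesis
  proof (cases "0 \<le> d")
    case True
    then show ?thesis using nn[of "nat d"] by simp
  next
    case False
    then have "reflection (\<rho> i) (\<rho> (i - d)) = - \<rho> (i + d)" using nn[of "nat (- d)"] by simp
    then have "reflection (\<rho> i) (reflection (\<rho> i) (\<rho> (i - d))) = - reflection (\<rho> i) (\<rho> (i + d))"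
      by (simp add: reflection_neg)
    then have "- \<rho> (i - d) = reflection (\<rho> i) (\<rho> (i + d))" by (simp add: reflection_invol)
    then show ?thesis by simp
  qed
qed

lemma reflect_\<rho>': "reflection (\<rho> i) (\<rho> j) = - \<rho> (2 * i - j)"
  using reflect_\<rho>[of i "j - i"] by simp

lemma coroot_reflection: "coroot (reflection g x) = reflection g (coroot (x::'v))"
  by (simp add: coroot_def reflection_inner reflection_scaleR)

text \<open>Coroots form the dual fan: the index of the coefficient is shifted by one, which
  exchanges \<open>A\<close> and \<open>B\<close>.\<close>

lemma coroot_rec: "coroot (\<rho> (j + 1)) = real_of_int (C (j + 1)) *\<^sub>R coroot (\<rho> j) - coroot (\<rho> (j - 1))"
proof -
  have "coroot (\<rho> (j + 1)) = - coroot (reflection (\<rho> j) (\<rho> (j - 1)))"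
    using reflect_\<rho>[of j "- 1"] by (simp add: coroot_minus)
  also have "\<dots> = - (coroot (\<rho> (j - 1)) - (\<rho> j \<bullet> coroot (\<rho> (j - 1))) *\<^sub>R coroot (\<rho> j))"
    unfolding coroot_reflection reflection_coroot_coroot ..
  also have "\<dots> = real_of_int (C (j + 1)) *\<^sub>R coroot (\<rho> j) - coroot (\<rho> (j - 1))"
    using pairing[of j] C_shift(2)[of j] by simp
  finally show ?thesis .
qed

section \<open>The state of a group element\<close>

definition state :: "'w \<Rightarrow> int \<Rightarrow> bool" where
  "state w c \<longleftrightarrow> 0 \<le> c \<and> c < 2 * m \<and> (\<forall>j. R w (\<rho> j) \<in> P \<longleftrightarrow> eps m c j)"

text \<open>\<open>- \<rho> (c - 1)\<close> is \<open>\<rho> (c + m - 1)\<close>, the last of the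
  \<open>m\<close> roots that start at \<open>c\<close>. So the first and the last of them span a
  cone containing the others.\<close>

lemma fan_nonneg:
  assumes "0 \<le> d" "d < m"
  shows "\<exists>x y. 0 \<le> x \<and> 0 \<le> y \<and> \<rho> (c + d) = x *\<^sub>R (- \<rho> (c - 1)) + y *\<^sub>R \<rho> c"
proof -
  define U where "U x y = x *\<^sub>R (- \<rho> (c - 1)) + y *\<^sub>R \<rho> c" for x y
  have Urec: "k *\<^sub>R U x y - U x' y' = U (k * x - x') (k * y - y')" "U x y - U x' y' = U (x - x') (y - y')"
    "- U x y = U (- x) (- y)" for k x y x' y'
    by (simp_all add: U_def algebra_simps)
  have r0: "\<rho> c = U 0 1" and r1: "\<rho> (c + 1) = U 1 (C c)"
    using rec[of c] by (simp_all add: U_def)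
  have rec2: "\<rho> (j + 2) = real_of_int (C (j + 1)) *\<^sub>R \<rho> (j + 1) - \<rho> j" for j
    using rec[of "j + 1"] by (simp add: add.assoc)
  have r2: "\<rho> (c + 2) = real_of_int (C (c + 1)) *\<^sub>R \<rho> (c + 1) - \<rho> c"
    by (rule rec2)
  have r3: "\<rho> (c + 3) = real_of_int (C c) *\<^sub>R \<rho> (c + 2) - \<rho> (c + 1)"
    using rec2[of "c + 1"] by (simp add: add.assoc C_shift)
  have r4: "\<rho> (c + 4) = real_of_int (C (c + 1)) *\<^sub>R \<rho> (c + 3) - \<rho> (c + 2)"
    using rec2[of "c + 2"] C_shift(1)[of "c + 1"] by (simp add: add.assoc)
  have r5: "\<rho> (c + 5) = real_of_int (C c) *\<^sub>R \<rho> (c + 4) - \<rho> (c + 3)"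
    using rec2[of "c + 3"] C_shift(1)[of "c + 2"] C_shift(1)[of c] by (simp add: add.assoc)
  have d: "d = 0 \<or> d = 1 \<or> d = 2 \<and> 2 < m \<or> d = 3 \<and> 3 < m \<or> d = 4 \<and> 4 < m \<or> d = 5 \<and> 5 < m"
    using assms m_cases by auto
  have "\<exists>x y. 0 \<le> x \<and> 0 \<le> y \<and> \<rho> (c + d) = U x y"
    using d m_cases
    by (elim disjE conjE; cases "even c"; simp add: r0 r1 r2 r3 r4 r5 cart_def Urec;
        intro exI conjI; (rule refl | simp))
  then show ?thesis by (simp add: U_def)
qed

text \<open>Signs at \<open>j\<close> and \<open>j + m\<close> are opposite, so somewhere a negative
  root is followed by a positive one. The cone that starts there supplies \<open>m\<close> positive
  roots, and antisymmetry settles the rest.\<close>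

lemma state_exists:
  assumes w: "w \<in> carrier W"
  shows "\<exists>c. state w c"
proof -
  define e where "e j \<longleftrightarrow> R w (\<rho> j) \<in> P" for j
  have eneg: "e (j + m) \<longleftrightarrow> \<not> e j" for j
    using neg_P_iff[OF \<Delta>_closed[OF \<rho>_root w], of j] by (simp add: e_def anti R_neg)
  have "\<exists>c. \<not> e (c - 1) \<and> e c"
  proof (rule ccontr)
    assume n: "\<not> ?thesis"
    obtain j where j: "\<not> e j" using eneg by blast
    have "\<not> e (j + int k)" for k
    proof (induction k)
      case (Suc k)
      then show ?case using n[simplified, rule_format, of "j + int k + 1"] by (auto simp: ac_simps)
    qed (use j in simp)
    from this[of "nat m"] show False using m_pos eneg j by auto
  qed
  then obtain c where c: "\<not> e (c - 1)" "e c" by blast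
  have cP: "- R w (\<rho> (c - 1)) \<in> P"
    using c(1) neg_P_iff[OF \<Delta>_closed[OF \<rho>_root w]] by (simp add: e_def)
  have pos: "e (c + d)" if dm: "0 \<le> d" "d < m" for d
  proof -
    obtain x y where xy: "0 \<le> x" "0 \<le> y" "\<rho> (c + d) = x *\<^sub>R (- \<rho> (c - 1)) + y *\<^sub>R \<rho> c"
      using fan_nonneg[OF dm] by blast
    have r: "R w (\<rho> (c + d)) = x *\<^sub>R (- R w (\<rho> (c - 1))) + y *\<^sub>R R w (\<rho> c)"
      unfolding xy(3) by (simp only: R_add R_scaleR R_neg)
    have "R w (\<rho> (c + d)) \<in> \<Delta>" by (rule \<Delta>_closed[OF \<rho>_root w])
    then show ?thesis
      unfolding e_def r using P_comb[OF cP c(2)[unfolded e_def] xy(1,2)] by blast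
  qed
  have e_iff: "e j \<longleftrightarrow> (j - c) mod (2 * m) < m" for j
  proof -
    define d where "d = (j - c) mod (2 * m)"
    have d: "0 \<le> d" "d < 2 * m" using m_pos by (auto simp: d_def)
    have "\<rho> j = \<rho> (c + d)"
    proof -
      have "(c + d) mod (2 * m) = j mod (2 * m)" by (simp add: d_def mod_add_right_eq)
      then show ?thesis using \<rho>_mod by metis
    qed
    then have "e j \<longleftrightarrow> e (c + d)" by (simp add: e_def)
    moreover have "e (c + d) \<longleftrightarrow> d < m"
    proof (cases "d < m")
      case False
      then have "e (c + (d - m))" using d by (intro pos) auto
      then show ?thesis using False eneg[of "c + (d - m)"] by simp
    qed (use pos d in auto)
    ultimately show ?thesis by (simp add: d_def)
  qed
  have "state w (c mod (2 * m))"
    using m_pos e_iff by (auto simp: state_def eps_def e_def mod_diff_right_eq)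
  then show ?thesis by blast
qed

lemma state_step:
  assumes "w \<in> carrier W" "state w c"
  shows "state (w \<otimes> rf (\<rho> i)) ((2 * i + 1 - c) mod (2 * m))"
proof -
  have "R (w \<otimes> rf (\<rho> i)) (\<rho> j) \<in> P \<longleftrightarrow> \<not> eps m c (2 * i - j)" for j
  proof -
    have "R (w \<otimes> rf (\<rho> i)) (\<rho> j) = - R w (\<rho> (2 * i - j))"
      using assms by (simp add: R_mult_rf \<rho>_root \<rho>_V reflect_\<rho>' R_neg)
    then show ?thesis
      using assms neg_P_iff[OF \<Delta>_closed[OF \<rho>_root assms(1)]] by (simp add: state_def)
  qed
  then show ?thesis using m_pos by (simp add: state_def eps_flip)
qed

lemma N_fan:
  assumes "0 \<le> i" "i < m" "\<bar>d\<bar> \<le> min i (m - 1 - i)"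
  shows "\<rho> (i + d) \<in> N (\<rho> i)"
proof -
  have "\<rho> (i + d) \<in> P" "\<rho> (i - d) \<in> P" using assms by (auto intro!: pos)
  then show ?thesis by (simp add: N_def reflect_\<rho>)
qed

text \<open>Equal roots would make two Cartan integers 2 or their product 4, which no row of the
  table allows.\<close>

lemma \<rho>_neq:
  assumes "0 \<le> i" "i < m" "\<bar>d\<bar> \<le> min i (m - 1 - i)" "d \<noteq> 0"
  shows "\<rho> (i + d) \<noteq> \<rho> i"
proof
  assume eq: "\<rho> (i + d) = \<rho> i"
  have "\<rho> (i + \<bar>d\<bar>) = \<rho> i"
  proof (cases "0 \<le> d")
    case False
    have "reflection (\<rho> i) (\<rho> (i + d)) = - \<rho> (i + \<bar>d\<bar>)" using False by (simp add: reflect_\<rho>)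
    then show ?thesis using eq by (simp add: reflection_self)
  qed (use eq in simp)
  then have eq': "\<rho> (i + \<bar>d\<bar>) = \<rho> i" .
  have small: "\<bar>d\<bar> = 1 \<or> \<bar>d\<bar> = 2" using assms m_cases by auto
  have "C i = 2 \<and> C (i + 1) = 2 \<or> C (i + 1) * C i = 4"
    using small
  proof
    assume "\<bar>d\<bar> = 1"
    then have e: "\<rho> (i + 1) = \<rho> i" using eq' by simp
    then show ?thesis
      using pairing1(2)[of i] pairing1(1)[of "i + 1"] coroot_self[OF \<rho>_nz[of i]] by simp
  next
    assume "\<bar>d\<bar> = 2"
    then have "\<rho> (i + 2) = \<rho> i" using eq' by simp
    then have "real_of_int (C (i + 1) * C i) = 4"
      using pairing2[of i] coroot_self[OF \<rho>_nz[of i]] by simp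
    then show ?thesis by linarith
  qed
  then show False using m_cases by (auto simp: cart_def split: if_splits)
qed

section \<open>Edges of the graph seen in a fan\<close>

theorem up_edge:
  assumes w: "w \<in> carrier W" "state w c" and i: "0 \<le> i" "i < m"
    and up: "len (w \<otimes> rf (\<rho> i)) = len w + 1"
  shows "up_step m c i"
proof -
  have iP: "\<rho> i \<in> P" using i by (rule pos)
  have st: "R w (\<rho> j) \<in> P \<longleftrightarrow> eps m c j" for j using w(2) by (simp add: state_def)
  have up': "R w (\<rho> i) \<in> P" using up_iff[OF w(1) iP] up by simp
  have "eps m c (i + d) \<noteq> eps m c (i - d)" if d: "1 \<le> d" "d \<le> min i (m - 1 - i)" for d
  proof -
    have "sg (R w (\<rho> (i + d))) + sg (R w (- reflection (\<rho> i) (\<rho> (i + d)))) = 0"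
      using d i by (intro up_steps(2)[OF w(1) iP up' up] N_fan \<rho>_neq) auto
    then show ?thesis by (auto simp: sg_def reflect_\<rho> st split: if_splits)
  qed
  then show ?thesis using up' by (simp add: up_step_def st)
qed

theorem down_edge:
  assumes w: "w \<in> carrier W" "state w c" and i: "0 \<le> i" "i < m"
    and dn: "real (len w) = real (len (w \<otimes> rf (\<rho> i))) + ht (coroot (\<rho> i)) - 1"
  shows "down_step m c i" "quantum_root m A B i"
proof -
  have iP: "\<rho> i \<in> P" using i by (rule pos)
  have st: "R w (\<rho> j) \<in> P \<longleftrightarrow> eps m c j" for j using w(2) by (simp add: state_def)
  have neg: "\<not> eps m c (i + d)" if "\<bar>d\<bar> \<le> min i (m - 1 - i)" for d
    using down_steps(3)[OF w(1) iP dn N_fan[OF i that]] st by simp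
  have "\<not> eps m c (i + d) \<and> \<not> eps m c (i - d)" if "0 \<le> d" "d \<le> min i (m - 1 - i)" for d
    using neg[of d] neg[of "- d"] that by simp
  then show "down_step m c i" by (simp add: down_step_def)
  have one: "\<rho> (i + d) \<bullet> coroot (\<rho> i) = 1" if d: "1 \<le> d" "d \<le> min i (m - 1 - i)" for d
    using d i by (intro down_steps(4)[OF w(1) iP dn] N_fan \<rho>_neq) auto
  show "quantum_root m A B i"
    unfolding quantum_root_def
  proof (intro conjI impI)
    assume "1 \<le> min i (m - 1 - i)"
    then show "C i = 1" using one[of 1] pairing1(2)[of i] by simp
  next
    assume "2 \<le> min i (m - 1 - i)"
    then have "real_of_int (C (i + 1) * C i) = 3" using one[of 2] pairing2[of i] by simp
    then show "C (i + 1) * C i = 3" by linarith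
  qed
qed

theorem up_bound:
  assumes "w \<in> carrier W" "state w c" "0 \<le> i" "i < m" "up_step m c i"
  shows "len w + 1 \<le> len (w \<otimes> rf (\<rho> i))"
  using up_steps(1)[OF assms(1) pos[OF assms(3,4)]] assms(2,5) by (simp add: up_step_def state_def)

theorem down_bound:
  assumes "w \<in> carrier W" "0 \<le> i" "i < m"
  shows "real (len w) \<le> real (len (w \<otimes> rf (\<rho> i))) + ht (coroot (\<rho> i)) - 1"
  using down_steps(1)[OF assms(1) pos[OF assms(2,3)]] .

text \<open>A product of two reflections is a rotation that depends only on the difference of their
  indices. Hence all paths of one quadratic relation share their end point.\<close>

lemma rf_rf_shift: "rf (\<rho> (j + int k)) \<otimes> rf (\<rho> j) = rf (\<rho> (int k)) \<otimes> rf (\<rho> 0)"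
proof -
  let ?r = "\<lambda>j. rf (\<rho> j)"
  have c: "?r j \<in> carrier W" for j by (rule rf_closed[OF \<rho>_root])
  have sq: "?r j \<otimes> ?r j = \<one>" for j by (rule rf_sq[OF \<rho>_root])
  have step: "?r (j + 1) \<otimes> ?r j = ?r j \<otimes> ?r (j - 1)" for j
  proof -
    have "?r (j + 1) = ?r j \<otimes> (?r (j - 1) \<otimes> ?r j)"
      using rf_conj[OF \<rho>_root \<rho>_root, of j "j - 1"] reflect_\<rho>[of j "- 1"] by (simp add: rf_minus)
    then show ?thesis using c sq by (simp add: m_assoc)
  qed
  have t: "?r (j + 1) \<otimes> ?r j = ?r 1 \<otimes> ?r 0" for j
  proof (induction j rule: int_induct[where k = 0])
    case (step1 j)
    then show ?case using step[of "j + 1"] by simp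
  next
    case (step2 j)
    then show ?case using step[of j] by simp
  qed simp
  have "\<forall>j. ?r (j + int k) \<otimes> ?r j = ?r (int k) \<otimes> ?r 0"
  proof (induction k)
    case (Suc k)
    have "?r (j + int (Suc k)) \<otimes> ?r j = (?r 1 \<otimes> ?r 0) \<otimes> (?r (int k) \<otimes> ?r 0)" for j
    proof -
      have "?r (j + int (Suc k)) \<otimes> ?r j
          = ?r (j + int k + 1) \<otimes> (?r (j + int k) \<otimes> ?r (j + int k)) \<otimes> ?r j"
        using c by (simp add: sq ac_simps)
      also have "\<dots> = (?r (j + int k + 1) \<otimes> ?r (j + int k)) \<otimes> (?r (j + int k) \<otimes> ?r j)"
        using c by (simp add: m_assoc)
      finally show ?thesis using t[of "j + int k"] Suc by simp
    qed
    from this this[of 0] show ?case by simp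
  qed (simp add: sq)
  then show ?thesis by blast
qed

end

text \<open>The sequence is continued to negative indices by reduction modulo \<open>2 m\<close>.
  This modulus is even, so the parity that selects \<open>A\<close> or \<open>B\<close>
  survives.\<close>

lemma (in crystallographic_coxeter) fan_exists:
  assumes ds: "dihedral_sequence P m g"
  shows "\<exists>A B \<rho>. fan W S \<alpha> act (int m) A B \<rho> \<and> (\<forall>n::nat. \<rho> (int n) = g n)"
proof -
  obtain A B where AB: "(int m, A, B) \<in> set dihedral_table"
    "\<And>n. g (n + 2) = real_of_int (cart A B (int n + 1)) *\<^sub>R g (n + 1) - g n"
    "g 0 \<bullet> coroot (g 1) = real_of_int B" "g 1 \<bullet> coroot (g 0) = real_of_int A"
    using dihedral_data[OF ds] by blast
  have m: "2 \<le> m" and anti: "\<And>j. g (j + m) = - g j" and gP: "\<And>i. i < m \<Longrightarrow> g i \<in> P"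
    using ds unfolding dihedral_sequence_def by auto
  have per: "g (n + k * (2 * m)) = g n" for n k
  proof (induction k)
    case (Suc k)
    have "g (n + Suc k * (2 * m)) = g (n + k * (2 * m) + m + m)" by (simp add: algebra_simps)
    also have "\<dots> = g (n + k * (2 * m))" by (simp only: anti minus_minus)
    finally show ?case using Suc by simp
  qed simp
  have gmod: "g (n mod (2 * m)) = g n" for n
    using per[of "n mod (2 * m)" "n div (2 * m)"] by (simp add: mult.commute)
  define \<rho> where "\<rho> j = g (nat (j mod (2 * int m)))" for j
  have \<rho>_nat: "\<rho> (int n) = g n" for n
  proof -
    have "int n mod (2 * int m) = int (n mod (2 * m))" by (simp add: zmod_int)
    then show ?thesis by (simp add: \<rho>_def gmod)
  qed
  have \<rho>_shift: "\<rho> (j + int i) = g (nat (j mod (2 * int m)) + i)" for j i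
  proof -
    have "\<rho> (j + int i) = \<rho> (j mod (2 * int m) + int i)"
      by (simp add: \<rho>_def mod_add_left_eq)
    also have "j mod (2 * int m) + int i = int (nat (j mod (2 * int m)) + i)" using m by simp
    finally show ?thesis unfolding \<rho>_nat .
  qed
  have "fan W S \<alpha> act (int m) A B \<rho>"
  proof unfold_locales
    fix j
    let ?n = "nat ((j - 1) mod (2 * int m))"
    have "even (int ?n) \<longleftrightarrow> even (j - 1)"
      using m by (simp add: even_iff_mod_2_eq_zero mod_mod_cancel)
    then have c: "cart A B (int ?n + 1) = cart A B j" by (simp add: cart_def)
    have "\<rho> (j - 1) = g ?n" "\<rho> j = g (?n + 1)" "\<rho> (j + 1) = g (?n + 2)"
      using \<rho>_shift[of "j - 1" 0] \<rho>_shift[of "j - 1" 1] \<rho>_shift[of "j - 1" 2] by (simp_all add: add.commute)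
    then show "\<rho> (j + 1) = real_of_int (cart A B j) *\<^sub>R \<rho> j - \<rho> (j - 1)"
      using AB(2)[of ?n] c by simp
  next
    show "\<rho> (j + int m) = - \<rho> j" for j
      using \<rho>_shift[of j m] \<rho>_shift[of j 0] anti by simp
  next
    show "\<rho> 0 \<bullet> coroot (\<rho> 1) = real_of_int B" "\<rho> 1 \<bullet> coroot (\<rho> 0) = real_of_int A"
      using \<rho>_nat[of 0] \<rho>_nat[of 1] AB(3,4) by simp_all
  next
    show "\<rho> j \<in> P" if "0 \<le> j" "j < int m" for j
      using \<rho>_nat[of "nat j"] gP[of "nat j"] that by simp
  qed (rule AB(1))
  then show ?thesis using \<rho>_nat by blast
qed

section \<open>The dihedral tables\<close>

text \<open>Coordinates of the coroots of a fan with respect to its first two, following the dual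
  recursion. They make weights computable.\<close>

fun coroot_coord :: "int \<Rightarrow> int \<Rightarrow> nat \<Rightarrow> int \<times> int" where
  "coroot_coord A B 0 = (1, 0)"
| "coroot_coord A B (Suc 0) = (0, 1)"
| "coroot_coord A B (Suc (Suc n)) =
    (let (x, y) = coroot_coord A B (Suc n); (x', y') = coroot_coord A B n; c = cart A B (int n)
     in (c * x - x', c * y - y'))"

text \<open>Edges of the graph of the dihedral subgroup, with their weights; for the graph of
  \<open>W\<close> they are only candidates.\<close>

definition edge :: "int \<Rightarrow> int \<Rightarrow> int \<Rightarrow> int \<Rightarrow> int \<Rightarrow> (int \<times> int) option" where
  "edge m A B c i = (if up_step m c i then Some (0, 0)
     else if down_step m c i \<and> quantum_root m A B i then Some (coroot_coord A B (nat i)) else None)"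

definition next_state :: "int \<Rightarrow> int \<Rightarrow> int \<Rightarrow> int" where
  "next_state m c i = (2 * i + 1 - c) mod (2 * m)"

text \<open>The weight of the path that first crosses the root \<open>j\<close> and then the root \<open>i\<close>.\<close>

definition two_path :: "int \<Rightarrow> int \<Rightarrow> int \<Rightarrow> int \<Rightarrow> int \<Rightarrow> int \<Rightarrow> (int \<times> int) option" where
  "two_path m A B c j i = (case edge m A B c j of None \<Rightarrow> None
     | Some (x, y) \<Rightarrow> (case edge m A B (next_state m c j) i of None \<Rightarrow> None
       | Some (x', y') \<Rightarrow> Some (x + x', y + y')))"

text \<open>The quadratic sum splits where \<open>i + k\<close> reaches \<open>m\<close>: from there
  on the factor \<open>g (i + k)\<close> is the negative of a root in the range. The operator on the
  right acts first, so \<open>i + k\<close> is crossed before \<open>i\<close>.\<close>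

definition positive_paths :: "int \<Rightarrow> int \<Rightarrow> int \<Rightarrow> int \<Rightarrow> int \<Rightarrow> (int \<times> int) list" where
  "positive_paths m A B c k = List.map_filter (\<lambda>i. two_path m A B c (i + k) i) [0..m - 1 - k]"

definition negative_paths :: "int \<Rightarrow> int \<Rightarrow> int \<Rightarrow> int \<Rightarrow> int \<Rightarrow> (int \<times> int) list" where
  "negative_paths m A B c k = List.map_filter (\<lambda>i. two_path m A B c (i + k - m) i) [m - k..m - 1]"

fun same_elements :: "'a list \<Rightarrow> 'a list \<Rightarrow> bool" where
  "same_elements [] ys \<longleftrightarrow> ys = []"
| "same_elements (x # xs) ys \<longleftrightarrow> x \<in> set ys \<and> same_elements xs (remove1 x ys)"

lemma same_elements_sum:
  "same_elements xs ys \<Longrightarrow> (\<Sum>x\<leftarrow>xs. f x) = (\<Sum>y\<leftarrow>ys. f y :: 'b::comm_monoid_add)"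
  by (induction xs ys rule: same_elements.induct) (auto simp: sum_list_map_remove1)

text \<open>The lists agree as multisets of weights, not just in length. As the end points are
  common, a path is kept or dropped by its weight alone, so the matching survives the passage to
  \<open>W\<close>.\<close>

lemma quadratic_table:
  "\<forall>(m, A, B)\<in>set dihedral_table. \<forall>k\<in>set [1..m div 2]. \<forall>c\<in>set [0..2 * m - 1].
    same_elements (positive_paths m A B c k) (negative_paths m A B c k)"
  by code_simp

text \<open>For the roots other than \<open>k\<close> the condition \<open>down_step\<close>, which is only necessary for a quantum
  edge, already excludes all walks that occur in the four term relation.\<close>

fun walk :: "int \<Rightarrow> int \<Rightarrow> int \<Rightarrow> int list \<Rightarrow> bool" where
  "walk m k c [] \<longleftrightarrow> True"
| "walk m k c (i # is) \<longleftrightarrow> (up_step m c i \<or> i \<noteq> k \<and> down_step m c i) \<and> walk m k (next_state m c i) is"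

text \<open>The crystallographic orders from 4 on are 4 and 6. Since \<open>walk\<close> asks
  nothing of the Cartan integers, one check serves both orientations.\<close>

lemma four_term_table:
  "\<forall>m\<in>set [4, 6]. \<forall>c\<in>set [0..2 * m - 1].
    let k = m div 2 - 1; up = [0..2 * k]; down = rev up in
    \<forall>u\<in>set [k # up, up @ [k], k # down, down @ [k]]. \<not> walk m k c u"
  by code_simp

section \<open>The quantum Bruhat operators\<close>

context crystallographic_coxeter
begin

text \<open>Total in the vector and defined for negative roots too, so words in all generators can
  be evaluated and rearranged without carrier conditions.\<close>

definition T :: "'v \<Rightarrow> ('w \<Rightarrow>\<^sub>0 'w qpoly) \<Rightarrow> ('w \<Rightarrow>\<^sub>0 'w qpoly)" where
  "T g x = (if g \<in> P then lin (s_tilde_basis W S \<alpha> act g) x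
     else - lin (s_tilde_basis W S \<alpha> act (- g)) x)"

lemma T_add: "T g (x + y) = T g x + T g y"
  by (simp add: T_def lin_add)

lemma T_smul: "T g (smul p x) = smul p (T g x)"
  by (simp add: T_def lin_smul smul_minus_right)

lemma T_zero [simp]: "T g 0 = 0"
  by (simp add: T_def)

lemma T_minus: "T g (- x) = - T g x"
  by (simp add: T_def lin_minus)

lemma T_neg: "g \<in> \<Delta> \<Longrightarrow> T (- g) x = - T g x"
  using neg_P_iff[of g] by (simp add: T_def)

lemma s_tilde_basis_alt:
  "s_tilde_basis W S \<alpha> act g w =
    (if len (w \<otimes> rf g) = len w + 1 then single (w \<otimes> rf g) 1
     else if real (len w) = real (len (w \<otimes> rf g)) + ht (coroot g) - 1
       then single (w \<otimes> rf g) (qwt (coroot g)) else 0)"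
proof -
  have "real (len w) = real (len (w \<otimes> rf g)) - 1 \<longleftrightarrow> len (w \<otimes> rf g) = len w + 1" by linarith
  then show ?thesis by (simp add: s_tilde_basis_def Let_def ht_def qwt_coroot)
qed

lemma T_single: "g \<in> P \<Longrightarrow> T g (single w p) =
    (if len (w \<otimes> rf g) = len w + 1 then single (w \<otimes> rf g) p
     else if real (len w) = real (len (w \<otimes> rf g)) + ht (coroot g) - 1
       then single (w \<otimes> rf g) (p * qwt (coroot g)) else 0)"
  by (simp add: T_def s_tilde_basis_alt)

text \<open>A step changes the length by \<open>+ 1\<close> or by \<open>1 - ht\<close>. Two steps
  that return to \<open>w\<close> would require the height to be 1 or 2.\<close>

lemma T_sq_nonsimple:
  assumes "g \<in> P" "g \<notin> \<alpha> ` S" "w \<in> carrier W"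
  shows "T g (T g (single w p)) = 0"
proof -
  have "w \<otimes> rf g \<otimes> rf g = w" using assms by (simp add: mult_rf_rf P_\<Delta>)
  moreover have "ht (coroot g) > 2" using ht_nonsimple assms by blast
  ultimately show ?thesis using assms(1) by (simp add: T_single)
qed

lemma T_sq_simple:
  assumes "s \<in> S" "w \<in> carrier W"
  shows "T (\<alpha> s) (T (\<alpha> s) (single w p)) = smul (qvar s) (single w p)"
proof -
  have r: "rf (\<alpha> s) = s" using assms rf_\<alpha> by simp
  have ss: "w \<otimes> s \<otimes> s = w" using assms by (simp add: mult_s_s)
  have h: "ht (coroot (\<alpha> s)) = 2" "qwt (coroot (\<alpha> s)) = qvar s"
    using assms ht_\<alpha> qwt_coroot_\<alpha> by auto
  from len_mult_s[OF assms(2,1)] show ?thesis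
    using \<alpha>_P[OF assms(1)] by (elim disjE) (simp_all add: T_single r ss h mult.commute)
qed

end

context fan
begin

definition vec :: "int \<times> int \<Rightarrow> 'v" where
  "vec c = real_of_int (fst c) *\<^sub>R coroot (\<rho> 0) + real_of_int (snd c) *\<^sub>R coroot (\<rho> 1)"

lemma vec_zero: "vec (0, 0) = 0"
  by (simp add: vec_def)

lemma vec_add: "vec (x, y) + vec (x', y') = vec (x + x', y + y')"
  by (simp add: vec_def scaleR_add_left)

lemma vec_coord: "vec (coroot_coord A B n) = coroot (\<rho> (int n))"
proof (induction n rule: induct_nat_012)
  case (ge2 n)
  obtain x y x' y' where xy: "coroot_coord A B (Suc n) = (x, y)" "coroot_coord A B n = (x', y')"
    by (meson surj_pair)
  have "coroot (\<rho> (int (Suc (Suc n)))) = real_of_int (C (int n)) *\<^sub>R coroot (\<rho> (int (Suc n))) - coroot (\<rho> (int n))"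
    using coroot_rec[of "int n + 1"] C_shift(1)[of "int n"] by (simp add: ac_simps)
  also have "\<dots> = real_of_int (C (int n)) *\<^sub>R vec (x, y) - vec (x', y')"
    using ge2 xy by simp
  also have "\<dots> = vec (C (int n) * x - x', C (int n) * y - y')"
    by (simp add: vec_def scaleR_add_right scaleR_diff_left)
  also have "(C (int n) * x - x', C (int n) * y - y') = coroot_coord A B (Suc (Suc n))"
    by (simp add: xy Let_def)
  finally show ?case by simp
qed (simp_all add: vec_def)

lemma step_excl: "0 \<le> i \<Longrightarrow> i < m \<Longrightarrow> down_step m c i \<Longrightarrow> \<not> up_step m c i"
  unfolding down_step_def up_step_def by (drule bspec[where x = 0]) auto

lemma edge_props:
  assumes "w \<in> carrier W" "state w c" "0 \<le> i" "i < m" "edge m A B c i = Some \<mu>"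
  shows "real (len w) + 1 \<le> real (len (w \<otimes> rf (\<rho> i))) + ht (vec \<mu>)" "natcomb (vec \<mu>)"
proof -
  consider "up_step m c i" "\<mu> = (0, 0)" | "\<mu> = coroot_coord A B (nat i)"
    using assms(5) by (auto simp: edge_def split: if_splits)
  then have "real (len w) + 1 \<le> real (len (w \<otimes> rf (\<rho> i))) + ht (vec \<mu>) \<and> natcomb (vec \<mu>)"
  proof cases
    case 1
    then show ?thesis using up_bound[OF assms(1-4)] by (simp add: vec_zero ht_zero natcomb_zero)
  next
    case 2
    then show ?thesis using down_bound[OF assms(1,3,4)] natcomb_coroot[OF pos[OF assms(3,4)]] assms(3)
      by (simp add: vec_coord)
  qed
  then show "real (len w) + 1 \<le> real (len (w \<otimes> rf (\<rho> i))) + ht (vec \<mu>)" "natcomb (vec \<mu>)" by auto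
qed

text \<open>A single length test replaces the distinction between up, down and no step: a candidate
  edge passes it exactly when it is an edge of \<open>W\<close>.\<close>

lemma T_edge:
  assumes "w \<in> carrier W" "state w c" "0 \<le> i" "i < m"
  shows "T (\<rho> i) (single w p) = (case edge m A B c i of None \<Rightarrow> 0
    | Some \<mu> \<Rightarrow> if real (len (w \<otimes> rf (\<rho> i))) + ht (vec \<mu>) = real (len w) + 1
        then single (w \<otimes> rf (\<rho> i)) (p * qwt (vec \<mu>)) else 0)"
proof -
  let ?u = "w \<otimes> rf (\<rho> i)"
  have vi: "vec (coroot_coord A B (nat i)) = coroot (\<rho> i)" using assms(3) by (simp add: vec_coord)
  consider "len ?u = len w + 1"
    | "len ?u \<noteq> len w + 1" "real (len w) = real (len ?u) + ht (coroot (\<rho> i)) - 1"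
    | "len ?u \<noteq> len w + 1" "real (len w) \<noteq> real (len ?u) + ht (coroot (\<rho> i)) - 1" by blast
  then show ?thesis
  proof cases
    case 1
    then have "edge m A B c i = Some (0, 0)" using up_edge[OF assms] by (simp add: edge_def)
    then show ?thesis using 1 pos[OF assms(3,4)] by (simp add: T_single vec_zero ht_zero qwt_zero)
  next
    case 2
    then have "edge m A B c i = Some (coroot_coord A B (nat i))"
      using down_edge[OF assms] step_excl[OF assms(3,4)] by (simp add: edge_def)
    then show ?thesis using 2 pos[OF assms(3,4)] by (simp add: T_single vi)
  next
    case 3
    then have "T (\<rho> i) (single w p) = 0" using pos[OF assms(3,4)] by (simp add: T_single)
    moreover have "real (len ?u) + ht (coroot (\<rho> i)) \<noteq> real (len w) + 1" using 3 by linarith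
    moreover have "real (len ?u) \<noteq> real (len w) + 1" using 3 by linarith
    ultimately show ?thesis by (simp add: edge_def vi vec_zero ht_zero)
  qed
qed

lemma T_two_path:
  assumes w: "w \<in> carrier W" "state w c" and i: "0 \<le> i" "i < m" and j: "0 \<le> j" "j < m"
    and u: "u = w \<otimes> (rf (\<rho> j) \<otimes> rf (\<rho> i))"
  shows "T (\<rho> i) (T (\<rho> j) (single w p)) = (case two_path m A B c j i of None \<Rightarrow> 0
    | Some \<mu> \<Rightarrow> if real (len u) + ht (vec \<mu>) = real (len w) + 2
        then single u (p * qwt (vec \<mu>)) else 0)"
proof (cases "edge m A B c j")
  case None
  then show ?thesis by (simp add: T_edge[OF w j] two_path_def)
next
  case (Some \<mu>)
  let ?v = "w \<otimes> rf (\<rho> j)"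
  have v: "?v \<in> carrier W" "state ?v (next_state m c j)"
    using w state_step[OF w, of j] rf_closed[OF \<rho>_root] by (auto simp: next_state_def)
  have uv: "u = ?v \<otimes> rf (\<rho> i)" unfolding u using w rf_closed[OF \<rho>_root] by (simp add: m_assoc)
  obtain x y where xy: "\<mu> = (x, y)" by (cases \<mu>)
  note p1 = edge_props[OF w j Some]
  show ?thesis
  proof (cases "edge m A B (next_state m c j) i")
    case None
    then show ?thesis using Some xy by (simp add: T_edge[OF w j] T_edge[OF v i] two_path_def)
  next
    case (Some \<nu>)
    obtain x' y' where xy': "\<nu> = (x', y')" by (cases \<nu>)
    note p2 = edge_props[OF v i Some, folded uv]
    have tp: "two_path m A B c j i = Some (x + x', y + y')"
      using \<open>edge m A B c j = Some \<mu>\<close> Some xy xy' by (simp add: two_path_def)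
    have vv: "vec (x + x', y + y') = vec \<mu> + vec \<nu>" using xy xy' vec_add by simp
    have q: "qwt (vec (x + x', y + y')) = qwt (vec \<mu>) * qwt (vec \<nu>)"
      unfolding vv by (rule qwt_add[OF p1(2) p2(2)])
    have h: "ht (vec (x + x', y + y')) = ht (vec \<mu>) + ht (vec \<nu>)" unfolding vv by (rule ht_add)
    \<comment> \<open>Both bounds point the same way, so their sum is tight only if each of them
      is.\<close>
    have iff: "real (len u) + ht (vec (x + x', y + y')) = real (len w) + 2 \<longleftrightarrow>
      real (len ?v) + ht (vec \<mu>) = real (len w) + 1 \<and> real (len u) + ht (vec \<nu>) = real (len ?v) + 1"
      unfolding h using p1(1) p2(1) by linarith
    have e1: "T (\<rho> j) (single w p) = (if real (len ?v) + ht (vec \<mu>) = real (len w) + 1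
        then single ?v (p * qwt (vec \<mu>)) else 0)"
      using \<open>edge m A B c j = Some \<mu>\<close> by (simp add: T_edge[OF w j])
    have e2: "T (\<rho> i) (single ?v r) = (if real (len u) + ht (vec \<nu>) = real (len ?v) + 1
        then single u (r * qwt (vec \<nu>)) else 0)" for r
      using Some by (simp add: T_edge[OF v i] uv)
    show ?thesis unfolding tp option.case q iff e1 by (simp add: e2 mult.assoc)
  qed
qed

lemma sum_list_map_filter:
  fixes f :: "'y \<Rightarrow> 'z::comm_monoid_add"
  shows "(\<Sum>y\<leftarrow>List.map_filter h xs. f y) = (\<Sum>x\<leftarrow>xs. case h x of None \<Rightarrow> 0 | Some y \<Rightarrow> f y)"
  by (induction xs) (auto simp: List.map_filter_simps split: option.splits)

lemma T_quadratic:
  assumes w: "w \<in> carrier W" and k: "1 \<le> k" "2 * int k \<le> m"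
  shows "(\<Sum>i<nat m. T (\<rho> (int i)) (T (\<rho> (int (i + k))) (single w p))) = 0"
proof -
  obtain c where c: "state w c" using state_exists[OF w] by blast
  define u where "u = w \<otimes> (rf (\<rho> (int k)) \<otimes> rf (\<rho> 0))"
  \<comment> \<open>The contribution of a path of weight \<open>\<mu>\<close>. Start, end point and
    coefficient are fixed, so a sum over paths becomes a sum over weights.\<close>
  define \<Phi> where "\<Phi> \<mu> = (if real (len u) + ht (vec \<mu>) = real (len w) + 2
        then single u (p * qwt (vec \<mu>)) else 0)" for \<mu>
  define F where "F i = T (\<rho> i) (T (\<rho> (i + int k)) (single w p))" for i
  define \<Psi> where "\<Psi> h = (case h of None \<Rightarrow> 0 | Some y \<Rightarrow> \<Phi> y)" for h
  have km: "int k < m" using k m_pos by linarith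
  have ui: "u = w \<otimes> (rf (\<rho> (i + int k)) \<otimes> rf (\<rho> i))" for i
    unfolding u_def rf_rf_shift[of i k] ..
  have F1: "F i = \<Psi> (two_path m A B c (i + int k) i)" if "0 \<le> i" "i \<le> m - 1 - int k" for i
    unfolding F_def \<Psi>_def \<Phi>_def using that by (intro T_two_path[OF w c _ _ _ _ ui]) auto
  have F2: "F i = - \<Psi> (two_path m A B c (i + int k - m) i)" if "m - int k \<le> i" "i \<le> m - 1" for i
  proof -
    have neg: "\<rho> (i + int k) = - \<rho> (i + int k - m)" using anti[of "i + int k - m"] by simp
    have "u = w \<otimes> (rf (\<rho> (i + int k - m)) \<otimes> rf (\<rho> i))"
      using ui[of i] unfolding neg rf_minus .
    then have "T (\<rho> i) (T (\<rho> (i + int k - m)) (single w p)) = \<Psi> (two_path m A B c (i + int k - m) i)"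
      unfolding \<Psi>_def \<Phi>_def using that km by (intro T_two_path[OF w c]) auto
    then show ?thesis unfolding F_def neg by (simp add: T_neg[OF \<rho>_root] T_minus)
  qed
  have "(\<Sum>i<nat m. F (int i)) = (\<Sum>i\<in>{0..m - 1}. F i)"
    by (rule sum.reindex_bij_witness[where i = nat and j = int]) (use m_pos in auto)
  also have "{0..m - 1} = {0..m - 1 - int k} \<union> {m - int k..m - 1}" using k km by auto
  also have "(\<Sum>i\<in>\<dots>. F i) = (\<Sum>i\<in>{0..m - 1 - int k}. F i) + (\<Sum>i\<in>{m - int k..m - 1}. F i)"
    by (rule sum.union_disjoint) auto
  also have "(\<Sum>i\<in>{0..m - 1 - int k}. F i) = (\<Sum>i\<in>{0..m - 1 - int k}. \<Psi> (two_path m A B c (i + int k) i))"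
    by (rule sum.cong) (auto simp: F1)
  also have "\<dots> = (\<Sum>y\<leftarrow>positive_paths m A B c (int k). \<Phi> y)"
    unfolding positive_paths_def sum_list_map_filter \<Psi>_def[symmetric]
    by (subst sum_list_distinct_conv_sum_set) auto
  also have "(\<Sum>i\<in>{m - int k..m - 1}. F i) = - (\<Sum>i\<in>{m - int k..m - 1}. \<Psi> (two_path m A B c (i + int k - m) i))"
    unfolding sum_negf[symmetric] by (rule sum.cong) (auto simp: F2)
  also have "(\<Sum>i\<in>{m - int k..m - 1}. \<Psi> (two_path m A B c (i + int k - m) i)) = (\<Sum>y\<leftarrow>negative_paths m A B c (int k). \<Phi> y)"
    unfolding negative_paths_def sum_list_map_filter \<Psi>_def[symmetric]
    by (subst sum_list_distinct_conv_sum_set) auto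
  also have "\<dots> = (\<Sum>y\<leftarrow>positive_paths m A B c (int k). \<Phi> y)"
  proof (rule same_elements_sum[symmetric])
    have "int k \<in> set [1..m div 2]" "c \<in> set [0..2 * m - 1]" using k c by (auto simp: state_def)
    then show "same_elements (positive_paths m A B c (int k)) (negative_paths m A B c (int k))"
      using bspec[OF quadratic_table tbl] by simp
  qed
  finally show ?thesis by (simp add: F_def)
qed

text \<open>\<open>fold\<close> applies the head first, so the list is the path in order. A nonzero
  result needs an edge at every letter, and the length hypothesis on root \<open>k\<close> excludes
  a step down there.\<close>

lemma T_walk:
  assumes k: "0 \<le> k" "k < m" "real (len (rf (\<rho> k))) \<noteq> ht (coroot (\<rho> k)) - 1"
    and "set is \<subseteq> {0..<m}" "w \<in> carrier W" "state w c"
  shows "fold (\<lambda>i. T (\<rho> i)) is (single w p) = 0 \<or> walk m k c is"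
  using assms(4-)
proof (induction "is" arbitrary: w c p)
  case (Cons i "is")
  let ?u = "w \<otimes> rf (\<rho> i)"
  have i: "0 \<le> i" "i < m" using Cons.prems by auto
  have u: "?u \<in> carrier W" "state ?u (next_state m c i)"
    using Cons.prems state_step[of w c i] rf_closed[OF \<rho>_root] by (auto simp: next_state_def)
  have zero: "fold (\<lambda>i. T (\<rho> i)) is 0 = 0" by (induction "is") simp_all
  have IH: "fold (\<lambda>i. T (\<rho> i)) is (single ?u r) = 0 \<or> walk m k (next_state m c i) is" for r
    using Cons.IH[OF _ u] Cons.prems by simp
  consider "T (\<rho> i) (single w p) = 0"
    | "len ?u = len w + 1" "\<exists>r. T (\<rho> i) (single w p) = single ?u r"
    | "real (len w) = real (len ?u) + ht (coroot (\<rho> i)) - 1"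
      "\<exists>r. T (\<rho> i) (single w p) = single ?u r"
    using T_single[OF pos[OF i], of w p] by (auto split: if_splits)
  then show ?case
  proof cases
    case 1
    then show ?thesis by (simp add: zero)
  next
    case 2
    then have "up_step m c i" using up_edge[OF Cons.prems(2,3) i] by simp
    then show ?thesis using 2 IH by auto
  next
    case 3
    have "down_step m c i" using down_edge[OF Cons.prems(2,3) i 3(1)] by simp
    moreover have "i \<noteq> k" using down_steps(2)[OF Cons.prems(2) pos[OF i] 3(1)] k(3) by auto
    ultimately show ?thesis using 3 IH by auto
  qed
qed simp

lemma T_four_term:
  assumes "4 \<le> m" "k = m div 2 - 1" "real (len (rf (\<rho> k))) \<noteq> ht (coroot (\<rho> k)) - 1"
    and "u \<in> {k # [0..2 * k], [0..2 * k] @ [k], k # rev [0..2 * k], rev [0..2 * k] @ [k]}"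
    and w: "w \<in> carrier W"
  shows "fold (\<lambda>i. T (\<rho> i)) u (single w p) = 0"
proof -
  obtain c where c: "state w c" using state_exists[OF w] by blast
  have mm: "m \<in> set [4, 6]" "c \<in> set [0..2 * m - 1]"
    using m_cases assms(1) c by (auto simp: state_def)
  from bspec[OF bspec[OF four_term_table mm(1)] mm(2)]
  have "\<forall>u\<in>set [k # [0..2 * k], [0..2 * k] @ [k], k # rev [0..2 * k], rev [0..2 * k] @ [k]]. \<not> walk m k c u"
    unfolding Let_def assms(2) .
  moreover have "u \<in> set [k # [0..2 * k], [0..2 * k] @ [k], k # rev [0..2 * k], rev [0..2 * k] @ [k]]"
    using assms(4) by (simp only: list.set)
  ultimately have "\<not> walk m k c u" by blast
  moreover have k: "0 \<le> k" "2 * k < m" using mm(1) assms(2) by auto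
  moreover have "set u \<subseteq> {0..<m}" using assms(4) k by auto
  ultimately show ?thesis using T_walk[OF _ _ assms(3) _ w c, of u p] by auto
qed

end

section \<open>The free algebra and its action\<close>

lemma qpolys_zero: "0 \<in> qpolys S"
  and qpolys_one: "1 \<in> qpolys S"
  by (simp_all add: qpolys_def)

lemma qpolys_add: "p \<in> qpolys S \<Longrightarrow> q \<in> qpolys S \<Longrightarrow> p + q \<in> qpolys S"
  using keys_add[of p q] by (auto simp: qpolys_def)

lemma qpolys_minus: "p \<in> qpolys S \<Longrightarrow> - p \<in> qpolys S"
  by (simp add: qpolys_def in_keys_iff)

lemma qpolys_mult:
  assumes "p \<in> qpolys S" "q \<in> qpolys S"
  shows "p * q \<in> qpolys S"
proof -
  have "keys k \<subseteq> S" if k: "k \<in> keys (p * q)" for k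
  proof -
    obtain a b where "k = a + b" "a \<in> keys p" "b \<in> keys q"
      using keys_mult[of p q] k by blast
    then show ?thesis using assms keys_add[of a b] by (fastforce simp: qpolys_def)
  qed
  then show ?thesis by (simp add: qpolys_def)
qed

lemma qpolys_qvar: "s \<in> S \<Longrightarrow> qvar s \<in> qpolys S"
  by (simp add: qpolys_def qvar_def)

lemma qpolys_power: "p \<in> qpolys S \<Longrightarrow> p ^ n \<in> qpolys S"
  by (induction n) (auto simp: qpolys_one qpolys_mult)

lemma qpolys_prod: "(\<And>a. a \<in> A \<Longrightarrow> f a \<in> qpolys S) \<Longrightarrow> prod f A \<in> qpolys S"
  by (induction A rule: infinite_finite_induct) (auto simp: qpolys_one qpolys_mult)

lemma qpolys_q_coroot: "q_coroot S \<alpha> g \<in> qpolys S"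
  unfolding q_coroot_def by (intro qpolys_prod qpolys_power qpolys_qvar)

abbreviation fcarrier :: "'w set \<Rightarrow> 'v set \<Rightarrow> ('v, 'w) free_alg set" where
  "fcarrier S D \<equiv> carrier (free_algebra S D)"

lemma fcarrier_iff: "x \<in> fcarrier S D \<longleftrightarrow>
    (\<forall>u. lookup x u \<in> qpolys S \<and> (lookup x u \<noteq> 0 \<longrightarrow> set (letters u) \<subseteq> D))"
  by (auto simp: free_algebra_def in_keys_iff qpolys_zero)

lemma fcarrier_zero: "0 \<in> fcarrier S D"
  by (simp add: fcarrier_iff qpolys_zero)

lemma fcarrier_add: "x \<in> fcarrier S D \<Longrightarrow> y \<in> fcarrier S D \<Longrightarrow> x + y \<in> fcarrier S D"
  by (auto simp: fcarrier_iff lookup_add qpolys_add) (metis add.left_neutral subsetD)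

lemma fcarrier_minus: "x \<in> fcarrier S D \<Longrightarrow> - x \<in> fcarrier S D"
  by (auto simp: fcarrier_iff qpolys_minus)

lemma fcarrier_single: "c \<in> qpolys S \<Longrightarrow> set (letters u) \<subseteq> D \<Longrightarrow> single u c \<in> fcarrier S D"
  by (auto simp: fcarrier_iff lookup_single when_def qpolys_zero)

lemma fcarrier_sum: "(\<And>a. a \<in> A \<Longrightarrow> f a \<in> fcarrier S D) \<Longrightarrow> sum f A \<in> fcarrier S D"
  by (induction A rule: infinite_finite_induct) (auto simp: fcarrier_zero fcarrier_add)

lemma letters_add: "letters (u + v) = letters u @ letters v"
  by (simp add: plus_word_def)

lemma letters_zero: "letters 0 = []"
  by (simp add: zero_word_def)

lemma fcarrier_mult:
  assumes "x \<in> fcarrier S D" "y \<in> fcarrier S D"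
  shows "x * y \<in> fcarrier S D"
proof -
  have "x * y = (\<Sum>u\<in>keys x. \<Sum>v\<in>keys y.
      single u (lookup x u) * single v (lookup y v))"
    by (subst pm_sum_single[of x], subst pm_sum_single[of y]) (rule sum_product)
  also have "\<dots> \<in> fcarrier S D"
  proof (intro fcarrier_sum)
    fix u v assume "u \<in> keys x" "v \<in> keys y"
    then show "single u (lookup x u) * single v (lookup y v)
        \<in> fcarrier S D"
      unfolding mult_single using assms
      by (intro fcarrier_single qpolys_mult) (simp_all add: fcarrier_iff in_keys_iff letters_add)
  qed
  finally show ?thesis .
qed

lemma fcarrier_gen: "g \<in> D \<Longrightarrow> gen g \<in> fcarrier S D"
  unfolding gen_def by (rule fcarrier_single) (auto simp: qpolys_one)

lemma fcarrier_scal: "p \<in> qpolys S \<Longrightarrow> scal p \<in> fcarrier S D"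
  unfolding scal_def by (rule fcarrier_single) (auto simp: letters_zero)

lemma fcarrier_one: "1 \<in> fcarrier S D"
  using fcarrier_scal[OF qpolys_one] by (simp add: scal_def)

lemma fcarrier_prod_list: "(\<And>x. x \<in> set xs \<Longrightarrow> x \<in> fcarrier S D) \<Longrightarrow> prod_list xs \<in> fcarrier S D"
  by (induction xs) (auto simp: fcarrier_one fcarrier_mult)

lemma free_algebra_ops:
  "mult (free_algebra S D) = (*)" "one (free_algebra S D) = 1"
  "zero (free_algebra S D) = 0" "add (free_algebra S D) = (+)"
  by (simp_all add: free_algebra_def)

lemma ring_free_algebra: "ring (free_algebra S D)"
proof (rule ringI)
  show "abelian_group (free_algebra S D)"
    by (rule abelian_groupI)
      (auto simp: free_algebra_ops fcarrier_add fcarrier_zero add_ac intro!: bexI[OF _ fcarrier_minus])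
  show "monoid (free_algebra S D)"
    by (rule monoidI) (auto simp: free_algebra_ops fcarrier_mult fcarrier_one mult.assoc)
qed (auto simp: free_algebra_ops algebra_simps)

section \<open>Evaluation of the free algebra at operators\<close>

definition ev :: "('v \<Rightarrow> ('k \<Rightarrow>\<^sub>0 'w qpoly) \<Rightarrow> ('k \<Rightarrow>\<^sub>0 'w qpoly)) \<Rightarrow> ('v, 'w) free_alg \<Rightarrow>
    ('k \<Rightarrow>\<^sub>0 'w qpoly) \<Rightarrow> ('k \<Rightarrow>\<^sub>0 'w qpoly)" where
  "ev T x v = lin (\<lambda>u. foldr T (letters u) v) x"

lemma ev_single: "ev T (single u p) v = smul p (foldr T (letters u) v)"
  by (simp add: ev_def)

lemma ev_zero: "ev T 0 v = 0"
  and ev_add: "ev T (x + y) v = ev T x v + ev T y v"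
  and ev_minus: "ev T (- x) v = - ev T x v"
  and ev_sum: "ev T (sum f A) v = (\<Sum>a\<in>A. ev T (f a) v)"
  by (simp_all add: ev_def lin_add lin_minus lin_sum)

lemma ev_diff: "ev T (x - y) v = ev T x v - ev T y v"
  using ev_add[of T x "- y" v] by (simp add: ev_minus)

lemma ev_gen: "ev T (gen g) v = T g v"
  by (simp add: gen_def ev_single)

lemma ev_scal: "ev T (scal p) v = smul p v"
  by (simp add: scal_def ev_single letters_zero)

lemma ev_one: "ev T 1 v = v"
  using ev_scal[of T 1 v] by (simp add: scal_def)

locale linear_family =
  fixes T :: "'v \<Rightarrow> ('k \<Rightarrow>\<^sub>0 'w qpoly) \<Rightarrow> ('k \<Rightarrow>\<^sub>0 'w qpoly)"
  assumes add: "T g (x + y) = T g x + T g y" and smul: "T g (smul p x) = smul p (T g x)"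
begin

lemma foldr_add: "foldr T gs (x + y) = foldr T gs x + foldr T gs y"
  by (induction gs) (simp_all add: add)

lemma foldr_smul: "foldr T gs (smul p x) = smul p (foldr T gs x)"
  by (induction gs) (simp_all add: smul)

lemma ev_add_right: "ev T x (v + v') = ev T x v + ev T x v'"
  by (simp add: ev_def lin_def foldr_add smul_add_right sum.distrib)

lemma ev_smul_right: "ev T x (smul p v) = smul p (ev T x v)"
  by (simp add: ev_def lin_def foldr_smul smul_smul smul_sum mult.commute)

lemma ev_mult: "ev T (x * y) v = ev T x (ev T y v)"
proof (induction x rule: pm_induct)
  case (single u c)
  show ?case
  proof (induction y rule: pm_induct)
    case (single u' c')
    show ?case by (simp add: mult_single ev_single letters_add foldr_smul smul_smul)
  next
    case (add y y')
    then show ?case by (simp add: distrib_left ev_add ev_add_right)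
  qed
next
  case (add x x')
  then show ?case by (simp add: distrib_right ev_add)
qed

lemma ev_prod_gen: "ev T (prod_list (map (\<lambda>i. gen (g i)) is)) v = foldr (\<lambda>i. T (g i)) is v"
  by (induction "is" arbitrary: v) (simp_all add: ev_one ev_mult ev_gen)

lemma ev_expand: "ev T x v = (\<Sum>k\<in>keys v. smul (lookup v k) (ev T x (single k 1)))"
proof -
  have s: "ev T x (sum f A) = (\<Sum>a\<in>A. ev T x (f a))" for f :: "'k \<Rightarrow> _" and A
  proof (induction A rule: infinite_finite_induct)
    have "ev T x 0 = 0" using ev_smul_right[of x 0 0] by simp
    then show "ev T x (sum f {}) = (\<Sum>a\<in>{}. ev T x (f a))" by simp
    then show "infinite A \<Longrightarrow> ev T x (sum f A) = (\<Sum>a\<in>A. ev T x (f a))" for A by simp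
  qed (simp add: ev_add_right)
  have "ev T x v = ev T x (\<Sum>k\<in>keys v. smul (lookup v k) (single k 1))"
    using pm_sum_single[of v] by simp
  also have "\<dots> = (\<Sum>k\<in>keys v. smul (lookup v k) (ev T x (single k 1)))"
    by (simp only: s ev_smul_right)
  finally show ?thesis .
qed

end

section \<open>The representation\<close>

context crystallographic_coxeter
begin

sublocale linear_family T
  by unfold_locales (rule T_add T_smul)+

abbreviation M :: "('w \<Rightarrow>\<^sub>0 'w qpoly) set" where "M \<equiv> carrier (W_module W S)"
abbreviation E where "E \<equiv> module_End (qpoly_ring S) (W_module W S)"
abbreviation F :: "('v, 'w) free_alg ring" where "F \<equiv> free_algebra S \<Delta>"
abbreviation I :: "('v, 'w) free_alg set" where "I \<equiv> qBE_ideal W S \<alpha> act"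
abbreviation Q :: "('v, 'w) free_alg set ring" where "Q \<equiv> qBE W S \<alpha> act"
abbreviation cls :: "('v, 'w) free_alg \<Rightarrow> ('v, 'w) free_alg set" where "cls \<equiv> qBE_class W S \<alpha> act"

lemma M_iff: "x \<in> M \<longleftrightarrow> (\<forall>w. lookup x w \<in> qpolys S \<and> (lookup x w \<noteq> 0 \<longrightarrow> w \<in> carrier W))"
  by (auto simp: W_module_def in_keys_iff subset_iff)

lemma M_zero: "0 \<in> M"
  by (simp add: M_iff qpolys_zero)

lemma M_add: "x \<in> M \<Longrightarrow> y \<in> M \<Longrightarrow> x + y \<in> M"
  by (auto simp: M_iff lookup_add qpolys_add) (metis add.left_neutral)

lemma M_minus: "x \<in> M \<Longrightarrow> - x \<in> M"
  by (auto simp: M_iff qpolys_minus)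

lemma M_smul: "p \<in> qpolys S \<Longrightarrow> x \<in> M \<Longrightarrow> smul p x \<in> M"
  by (auto simp: M_iff qpolys_mult dest: mult_not_zero)

lemma M_single: "p \<in> qpolys S \<Longrightarrow> w \<in> carrier W \<Longrightarrow> single w p \<in> M"
  by (auto simp: M_iff lookup_single when_def qpolys_zero)

lemma M_sum: "(\<And>a. a \<in> A \<Longrightarrow> f a \<in> M) \<Longrightarrow> sum f A \<in> M"
  by (induction A rule: infinite_finite_induct) (auto simp: M_zero M_add)

lemma M_ops: "add (W_module W S) = (+)" "zero (W_module W S) = 0" "smult (W_module W S) = smul"
  by (simp_all add: W_module_def smul_def fun_eq_iff)

lemma M_keys: "x \<in> M \<Longrightarrow> k \<in> keys x \<Longrightarrow> k \<in> carrier W \<and> lookup x k \<in> qpolys S"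
  by (auto simp: M_iff in_keys_iff)

lemma T_closed:
  assumes "g \<in> \<Delta>" "x \<in> M"
  shows "T g x \<in> M"
proof -
  have b: "s_tilde_basis W S \<alpha> act h w \<in> M" if "h \<in> P" "w \<in> carrier W" for h w
    using that rf_closed[OF P_\<Delta>[OF that(1)]]
    by (auto simp: s_tilde_basis_alt qwt_coroot intro!: M_single M_zero qpolys_one qpolys_q_coroot)
  have l: "lin (s_tilde_basis W S \<alpha> act h) x \<in> M" if "h \<in> P" for h
    unfolding lin_def using M_keys[OF assms(2)] b[OF that] by (intro M_sum M_smul) auto
  show ?thesis
    using l[of g] M_minus[OF l[of "- g"]] neg_P_iff[OF assms(1)] by (auto simp: T_def)
qed

lemma ev_closed:
  assumes "x \<in> carrier F" "v \<in> M"
  shows "ev T x v \<in> M"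
proof -
  have f: "set gs \<subseteq> \<Delta> \<Longrightarrow> foldr T gs v \<in> M" for gs
    by (induction gs) (auto simp: assms T_closed)
  show ?thesis unfolding ev_def lin_def
    using assms(1) by (intro M_sum M_smul f) (auto simp: fcarrier_iff in_keys_iff)
qed

lemma ev_vanish:
  assumes "\<And>w. w \<in> carrier W \<Longrightarrow> ev T x (single w 1) = 0" "v \<in> M"
  shows "ev T x v = 0"
  unfolding ev_expand[of x v] using assms M_keys by (intro sum.neutral) auto

lemma ev_four_term: "ev T (four_term k g) v =
    foldr (\<lambda>i. T (g i)) (k # [0..<2 * k + 1]) v + foldr (\<lambda>i. T (g i)) ([0..<2 * k + 1] @ [k]) v
    + foldr (\<lambda>i. T (g i)) (k # rev [0..<2 * k + 1]) v + foldr (\<lambda>i. T (g i)) (rev [0..<2 * k + 1] @ [k]) v"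
  unfolding four_term_def Let_def by (simp only: ev_add ev_mult ev_prod_gen ev_gen foldr_append foldr.simps o_apply id_apply)

lemma upto_int: "map int [0..<n] = [0..int n - 1]"
proof (induction n)
  case (Suc n)
  then show ?case by (simp add: upto_rec2)
qed simp

lemma four_term_vanish:
  assumes ds: "dihedral_sequence P m g" and m: "4 \<le> m" and k: "k = m div 2 - 1"
    and nq: "real (len (rf (g k))) \<noteq> 2 * (rho W S \<alpha> act \<bullet> coroot (g k)) - 1" and v: "v \<in> M"
  shows "ev T (four_term k g) v = 0"
proof -
  obtain A B \<rho> where f: "fan W S \<alpha> act (int m) A B \<rho>" and \<rho>: "\<And>n. \<rho> (int n) = g n"
    using fan_exists[OF ds] by blast
  interpret fn: fan W S \<alpha> act "int m" A B \<rho> by (rule f)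
  have ik: "int k = int m div 2 - 1" using m k by (simp add: of_nat_diff zdiv_int)
  let ?up = "[0..2 * int k]"
  have up: "map int [0..<2 * k + 1] = ?up" using upto_int[of "2 * k + 1"] by simp
  \<comment> \<open>\<open>ev\<close> applies the last letter first, \<open>fold\<close> the head
    first, hence the reversal. Reversal permutes the four words.\<close>
  have zero: "foldr (\<lambda>i. T (g i)) is (single w 1) = 0"
    if "rev (map int is) \<in> {int k # ?up, ?up @ [int k], int k # rev ?up, rev ?up @ [int k]}" "w \<in> carrier W" for "is" w
  proof -
    have "fold (\<lambda>i. T (\<rho> i)) (rev (map int is)) (single w 1) = 0"
      using fn.T_four_term[OF _ ik _ that] m nq by (simp add: ht_def \<rho>)
    then show ?thesis by (simp add: foldr_conv_fold fold_map rev_map o_def \<rho>)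
  qed
  show ?thesis
  proof (rule ev_vanish[OF _ v])
    fix w assume w: "w \<in> carrier W"
    show "ev T (four_term k g) (single w 1) = 0"
      unfolding ev_four_term
      using zero[OF _ w, of "k # [0..<2 * k + 1]"] zero[OF _ w, of "[0..<2 * k + 1] @ [k]"]
        zero[OF _ w, of "k # rev [0..<2 * k + 1]"] zero[OF _ w, of "rev [0..<2 * k + 1] @ [k]"]
      by (simp only: list.map map_append rev_map[symmetric] up rev.simps rev_append rev_rev_ident
          append.simps insert_iff simp_thms add_0)
  qed
qed

lemma quadratic_vanish:
  assumes ds: "dihedral_sequence P m g" and k: "1 \<le> k" "2 * k \<le> m" and v: "v \<in> M"
  shows "ev T (\<Sum>i<m. gen (g i) * gen (g (i + k))) v = 0"
proof -
  obtain A B \<rho> where f: "fan W S \<alpha> act (int m) A B \<rho>" and \<rho>: "\<And>n. \<rho> (int n) = g n"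
    using fan_exists[OF ds] by blast
  interpret fn: fan W S \<alpha> act "int m" A B \<rho> by (rule f)
  show ?thesis
  proof (rule ev_vanish[OF _ v])
    fix w assume w: "w \<in> carrier W"
    have "2 * int k \<le> int m" using k by linarith
    from fn.T_quadratic[OF w k(1) this, of 1]
    show "ev T (\<Sum>i<m. gen (g i) * gen (g (i + k))) (single w 1) = 0"
      unfolding \<rho> by (simp add: ev_sum ev_mult ev_gen)
  qed
qed

lemma dihedral_roots:
  assumes ds: "dihedral_sequence P m g"
  shows "g i \<in> \<Delta>"
proof -
  obtain A B \<rho> where f: "fan W S \<alpha> act (int m) A B \<rho>" and \<rho>: "\<And>n. \<rho> (int n) = g n"
    using fan_exists[OF ds] by blast
  show ?thesis using fan.\<rho>_root[OF f, of "int i"] \<rho> by simp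
qed

lemma relators_closed: "qBE_relators W S \<alpha> act \<subseteq> carrier F"
proof -
  have g: "gen g \<in> carrier F" if "g \<in> \<Delta>" for g using that by (rule fcarrier_gen)
  have d: "x - y \<in> carrier F" if "x \<in> carrier F" "y \<in> carrier F" for x y
    using fcarrier_add[OF that(1) fcarrier_minus[OF that(2)]] by simp
  have "four_term k h \<in> carrier F" if "dihedral_sequence P m h" for k h m
    unfolding four_term_def Let_def using dihedral_roots[OF that]
    by (intro fcarrier_add fcarrier_mult fcarrier_prod_list g) (auto intro: g)
  moreover have "gen (h i) \<in> carrier F" if "dihedral_sequence P m h" for h i m
    by (rule g[OF dihedral_roots[OF that]])
  ultimately show ?thesis
    unfolding qBE_relators_def relators_neg_def relators_square_def relators_quadratic_def
      relators_four_term_def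
    by (auto intro!: fcarrier_add fcarrier_mult fcarrier_sum d fcarrier_scal qpolys_qvar
        intro: g[OF \<Delta>_neg] g[OF \<alpha>_root] g[OF P_\<Delta>] g)
qed

lemma relators_vanish:
  assumes "r \<in> qBE_relators W S \<alpha> act" "v \<in> M"
  shows "ev T r v = 0"
  using assms(1) unfolding qBE_relators_def
proof (elim UnE)
  assume "r \<in> relators_neg \<Delta>"
  then show ?thesis by (auto simp: relators_neg_def ev_add ev_gen T_neg)
next
  assume "r \<in> relators_square S \<alpha> P"
  then consider s where "s \<in> S" "r = gen (\<alpha> s) * gen (\<alpha> s) - scal (qvar s)"
    | g where "g \<in> P" "g \<notin> \<alpha> ` S" "r = gen g * gen g" unfolding relators_square_def by blast
  then show ?thesis
  proof cases
    case 1
    then show ?thesis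
      by (intro ev_vanish[OF _ assms(2)]) (simp add: ev_diff ev_mult ev_gen ev_scal T_sq_simple)
  next
    case 2
    then show ?thesis
      by (intro ev_vanish[OF _ assms(2)]) (simp add: ev_mult ev_gen T_sq_nonsimple)
  qed
next
  assume "r \<in> relators_quadratic P"
  then show ?thesis unfolding relators_quadratic_def using quadratic_vanish assms(2) by blast
next
  assume "r \<in> relators_four_term W S \<alpha> act"
  then show ?thesis unfolding relators_four_term_def using four_term_vanish assms(2) by blast
qed

text \<open>An ideal that contains the relators contains the ideal generated by them, so evaluation
  descends to the quotient.\<close>

definition kernel :: "('v, 'w) free_alg set" where
  "kernel = {x \<in> carrier F. \<forall>v\<in>M. ev T x v = 0}"

lemma ev_zero_right: "ev T x 0 = 0"
  using ev_smul_right[of x 0 0] by simp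

lemma kernel_ideal: "ideal kernel F"
proof (rule idealI)
  interpret Fr: ring F by (rule ring_free_algebra)
  show "ring F" by (rule ring_free_algebra)
  show "subgroup kernel (add_monoid F)"
  proof (rule group.subgroupI)
    show "group (add_monoid F)" by (rule Fr.a_group)
    show "kernel \<subseteq> carrier (add_monoid F)" by (auto simp: kernel_def)
    show "kernel \<noteq> {}" using fcarrier_zero by (auto simp: kernel_def ev_zero intro!: exI[of _ 0])
  next
    fix a assume a: "a \<in> kernel"
    have "inv\<^bsub>add_monoid F\<^esub> a = - a"
    proof -
      have "\<ominus>\<^bsub>F\<^esub> a = - a"
        using a by (intro Fr.minus_equality) (auto simp: kernel_def free_algebra_ops fcarrier_minus)
      then show ?thesis by (simp add: a_inv_def)
    qed
    then show "inv\<^bsub>add_monoid F\<^esub> a \<in> kernel" using a by (auto simp: kernel_def fcarrier_minus ev_minus)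
  next
    fix a b assume "a \<in> kernel" "b \<in> kernel"
    then show "a \<otimes>\<^bsub>add_monoid F\<^esub> b \<in> kernel"
      by (auto simp: kernel_def free_algebra_ops fcarrier_add ev_add)
  qed
qed (auto simp: kernel_def free_algebra_ops fcarrier_mult ev_mult ev_zero_right ev_closed)

lemma I_kernel: "I \<subseteq> kernel"
  unfolding qBE_ideal_def
  using relators_closed relators_vanish
  by (intro ring.genideal_minimal[OF ring_free_algebra kernel_ideal]) (auto simp: kernel_def)

lemma I_ideal: "ideal I F"
  unfolding qBE_ideal_def by (rule ring.genideal_ideal[OF ring_free_algebra relators_closed])

lemma cls_hom: "cls \<in> ring_hom F Q"
  using ideal.rcos_ring_hom[OF I_ideal] unfolding qBE_def qBE_class_def[abs_def] .

lemma cls_surj: "X \<in> carrier Q \<Longrightarrow> \<exists>x\<in>carrier F. X = cls x"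
  by (auto simp: qBE_def qBE_class_def FactRing_def A_RCOSETS_def')

lemma cls_eq:
  assumes "x \<in> carrier F" "y \<in> carrier F" "cls x = cls y" "v \<in> M"
  shows "ev T x v = ev T y v"
proof -
  interpret id: ideal I F by (rule I_ideal)
  have "x \<in> cls x" unfolding qBE_class_def using assms(1) by (rule id.a_rcos_self)
  then have "x \<in> I +>\<^bsub>F\<^esub> y" using assms(3) by (simp add: qBE_class_def)
  then obtain h where "h \<in> I" "x = h + y" by (auto simp: a_r_coset_def' free_algebra_ops)
  then show ?thesis using I_kernel assms(4) by (auto simp: kernel_def ev_add)
qed

definition rep :: "('v, 'w) free_alg \<Rightarrow> ('w \<Rightarrow>\<^sub>0 'w qpoly) \<Rightarrow> ('w \<Rightarrow>\<^sub>0 'w qpoly)" where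
  "rep x = (\<lambda>v\<in>M. ev T x v)"

text \<open>The chosen representative is irrelevant by \<open>cls_eq\<close>; the restriction to the
  carrier gives the extensionality on which uniqueness depends.\<close>

definition qrep :: "('v, 'w) free_alg set \<Rightarrow> ('w \<Rightarrow>\<^sub>0 'w qpoly) \<Rightarrow> ('w \<Rightarrow>\<^sub>0 'w qpoly)" where
  "qrep = (\<lambda>X\<in>carrier Q. rep (SOME x. x \<in> carrier F \<and> X = cls x))"

lemma cls_closed: "x \<in> carrier F \<Longrightarrow> cls x \<in> carrier Q"
  using cls_hom by (rule ring_hom_closed)

lemma qrep_cls:
  assumes "x \<in> carrier F"
  shows "qrep (cls x) = rep x"
proof -
  let ?y = "SOME y. y \<in> carrier F \<and> cls x = cls y"
  have y: "?y \<in> carrier F \<and> cls x = cls ?y" by (rule someI[of _ x]) (use assms in simp)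
  have "rep ?y = rep x"
    unfolding rep_def using cls_eq[OF conjunct1[OF y] assms conjunct2[OF y, symmetric]]
    by (intro restrict_ext)
  then show ?thesis using cls_closed[OF assms] by (simp add: qrep_def)
qed

lemma rep_hom: "rep \<in> ring_hom F E"
proof (rule ring_hom_memI)
  show "rep x \<in> carrier E" if "x \<in> carrier F" for x
    using that
    by (auto simp: rep_def module_End_def qpoly_ring_def M_ops ev_closed M_add M_smul ev_add_right ev_smul_right)
  show "rep (x \<otimes>\<^bsub>F\<^esub> y) = rep x \<otimes>\<^bsub>E\<^esub> rep y" if "x \<in> carrier F" "y \<in> carrier F" for x y
    using that by (auto simp: rep_def module_End_def compose_def free_algebra_ops ev_mult ev_closed intro!: restrict_ext)
  show "rep (x \<oplus>\<^bsub>F\<^esub> y) = rep x \<oplus>\<^bsub>E\<^esub> rep y" if "x \<in> carrier F" "y \<in> carrier F" for x y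
    by (auto simp: rep_def module_End_def free_algebra_ops ev_add M_ops intro!: restrict_ext)
  show "rep \<one>\<^bsub>F\<^esub> = \<one>\<^bsub>E\<^esub>"
    by (auto simp: rep_def module_End_def free_algebra_ops ev_one intro!: restrict_ext)
qed

lemma qrep_hom: "qrep \<in> ring_hom Q E"
proof (rule ring_hom_memI)
  fix X Y assume "X \<in> carrier Q" "Y \<in> carrier Q"
  then obtain x y where xy: "x \<in> carrier F" "X = cls x" "y \<in> carrier F" "Y = cls y"
    using cls_surj by metis
  show "qrep X \<in> carrier E" using xy ring_hom_closed[OF rep_hom] by (simp add: qrep_cls)
  have c: "x \<otimes>\<^bsub>F\<^esub> y \<in> carrier F" "x \<oplus>\<^bsub>F\<^esub> y \<in> carrier F"
    using xy by (auto simp: free_algebra_ops fcarrier_mult fcarrier_add)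
  show "qrep (X \<otimes>\<^bsub>Q\<^esub> Y) = qrep X \<otimes>\<^bsub>E\<^esub> qrep Y"
    using xy c ring_hom_mult[OF cls_hom xy(1,3)] ring_hom_mult[OF rep_hom xy(1,3)]
    by (metis qrep_cls)
  show "qrep (X \<oplus>\<^bsub>Q\<^esub> Y) = qrep X \<oplus>\<^bsub>E\<^esub> qrep Y"
    using xy c ring_hom_add[OF cls_hom xy(1,3)] ring_hom_add[OF rep_hom xy(1,3)]
    by (metis qrep_cls)
next
  have "\<one>\<^bsub>F\<^esub> \<in> carrier F" by (simp add: free_algebra_ops fcarrier_one)
  then show "qrep \<one>\<^bsub>Q\<^esub> = \<one>\<^bsub>E\<^esub>"
    using ring_hom_one[OF cls_hom] ring_hom_one[OF rep_hom] qrep_cls by metis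
qed

lemma s_tilde_T: "g \<in> P \<Longrightarrow> s_tilde W S \<alpha> act g = (\<lambda>v\<in>M. T g v)"
  unfolding s_tilde_def by (intro restrict_ext) (simp add: M_ops T_def lin_def)

lemma rep_gen: "rep (gen g) = (\<lambda>v\<in>M. T g v)"
  by (simp add: rep_def ev_gen)

text \<open>The additive inverse unfolds to a definite description, so an inverse is exhibited and
  its uniqueness is read off pointwise.\<close>

lemma End_minus:
  assumes "g \<in> \<Delta>"
  shows "\<ominus>\<^bsub>E\<^esub> (\<lambda>v\<in>M. T g v) = (\<lambda>v\<in>M. T (- g) v)"
  unfolding a_inv_def m_inv_def
proof (rule the_equality)
  have c: "rep (gen (- g)) \<in> carrier E"
    by (rule ring_hom_closed[OF rep_hom fcarrier_gen[OF \<Delta>_neg[OF assms]]])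
  have "(\<lambda>v\<in>M. T g v) \<oplus>\<^bsub>E\<^esub> (\<lambda>v\<in>M. T (- g) v) = \<zero>\<^bsub>E\<^esub>" "(\<lambda>v\<in>M. T (- g) v) \<oplus>\<^bsub>E\<^esub> (\<lambda>v\<in>M. T g v) = \<zero>\<^bsub>E\<^esub>"
    using assms by (auto simp: module_End_def M_ops T_neg intro!: restrict_ext)
  then show "(\<lambda>v\<in>M. T (- g) v) \<in> carrier (add_monoid E) \<and>
    (\<lambda>v\<in>M. T g v) \<otimes>\<^bsub>add_monoid E\<^esub> (\<lambda>v\<in>M. T (- g) v) = \<one>\<^bsub>add_monoid E\<^esub> \<and>
    (\<lambda>v\<in>M. T (- g) v) \<otimes>\<^bsub>add_monoid E\<^esub> (\<lambda>v\<in>M. T g v) = \<one>\<^bsub>add_monoid E\<^esub>"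
    using c by (simp add: rep_gen)
next
  fix f assume "f \<in> carrier (add_monoid E) \<and>
    (\<lambda>v\<in>M. T g v) \<otimes>\<^bsub>add_monoid E\<^esub> f = \<one>\<^bsub>add_monoid E\<^esub> \<and>
    f \<otimes>\<^bsub>add_monoid E\<^esub> (\<lambda>v\<in>M. T g v) = \<one>\<^bsub>add_monoid E\<^esub>"
  then have f: "f \<in> extensional M" "(\<lambda>v\<in>M. T g v) \<oplus>\<^bsub>E\<^esub> f = \<zero>\<^bsub>E\<^esub>"
    by (auto simp: module_End_def PiE_def)
  show "f = (\<lambda>v\<in>M. T (- g) v)"
  proof (rule extensionalityI[OF f(1)])
    fix v assume v: "v \<in> M"
    have "T g v + f v = 0" using fun_cong[OF f(2), of v] v by (simp add: module_End_def M_ops)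
    then show "f v = (\<lambda>v\<in>M. T (- g) v) v" using v assms by (simp add: T_neg eq_neg_iff_add_eq_0 add.commute)
  qed simp
qed

text \<open>The elements on whose classes both maps agree are closed under sums and products.
  Scalars and generators give all monomials, and these give the whole free algebra.\<close>

lemma hom_unique:
  assumes \<phi>: "\<phi> \<in> extensional (carrier Q)" "\<phi> \<in> ring_hom Q E"
    and \<psi>: "\<psi> \<in> extensional (carrier Q)" "\<psi> \<in> ring_hom Q E"
    and scal: "\<And>p. p \<in> qpolys S \<Longrightarrow> \<phi> (cls (scal p)) = \<psi> (cls (scal p))"
    and gen: "\<And>g. g \<in> \<Delta> \<Longrightarrow> \<phi> (cls (gen g)) = \<psi> (cls (gen g))"
  shows "\<phi> = \<psi>"
proof (rule extensionalityI[OF \<phi>(1) \<psi>(1)])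
  fix X assume "X \<in> carrier Q"
  then obtain x where x: "x \<in> carrier F" "X = cls x" using cls_surj by blast
  define A where "A = {x \<in> carrier F. \<phi> (cls x) = \<psi> (cls x)}"
  have add: "x + y \<in> A" if "x \<in> A" "y \<in> A" for x y
  proof -
    have xy: "x \<in> carrier F" "y \<in> carrier F" using that by (auto simp: A_def)
    have "cls (x + y) = cls x \<oplus>\<^bsub>Q\<^esub> cls y"
      using ring_hom_add[OF cls_hom xy] by (simp add: free_algebra_ops)
    then show ?thesis
      using that ring_hom_add[OF \<phi>(2)] ring_hom_add[OF \<psi>(2)] cls_closed
      by (simp add: A_def fcarrier_add)
  qed
  have mult: "x * y \<in> A" if "x \<in> A" "y \<in> A" for x y
  proof -
    have xy: "x \<in> carrier F" "y \<in> carrier F" using that by (auto simp: A_def)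
    have "cls (x * y) = cls x \<otimes>\<^bsub>Q\<^esub> cls y"
      using ring_hom_mult[OF cls_hom xy] by (simp add: free_algebra_ops)
    then show ?thesis
      using that ring_hom_mult[OF \<phi>(2)] ring_hom_mult[OF \<psi>(2)] cls_closed
      by (simp add: A_def fcarrier_mult)
  qed
  have sc: "scal p \<in> A" if "p \<in> qpolys S" for p using that scal by (simp add: A_def fcarrier_scal)
  have mono: "single (Word gs) c \<in> A" if "c \<in> qpolys S" "set gs \<subseteq> \<Delta>" for gs c
    using that(2)
  proof (induction gs rule: rev_induct)
    case Nil
    then show ?case using sc[OF that(1)] by (simp add: scal_def zero_word_def)
  next
    case (snoc g gs)
    have "single (Word gs) c * gen g \<in> A"
      using snoc gen by (intro mult) (auto simp: A_def fcarrier_gen)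
    then show ?case by (simp add: gen_def mult_single plus_word_def)
  qed
  have sum: "sum h B \<in> A" if "finite B" "\<And>u. u \<in> B \<Longrightarrow> h u \<in> A" for h :: "'v word \<Rightarrow> _" and B
    using that
  proof (induction B rule: finite_induct)
    case empty
    have "scal 0 \<in> A" using sc qpolys_zero by blast
    then show ?case by (simp add: scal_def)
  qed (auto intro: add)
  have "x \<in> A"
  proof (subst pm_sum_single[of x], rule sum)
    fix u assume "u \<in> keys x"
    then show "single u (lookup x u) \<in> A"
      using mono[of "lookup x u" "letters u"] x(1) by (simp add: fcarrier_iff in_keys_iff)
  qed simp
  then show "\<phi> X = \<psi> X" using x by (simp add: A_def)
qed

theorem representation:
  "\<exists>!\<phi>. \<phi> \<in> extensional (carrier Q) \<and> \<phi> \<in> ring_hom Q E \<and>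
      (\<forall>p\<in>qpolys S. \<phi> (cls (scal p)) = (\<lambda>x\<in>M. p \<odot>\<^bsub>W_module W S\<^esub> x)) \<and>
      (\<forall>g\<in>P. \<phi> (cls (gen g)) = s_tilde W S \<alpha> act g \<and>
         \<phi> (cls (gen (- g))) = \<ominus>\<^bsub>E\<^esub> s_tilde W S \<alpha> act g)"
  (is "\<exists>!\<phi>. ?rep \<phi>")
proof (rule ex_ex1I)
  have "qrep \<in> extensional (carrier Q)" by (simp add: qrep_def)
  moreover have "qrep (cls (scal p)) = (\<lambda>x\<in>M. p \<odot>\<^bsub>W_module W S\<^esub> x)" if "p \<in> qpolys S" for p
    using that by (simp add: qrep_cls fcarrier_scal rep_def ev_scal M_ops)
  moreover have "qrep (cls (gen g)) = s_tilde W S \<alpha> act g \<and>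
      qrep (cls (gen (- g))) = \<ominus>\<^bsub>E\<^esub> s_tilde W S \<alpha> act g" if "g \<in> P" for g
    using that P_\<Delta>[OF that] by (simp add: qrep_cls fcarrier_gen \<Delta>_neg rep_gen s_tilde_T End_minus)
  ultimately show "\<exists>\<phi>. ?rep \<phi>"
    using qrep_hom by blast
next
  fix \<phi> \<psi> assume a: "?rep \<phi>" and b: "?rep \<psi>"
  show "\<phi> = \<psi>"
  proof (rule hom_unique)
    fix g assume g: "g \<in> \<Delta>"
    then consider "g \<in> P" | "- g \<in> P" using \<Delta>_cases by blast
    then show "\<phi> (cls (gen g)) = \<psi> (cls (gen g))"
    proof cases
      case 1
      then show ?thesis using a b by simp
    next
      case 2
      then have "\<phi> (cls (gen (- (- g)))) = \<psi> (cls (gen (- (- g))))" using a b by metis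
      then show ?thesis by simp
    qed
  qed (use a b in auto)
qed

end

theorem theorem7p1:
  fixes W :: "('w, 'b) monoid_scheme" and S :: "'w set"
    and \<alpha> :: "'w \<Rightarrow> 'v::real_inner" and act :: "'w \<Rightarrow> 'v \<Rightarrow> 'v"
  assumes "coxeter_system W S" and "finite (carrier W)"
    and "reflection_realization W S \<alpha> act"
    and "crystallographic (roots W S \<alpha> act)"
  shows "\<exists>!\<phi>. \<phi> \<in> extensional (carrier (qBE W S \<alpha> act)) \<and>
      \<phi> \<in> ring_hom (qBE W S \<alpha> act) (module_End (qpoly_ring S) (W_module W S)) \<and>
      (\<forall>p\<in>qpolys S. \<phi> (qBE_class W S \<alpha> act (scal p)) =
         (\<lambda>x\<in>carrier (W_module W S). p \<odot>\<^bsub>W_module W S\<^esub> x)) \<and>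
      (\<forall>g\<in>pos_roots W S \<alpha> act.
         \<phi> (qBE_class W S \<alpha> act (gen g)) = s_tilde W S \<alpha> act g \<and>
         \<phi> (qBE_class W S \<alpha> act (gen (- g))) =
           \<ominus>\<^bsub>module_End (qpoly_ring S) (W_module W S)\<^esub> s_tilde W S \<alpha> act g)"
proof -
  interpret crystallographic_coxeter W S \<alpha> act
    using assms by unfold_locales
  show ?thesis by (rule representation)
qed

end
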